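(* Suppose that: (i) $\sup_{k\ge1}\|\psi_k\|_\infty<\infty$; (ii) there are $\lambda\in\mathbb R$ and $K_0>0$, independent of $n$ and $p$, such that for all $n,p$ the matrix $\Psi\in\mathbb R^{p\times p}$, $\Psi_{k\ell}=\sum_{j=1}^n\psi_k(j/n)\psi_\ell(j/n)$, satisfies $|u^\top(\Psi-nI_p)u|\le K_0\sum_{k=1}^pk^\lambda u_k^2$ for all $u\in\mathbb R^p$; (iii) $\|\mathcal Rq_{\hat\theta}\|_\infty\le C_0$ for a constant $C_0$ independent of $n$ and $p$. Suppose $2\gamma+2\beta>\max(2,\lambda+1)$, and let $m=n^{1/(2\beta+2\gamma)}$, $\gamma_0^*=\gamma-\frac12-\frac1{2m}$, and $m_0^*=n^{1/(2\beta+2\gamma_0^* )}$. Then there are constants $n_0,c,K>0$ depending only on the problem parameters (not on $n$, $p$ or the data) such that for all $n\ge n_0$, $$\mathrm{TV}(\pi_f,\gamma_f)\le K\,\frac{(m\wedge p)\sqrt{m_0^*\wedge p}}{\sqrt n}$$ whenever $(m\wedge p)\sqrt{m_0^*\wedge p}/\sqrt n\le c$.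
   Context: Operator. $\mathcal R:E\to L^2[0,1]$ is a compact linear operator, $E$ a linear subspace of $L^2[0,1]$; $\phi_k$, $k\ge1$, is a complete orthonormal basis of $E$ of eigenfunctions of $\mathcal R^\top\mathcal R$ with eigenvalues $\lambda_1\ge\lambda_2\ge\dots>0$ satisfying $c'k^{-2\beta}\le\lambda_k\le C'k^{-2\beta}$ for all $k$ (constants $0<c'<C'$, $\beta\ge0$). Put $\psi_k=\mathcal R\phi_k/\sqrt{\lambda_k}$ (orthonormal in $L^2[0,1]$); these functions are taken to be defined pointwise on $[0,1]$, and $\|\cdot\|_\infty$ is the sup norm on $[0,1]$. Exponential family. $\rho(dy\mid s)=\exp(sy-h(s))\mu(dy)$, $y\in\mathcal Y\subset\mathbb R$, with $h(s)=\log\int e^{sy}\mu(dy)$ finite for all $s\in\mathbb R$; $h$ is infinitely differentiable and strictly convex with $h''>0$. Posterior. Given integers $n,p\ge1$ and data $Y_1,\dots,Y_n\in\mathcal Y$, for $\theta\in\mathbb R^p$ let $q_\theta=\sum_{k=1}^p\theta_k\phi_k$ and let $R\in\mathbb R^{n\times p}$, $R_{jk}=(\mathcal R\phi_k)(j/n)$, with rows $R_j^\top$, so $R_j^\top\theta=(\mathcal Rq_\theta)(j/n)$. Let $L(\theta)=\sum_{j=1}^n[h(R_j^\top\theta)-Y_jR_j^\top\theta]$, $G^2=\mathrm{diag}(k^{2\gamma})_{k=1}^p$ with $\gamma\ge0$, and $f(\theta)=L(\theta)+\frac12\|G\theta\|^2$, which is strongly convex with unique minimizer $\hat\theta$. Let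 $\pi_f\propto e^{-f}$ (the posterior) and $\gamma_f=\mathcal N(\hat\theta,\nabla^2f(\hat\theta)^{-1})$ (its Laplace approximation). $\mathrm{TV}$ is total variation distance, $\sup_A|\mu(A)-\nu(A)|$. $x\wedge y=\min(x,y)$. "Problem parameters" means: the operator $\mathcal R$ (hence $\beta,c',C',\phi_k,\psi_k$), the function $h$, $\gamma$, $\lambda$, and the constants $K_0$, $C_0$, $\sup_k\|\psi_k\|_\infty$. The statement is for any $p$ and any data for which (iii) holds. *)

theory Defs
  imports "HOL-Probability.Probability"
begin

(* Elements of L^2[0,1] are represented by square-integrable functions, and equality in L^2[0,1]
   is equality almost everywhere on [0,1]. *)

definition L2_01 :: "(real \<Rightarrow> real) set" where
  "L2_01 = {f \<in> borel_measurable (lebesgue_on {0..1}).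
              integrable (lebesgue_on {0..1}) (\<lambda>x. (f x)\<^sup>2)}"

definition ip_01 :: "(real \<Rightarrow> real) \<Rightarrow> (real \<Rightarrow> real) \<Rightarrow> real" where
  "ip_01 f g = (\<integral>x. f x * g x \<partial>lebesgue_on {0..1})"

definition norm_01 :: "(real \<Rightarrow> real) \<Rightarrow> real" where
  "norm_01 f = sqrt (ip_01 f f)"

definition L2_subspace :: "(real \<Rightarrow> real) set \<Rightarrow> bool" where
  "L2_subspace E \<longleftrightarrow> E \<subseteq> L2_01 \<and> (\<lambda>x. 0) \<in> E \<and>
     (\<forall>f\<in>E. \<forall>g\<in>E. \<forall>a b. (\<lambda>x. a * f x + b * g x) \<in> E)"

definition L2_closure :: "(real \<Rightarrow> real) set \<Rightarrow> (real \<Rightarrow> real) set" where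
  "L2_closure E = {g \<in> L2_01. \<exists>s. range s \<subseteq> E \<and> (\<lambda>i::nat. norm_01 (\<lambda>x. s i x - g x)) \<longlonglongrightarrow> 0}"

(* The sup norm on [0,1] takes extended real values, so that it is infinite for unbounded
   functions. *)
definition sup_norm :: "(real \<Rightarrow> real) \<Rightarrow> ereal" where
  "sup_norm g = (SUP x\<in>{0..1}. ereal \<bar>g x\<bar>)"

(* The image functions R f are evaluated at the points j/n, so R selects a pointwise defined
   representative of each image, and it is linear as a map into functions on [0,1]. This is what
   makes (R q)(x) for q = sum_k theta_k phi_k equal to sum_k theta_k (R phi_k)(x) at every x.
   R need not send almost everywhere equal functions to identical functions; that it sends them to
   almost everywhere equal functions follows from linearity and compactness. *)
definition compact_linear_op :: "(real \<Rightarrow> real) set \<Rightarrow> ((real \<Rightarrow> real) \<Rightarrow> real \<Rightarrow> real) \<Rightarrow> bool" where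
  "compact_linear_op E R \<longleftrightarrow>
     (\<forall>f\<in>E. R f \<in> L2_01) \<and>
     (\<forall>f\<in>E. \<forall>g\<in>E. \<forall>a b. \<forall>x\<in>{0..1}. R (\<lambda>t. a * f t + b * g t) x = a * R f x + b * R g x) \<and>
     (\<forall>s B. (\<forall>i::nat. s i \<in> E \<and> norm_01 (s i) \<le> B) \<longrightarrow>
        (\<exists>r g. strict_mono r \<and> g \<in> L2_01 \<and>
               (\<lambda>i. norm_01 (\<lambda>x. R (s (r i)) x - g x)) \<longlonglongrightarrow> 0))"

(* E need not be closed, so the adjoint of R : E -> L^2[0,1] takes values in the closure of E. *)
definition adjoint_op :: "(real \<Rightarrow> real) set \<Rightarrow> ((real \<Rightarrow> real) \<Rightarrow> real \<Rightarrow> real) \<Rightarrow>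
    ((real \<Rightarrow> real) \<Rightarrow> real \<Rightarrow> real) \<Rightarrow> bool" where
  "adjoint_op E R Rt \<longleftrightarrow>
     (\<forall>g\<in>L2_01. Rt g \<in> L2_closure E \<and> (\<forall>f\<in>E. ip_01 (R f) g = ip_01 f (Rt g)))"

(* Here and below, index 0 of sequences is unused. *)
definition complete_orthonormal_basis :: "(real \<Rightarrow> real) set \<Rightarrow> (nat \<Rightarrow> real \<Rightarrow> real) \<Rightarrow> bool" where
  "complete_orthonormal_basis E \<phi> \<longleftrightarrow>
     (\<forall>k\<ge>1. \<phi> k \<in> E) \<and>
     (\<forall>k\<ge>1. \<forall>l\<ge>1. ip_01 (\<phi> k) (\<phi> l) = (if k = l then 1 else 0)) \<and>
     (\<forall>f\<in>E. (\<lambda>N. norm_01 (\<lambda>x. f x - (\<Sum>k=1..N. ip_01 f (\<phi> k) * \<phi> k x))) \<longlonglongrightarrow> 0)"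

locale inverse_problem =
  fixes E :: "(real \<Rightarrow> real) set"
    and R Rt :: "(real \<Rightarrow> real) \<Rightarrow> real \<Rightarrow> real"
    and \<phi> :: "nat \<Rightarrow> real \<Rightarrow> real"
    and eig :: "nat \<Rightarrow> real"
    and \<beta> c' C' :: real
  assumes subspace: "L2_subspace E"
    and compact_linear: "compact_linear_op E R"
    and adjoint: "adjoint_op E R Rt"
    and basis: "complete_orthonormal_basis E \<phi>"
    and eigenfunction: "\<And>k. k \<ge> 1 \<Longrightarrow> AE x in lebesgue_on {0..1}. Rt (R (\<phi> k)) x = eig k * \<phi> k x"
    and eig_pos: "\<And>k. k \<ge> 1 \<Longrightarrow> 0 < eig k"
    and eig_decreasing: "\<And>k l. 1 \<le> k \<Longrightarrow> k \<le> l \<Longrightarrow> eig l \<le> eig k"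
    and const_ranges: "0 < c'" "c' < C'" "0 \<le> \<beta>"
    and eig_bounds: "\<And>k. k \<ge> 1 \<Longrightarrow>
          c' * real k powr (- 2 * \<beta>) \<le> eig k \<and> eig k \<le> C' * real k powr (- 2 * \<beta>)"

definition psi :: "((real \<Rightarrow> real) \<Rightarrow> real \<Rightarrow> real) \<Rightarrow> (nat \<Rightarrow> real \<Rightarrow> real) \<Rightarrow> (nat \<Rightarrow> real) \<Rightarrow>
    nat \<Rightarrow> real \<Rightarrow> real" where
  "psi R \<phi> eig k = (\<lambda>x. R (\<phi> k) x / sqrt (eig k))"

definition Psi_mat :: "((real \<Rightarrow> real) \<Rightarrow> real \<Rightarrow> real) \<Rightarrow> (nat \<Rightarrow> real \<Rightarrow> real) \<Rightarrow> (nat \<Rightarrow> real) \<Rightarrow>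
    nat \<Rightarrow> nat \<Rightarrow> nat \<Rightarrow> real" where
  "Psi_mat R \<phi> eig n k l =
     (\<Sum>j=1..n. psi R \<phi> eig k (real j / real n) * psi R \<phi> eig l (real j / real n))"

definition exponential_family :: "real set \<Rightarrow> real measure \<Rightarrow> (real \<Rightarrow> real) \<Rightarrow> bool" where
  "exponential_family \<Y> \<mu> h \<longleftrightarrow>
     sets \<mu> = sets (restrict_space borel \<Y>) \<and>
     (\<forall>s. integrable \<mu> (\<lambda>y. exp (s * y)) \<and> 0 < (\<integral>y. exp (s * y) \<partial>\<mu>) \<and>
          h s = ln (\<integral>y. exp (s * y) \<partial>\<mu>))"

(* Vectors in R^p are functions on {1..p} (extended by undefined), with Lebesgue measure leb p;
   p x p matrices are functions of two indices, of which only the values on {1..p} matter. *)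

abbreviation leb :: "nat \<Rightarrow> (nat \<Rightarrow> real) measure" where
  "leb p \<equiv> \<Pi>\<^sub>M i\<in>{1..p}. lborel"

definition mat_inv :: "nat \<Rightarrow> (nat \<Rightarrow> nat \<Rightarrow> real) \<Rightarrow> nat \<Rightarrow> nat \<Rightarrow> real" where
  "mat_inv p A = (SOME B. \<forall>i\<in>{1..p}. \<forall>j\<in>{1..p}.
      (\<Sum>k=1..p. A i k * B k j) = (if i = j then 1 else 0) \<and>
      (\<Sum>k=1..p. B i k * A k j) = (if i = j then 1 else 0))"

definition partial :: "nat \<Rightarrow> ((nat \<Rightarrow> real) \<Rightarrow> real) \<Rightarrow> (nat \<Rightarrow> real) \<Rightarrow> real" where
  "partial i f \<theta> = deriv (\<lambda>t. f (\<theta>(i := t))) (\<theta> i)"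

definition hessian :: "((nat \<Rightarrow> real) \<Rightarrow> real) \<Rightarrow> (nat \<Rightarrow> real) \<Rightarrow> nat \<Rightarrow> nat \<Rightarrow> real" where
  "hessian f \<theta> i j = partial i (partial j f) \<theta>"

(* The probability measure on R^p whose Lebesgue density is proportional to exp (- V). *)
definition gibbs :: "nat \<Rightarrow> ((nat \<Rightarrow> real) \<Rightarrow> real) \<Rightarrow> (nat \<Rightarrow> real) measure" where
  "gibbs p V =
     density (leb p) (\<lambda>\<theta>. ennreal (exp (- V \<theta>) / (\<integral>\<theta>'. exp (- V \<theta>') \<partial>leb p)))"

(* N(a, S) for a nondegenerate covariance matrix S. *)
definition gaussian :: "nat \<Rightarrow> (nat \<Rightarrow> real) \<Rightarrow> (nat \<Rightarrow> nat \<Rightarrow> real) \<Rightarrow> (nat \<Rightarrow> real) measure" where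
  "gaussian p a S = gibbs p (\<lambda>\<theta>. 1/2 *
     (\<Sum>i=1..p. \<Sum>j=1..p. (\<theta> i - a i) * mat_inv p S i j * (\<theta> j - a j)))"

definition laplace_approx :: "nat \<Rightarrow> ((nat \<Rightarrow> real) \<Rightarrow> real) \<Rightarrow> (nat \<Rightarrow> real) \<Rightarrow> (nat \<Rightarrow> real) measure" where
  "laplace_approx p f \<theta>hat = gaussian p \<theta>hat (mat_inv p (hessian f \<theta>hat))"

definition TV :: "'a measure \<Rightarrow> 'a measure \<Rightarrow> real" where
  "TV M N = (SUP A\<in>sets M. \<bar>measure M A - measure N A\<bar>)"

definition q_fun :: "(nat \<Rightarrow> real \<Rightarrow> real) \<Rightarrow> nat \<Rightarrow> (nat \<Rightarrow> real) \<Rightarrow> real \<Rightarrow> real" where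
  "q_fun \<phi> p \<theta> = (\<lambda>x. \<Sum>k=1..p. \<theta> k * \<phi> k x)"

definition design :: "((real \<Rightarrow> real) \<Rightarrow> real \<Rightarrow> real) \<Rightarrow> (nat \<Rightarrow> real \<Rightarrow> real) \<Rightarrow> nat \<Rightarrow> nat \<Rightarrow> nat \<Rightarrow> real" where
  "design R \<phi> n j k = R (\<phi> k) (real j / real n)"

definition neg_loglik :: "((real \<Rightarrow> real) \<Rightarrow> real \<Rightarrow> real) \<Rightarrow> (nat \<Rightarrow> real \<Rightarrow> real) \<Rightarrow> (real \<Rightarrow> real) \<Rightarrow>
    nat \<Rightarrow> nat \<Rightarrow> (nat \<Rightarrow> real) \<Rightarrow> (nat \<Rightarrow> real) \<Rightarrow> real" where
  "neg_loglik R \<phi> h n p Y \<theta> =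
     (\<Sum>j=1..n. h (\<Sum>k=1..p. design R \<phi> n j k * \<theta> k) - Y j * (\<Sum>k=1..p. design R \<phi> n j k * \<theta> k))"

definition neg_logpost :: "((real \<Rightarrow> real) \<Rightarrow> real \<Rightarrow> real) \<Rightarrow> (nat \<Rightarrow> real \<Rightarrow> real) \<Rightarrow> (real \<Rightarrow> real) \<Rightarrow>
    real \<Rightarrow> nat \<Rightarrow> nat \<Rightarrow> (nat \<Rightarrow> real) \<Rightarrow> (nat \<Rightarrow> real) \<Rightarrow> real" where
  "neg_logpost R \<phi> h \<gamma> n p Y \<theta> =
     neg_loglik R \<phi> h n p Y \<theta> + 1/2 * (\<Sum>k=1..p. real k powr (2 * \<gamma>) * (\<theta> k)\<^sup>2)"

end

theory Submission
  imports Defs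
begin

text \<open>Put \<open>z = \<theta> - \<theta>hat\<close>, \<open>x\<^sub>j = R\<^sub>j\<^sup>T z\<close>, \<open>w\<^sub>j = h''(R\<^sub>j\<^sup>T \<theta>hat)\<close>, \<open>Q = \<Sum> w\<^sub>j x\<^sub>j\<^sup>2\<close> and
  \<open>g = \<parallel>G z\<parallel>\<^sup>2 / 2\<close>. Since \<open>\<theta>hat\<close> is stationary, the posterior density is proportional to
  \<open>exp (- g - \<Sum> D\<^sub>j(x\<^sub>j))\<close>, where \<open>D\<^sub>j\<close> is a Bregman divergence of \<open>h\<close>, and its Laplace approximation to
  \<open>exp (- g - Q / 2)\<close>. By (ii) the Hessian dominates a multiple of \<open>diag(n k\<^sup>-\<^sup>2\<^sup>\<beta> + k\<^sup>2\<^sup>\<gamma>)\<close>, so each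
  \<open>x\<^sub>j\<close> has variance \<open>O(d / n)\<close> with \<open>d = m \<and> p\<close>. As \<open>m\<^sub>0 \<ge> m\<close>, the bound \<open>O(d\<^sup>3\<^sup>/\<^sup>2 / \<surd>n)\<close> suffices.

  The total variation distance is at most twice the normalised \<open>L\<^sup>1\<close> distance of the two unnormalised
  densities, and three regions are distinguished. Where \<open>max |x\<^sub>j| \<le> 1\<close> and \<open>Q \<lesssim> n\<^sup>1\<^sup>/\<^sup>3\<close>, the log ratio is
  \<open>O(\<Sum> |x\<^sub>j|\<^sup>3)\<close>, and its exponential is controlled through
  \<open>\<Sum> |x\<^sub>j|\<^sup>3 \<le> (\<Sum> x\<^sub>j\<^sup>2)\<^sup>1\<^sup>/\<^sup>2 (\<Sum> x\<^sub>j\<^sup>4)\<^sup>1\<^sup>/\<^sup>2\<close> by the mean of the \<open>exp (x\<^sub>j\<^sup>2 / 4 \<sigma>\<^sup>2)\<close>. Elsewhere, convexity of \<open>h\<close>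
  along rays bounds both densities by \<open>exp (- g - \<kappa> Q / 2)\<close>, where \<open>\<kappa>\<close> is of the order of
  \<open>1 / max 1 (max |x\<^sub>j|)\<close>. By Jensen's inequality, passing from \<open>\<kappa> = 1\<close> to \<open>\<kappa>\<close> only costs a factor
  \<open>exp (O(d / \<kappa>))\<close>, whatever the value of \<open>p\<close>, and Gaussian tails beat this factor.\<close>

subsection \<open>Linear algebra over finite index sets\<close>

lemma quadratic_form_insert:
  fixes A :: "'a \<Rightarrow> 'a \<Rightarrow> real"
  assumes "finite J" "a \<notin> J" and sym: "\<And>j. j \<in> J \<Longrightarrow> A j a = A a j"
  shows "(\<Sum>i\<in>insert a J. \<Sum>j\<in>insert a J. z i * A i j * z j) =
    A a a * (z a)\<^sup>2 + 2 * z a * (\<Sum>j\<in>J. A a j * z j) + (\<Sum>i\<in>J. \<Sum>j\<in>J. z i * A i j * z j)"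
proof -
  have "(\<Sum>i\<in>J. z i * A i a * z a) = z a * (\<Sum>j\<in>J. A a j * z j)"
    unfolding sum_distrib_left by (intro sum.cong) (auto simp: sym)
  moreover have "(\<Sum>j\<in>J. z a * A a j * z j) = z a * (\<Sum>j\<in>J. A a j * z j)"
    unfolding sum_distrib_left by (intro sum.cong) auto
  ultimately show ?thesis
    using assms by (simp add: sum.distrib power2_eq_square algebra_simps)
qed

text \<open>Induction on the index set through the Schur complement.\<close>

lemma posdef_solvable:
  fixes A :: "'a \<Rightarrow> 'a \<Rightarrow> real"
  assumes "finite I" "\<And>i j. i \<in> I \<Longrightarrow> j \<in> I \<Longrightarrow> A i j = A j i"
    and "\<And>z. \<exists>i\<in>I. z i \<noteq> 0 \<Longrightarrow> 0 < (\<Sum>i\<in>I. \<Sum>j\<in>I. z i * A i j * z j)"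
  shows "\<exists>u. \<forall>i\<in>I. (\<Sum>j\<in>I. A i j * u j) = v i"
  using assms
proof (induction I arbitrary: A v rule: finite_induct)
  case empty
  then show ?case by simp
next
  case (insert a J)
  note sym = insert.prems(1) and pos = insert.prems(2)
  note quad = quadratic_form_insert[OF insert.hyps, of A, OF sym[OF insertI2 insertI1]]
  have J: "(\<Sum>j\<in>J. A a j * ((\<lambda>_. 0)(a := 1)) j) = 0" "(\<Sum>i\<in>J. \<Sum>j\<in>J. ((\<lambda>_. 0)(a := 1)) i * A i j * ((\<lambda>_. 0)(a := 1)) j) = 0"
    using insert.hyps by (auto intro!: sum.neutral)
  have \<alpha>: "A a a > 0"
  proof -
    have "0 < (\<Sum>i\<in>insert a J. \<Sum>j\<in>insert a J. ((\<lambda>_. 0)(a := 1)) i * A i j * ((\<lambda>_. 0)(a := 1)) j)"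
      by (rule pos) auto
    also have "\<dots> = A a a * (((\<lambda>_. 0)(a := 1)) a)\<^sup>2 + 2 * ((\<lambda>_. 0)(a := 1)) a * 0 + 0"
      by (subst quad) (assumption, simp only: J)
    finally show ?thesis by simp
  qed
  define A' where "A' i j = A i j - A i a * A a j / A a a" for i j
  have A'_row: "(\<Sum>j\<in>J. A' i j * z j) = (\<Sum>j\<in>J. A i j * z j) - A i a / A a a * (\<Sum>j\<in>J. A a j * z j)" for i z
    unfolding A'_def by (simp add: left_diff_distrib sum_subtractf sum_distrib_left mult.assoc)
  have pos': "0 < (\<Sum>i\<in>J. \<Sum>j\<in>J. z i * A' i j * z j)" if "\<exists>i\<in>J. z i \<noteq> 0" for z
  proof -
    define S where "S = (\<Sum>j\<in>J. A a j * z j)"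
    \<comment> \<open>This value at \<open>a\<close> minimises the quadratic form over that
      coordinate, and the minimum is the form of the Schur complement \<open>A'\<close> at
      \<open>z\<close>. Positivity of \<open>A\<close> at \<open>z'\<close> is therefore positivity
      of \<open>A'\<close> at \<open>z\<close>.\<close>
    define z' where "z' = z(a := - S / A a a)"
    have eq: "(\<Sum>j\<in>J. A a j * z' j) = S" "(\<Sum>i\<in>J. \<Sum>j\<in>J. z' i * A i j * z' j) = (\<Sum>i\<in>J. \<Sum>j\<in>J. z i * A i j * z j)"
      unfolding S_def z'_def using insert.hyps by (auto intro!: sum.cong)
    have "(\<Sum>i\<in>J. \<Sum>j\<in>J. z i * A' i j * z j) = (\<Sum>i\<in>J. z i * (\<Sum>j\<in>J. A' i j * z j))"
      by (simp add: sum_distrib_left mult.assoc)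
    also have "\<dots> = (\<Sum>i\<in>J. z i * (\<Sum>j\<in>J. A i j * z j)) - (\<Sum>i\<in>J. A i a * z i) / A a a * S"
      unfolding A'_row S_def[symmetric]
      by (simp add: right_diff_distrib sum_subtractf sum_distrib_right sum_distrib_left sum_divide_distrib mult_ac)
    also have "(\<Sum>i\<in>J. A i a * z i) = S"
      unfolding S_def by (intro sum.cong) (auto simp: sym)
    finally have *: "(\<Sum>i\<in>J. \<Sum>j\<in>J. z i * A' i j * z j) = (\<Sum>i\<in>J. \<Sum>j\<in>J. z i * A i j * z j) - S\<^sup>2 / A a a"
      by (simp add: sum_distrib_left mult.assoc power2_eq_square)
    have "0 < (\<Sum>i\<in>insert a J. \<Sum>j\<in>insert a J. z' i * A i j * z' j)"
      using that insert.hyps by (intro pos) (auto simp: z'_def)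
    also have "\<dots> = A a a * (- S / A a a)\<^sup>2 + 2 * (- S / A a a) * S + (\<Sum>i\<in>J. \<Sum>j\<in>J. z i * A i j * z j)"
      by (subst quad) (auto simp: eq, simp add: z'_def)
    also have "\<dots> = (\<Sum>i\<in>J. \<Sum>j\<in>J. z i * A' i j * z j)"
      unfolding * using \<alpha> by (simp add: field_simps power2_eq_square)
    finally show ?thesis .
  qed
  have "A' i j = A' j i" if "i \<in> J" "j \<in> J" for i j
    unfolding A'_def using that sym[of i j] sym[of a i] sym[of a j] by simp
  \<comment> \<open>The right-hand side is what remains of \<open>v\<close> after eliminating the
    unknown at \<open>a\<close>; \<open>u'\<close> below recovers that unknown by back
    substitution.\<close>
  from insert.IH[OF this pos', of "\<lambda>i. v i - A i a * v a / A a a"]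
  obtain u where u: "\<And>i. i \<in> J \<Longrightarrow> (\<Sum>j\<in>J. A' i j * u j) = v i - A i a * v a / A a a"
    by auto
  define S where "S = (\<Sum>j\<in>J. A a j * u j)"
  define u' where "u' = u(a := (v a - S) / A a a)"
  have u': "(\<Sum>j\<in>J. A i j * u' j) = (\<Sum>j\<in>J. A i j * u j)" for i
    using insert.hyps by (auto intro!: sum.cong simp: u'_def)
  have "(\<Sum>j\<in>insert a J. A i j * u' j) = v i" if "i \<in> insert a J" for i
  proof (cases "i = a")
    case True
    then show ?thesis using insert.hyps \<alpha> u'[of a] by (simp add: S_def[symmetric]) (simp add: u'_def)
  next
    case False
    then have "i \<in> J" using that by auto
    with u[of i] A'_row[of i u] have "(\<Sum>j\<in>J. A i j * u j) = v i - A i a * v a / A a a + A i a / A a a * S"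
      by (simp add: S_def)
    then show ?thesis using insert.hyps \<alpha> u'[of i] by (simp add: u'_def field_simps)
  qed
  then show ?case by blast
qed

lemma mult_sum_delta:
  fixes f :: "'a \<Rightarrow> real"
  assumes "finite I" "i \<in> I"
  shows "(\<Sum>k\<in>I. f k * (if k = i then 1 else 0)) = f i" "(\<Sum>k\<in>I. (if i = k then 1 else 0) * f k) = f i"
proof -
  have "(\<Sum>k\<in>I. f k * (if k = i then 1 else 0)) = (\<Sum>k\<in>I. if k = i then f k else 0)"
    "(\<Sum>k\<in>I. (if i = k then 1 else 0) * f k) = (\<Sum>k\<in>I. if i = k then f k else 0)"
    by (auto intro!: sum.cong)
  then show "(\<Sum>k\<in>I. f k * (if k = i then 1 else 0)) = f i" "(\<Sum>k\<in>I. (if i = k then 1 else 0) * f k) = f i"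
    using assms by simp_all
qed

text \<open>Associativity, \<open>C = C (A B) = (C A) B = B\<close>, with every sum restricted to
  \<open>I\<close> because the matrices are arbitrary outside it.\<close>

lemma left_inverse_eq_right_inverse:
  fixes A B C :: "'a \<Rightarrow> 'a \<Rightarrow> real"
  assumes I: "finite I" "i \<in> I" "j \<in> I"
    and AB: "\<And>i j. i \<in> I \<Longrightarrow> j \<in> I \<Longrightarrow> (\<Sum>k\<in>I. A i k * B k j) = (if i = j then 1 else 0)"
    and CA: "\<And>i j. i \<in> I \<Longrightarrow> j \<in> I \<Longrightarrow> (\<Sum>k\<in>I. C i k * A k j) = (if i = j then 1 else 0)"
  shows "C i j = B i j"
proof -
  have "C i j = (\<Sum>k\<in>I. C i k * (if k = j then 1 else 0))"
    using I by (simp add: mult_sum_delta)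
  also have "\<dots> = (\<Sum>k\<in>I. \<Sum>l\<in>I. C i k * (A k l * B l j))"
    unfolding sum_distrib_left[symmetric] by (intro sum.cong) (auto simp: AB I)
  also have "\<dots> = (\<Sum>l\<in>I. \<Sum>k\<in>I. C i k * A k l * B l j)"
    by (subst sum.swap) (simp add: mult.assoc)
  also have "\<dots> = (\<Sum>l\<in>I. (if i = l then 1 else 0) * B l j)"
    unfolding sum_distrib_right[symmetric] by (intro sum.cong) (auto simp: CA I)
  also have "\<dots> = B i j"
    using I by (simp add: mult_sum_delta)
  finally show ?thesis .
qed

text \<open>Identifies the precision matrix of the Laplace approximation, which is encoded as the
  inverse of an inverse Hessian. Since \<open>mat_inv\<close> is a choice operator, a two-sided
  inverse must be exhibited first; its columns come from \<open>posdef_solvable\<close>, and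
  symmetry makes it two-sided.\<close>

lemma mat_inv_mat_inv:
  assumes sym: "\<And>i j. i \<in> {1..p} \<Longrightarrow> j \<in> {1..p} \<Longrightarrow> A i j = A j i"
    and pos: "\<And>z. \<exists>i\<in>{1..p}. z i \<noteq> 0 \<Longrightarrow> 0 < (\<Sum>i=1..p. \<Sum>j=1..p. z i * A i j * z j)"
    and ij: "i \<in> {1..p}" "j \<in> {1..p}"
  shows "mat_inv p (mat_inv p A) i j = A i j"
proof -
  let ?inv = "\<lambda>A B. \<forall>i\<in>{1..p}. \<forall>j\<in>{1..p}. (\<Sum>k=1..p. A i k * B k j) = (if i = j then 1 else 0) \<and>
      (\<Sum>k=1..p. B i k * A k j) = (if i = j then 1 else (0::real))"
  have "\<forall>j. \<exists>u. \<forall>i\<in>{1..p}. (\<Sum>k\<in>{1..p}. A i k * u k) = (if i = j then 1 else 0)"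
    by (intro allI posdef_solvable sym pos) auto
  \<comment> \<open>\<open>U j\<close> is the column belonging to the unit vector at
    \<open>j\<close>, so the column index comes first until \<open>U\<close> is known to be
    symmetric.\<close>
  then obtain U where U: "\<And>i j. i \<in> {1..p} \<Longrightarrow> (\<Sum>k=1..p. A i k * U j k) = (if i = j then 1 else 0)"
    by metis
  have UA: "(\<Sum>k=1..p. U i k * A k j) = (if i = j then 1 else 0)" if "i \<in> {1..p}" "j \<in> {1..p}" for i j
  proof -
    have "(\<Sum>k=1..p. U i k * A k j) = (\<Sum>k=1..p. A j k * U i k)"
      using that by (intro sum.cong) (auto simp: sym)
    then show ?thesis using U[of j i] that by auto
  qed
  have symU: "U i j = U j i" if "i \<in> {1..p}" "j \<in> {1..p}" for i j
    by (rule left_inverse_eq_right_inverse[of "{1..p}" i j A "\<lambda>k j. U j k" U]) (use that U UA in auto)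
  have AU: "(\<Sum>k=1..p. A i k * U k j) = (if i = j then 1 else 0)" if "i \<in> {1..p}" "j \<in> {1..p}" for i j
  proof -
    have "(\<Sum>k=1..p. A i k * U k j) = (\<Sum>k=1..p. A i k * U j k)"
      using that by (intro sum.cong) (auto simp: symU)
    then show ?thesis using U that by auto
  qed
  have "?inv A U"
    using UA AU by blast
  then have 1: "?inv A (mat_inv p A)"
    unfolding mat_inv_def by (rule someI[of "?inv A"])
  \<comment> \<open>Being inverse to each other is a symmetric relation, so \<open>A\<close> is the
    witness that justifies the second choice as well.\<close>
  then have "?inv (mat_inv p A) A" by blast
  then have 2: "?inv (mat_inv p A) (mat_inv p (mat_inv p A))"
    unfolding mat_inv_def[of p "mat_inv p A"] by (rule someI[of "?inv (mat_inv p A)"])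
  show ?thesis
    by (rule left_inverse_eq_right_inverse[of "{1..p}" i j "mat_inv p A"]) (use 1 2 ij in auto)
qed

subsection \<open>Lebesgue measure and densities\<close>

lemma product_sigma_finite_lborel: "product_sigma_finite (\<lambda>_. lborel)" ..

text \<open>The product measure is determined by boxes, and each factor is translation invariant.
  The restricted abstraction keeps the translate inside the space of the product measure, whose
  elements are \<open>undefined\<close> outside \<open>{1..p}\<close>.\<close>

lemma leb_translate:
  "distr (leb p) (leb p) (\<lambda>z. \<lambda>k\<in>{1..p}. z k + u k) = leb p"
proof (rule product_sigma_finite.PiM_eqI[OF product_sigma_finite_lborel])
  fix A :: "nat \<Rightarrow> real set"
  assume A: "\<And>i. i \<in> {1..p} \<Longrightarrow> A i \<in> sets lborel"
  have [measurable]: "(\<lambda>z. \<lambda>k\<in>{1..p}. z k + u k) \<in> measurable (leb p) (leb p)"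
    by measurable
  have m: "{x. x + u i \<in> A i} \<in> sets lborel" if "i \<in> {1..p}" for i
    using measurable_sets[of "\<lambda>x. x + u i" borel borel "A i"] A[OF that] by (simp add: vimage_def)
  have "(\<lambda>z. \<lambda>k\<in>{1..p}. z k + u k) -` Pi\<^sub>E {1..p} A \<inter> space (leb p) = (\<Pi>\<^sub>E i\<in>{1..p}. {x. x + u i \<in> A i})"
    by (auto simp: space_PiM PiE_iff)
  then have "emeasure (distr (leb p) (leb p) (\<lambda>z. \<lambda>k\<in>{1..p}. z k + u k)) (Pi\<^sub>E {1..p} A) =
      emeasure (leb p) (\<Pi>\<^sub>E i\<in>{1..p}. {x. x + u i \<in> A i})"
    using A by (subst emeasure_distr) (auto intro!: sets_PiM_I_finite)
  also have "\<dots> = (\<Prod>i\<in>{1..p}. emeasure lborel {x. x + u i \<in> A i})"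
    using m by (intro product_sigma_finite.emeasure_PiM[OF product_sigma_finite_lborel]) auto
  also have "\<dots> = (\<Prod>i\<in>{1..p}. emeasure lborel (A i))"
  proof (intro prod.cong refl)
    fix i assume i: "i \<in> {1..p}"
    have "emeasure lborel (A i) = emeasure (distr lborel borel (\<lambda>x. u i + x)) (A i)"
      using lborel_distr_plus[of "u i"] by simp
    also have "\<dots> = emeasure lborel {x. x + u i \<in> A i}"
      using A[OF i] by (subst emeasure_distr) (auto simp: vimage_def add.commute)
    finally show "emeasure lborel {x. x + u i \<in> A i} = emeasure lborel (A i)" by simp
  qed
  finally show "emeasure (distr (leb p) (leb p) (\<lambda>z. \<lambda>k\<in>{1..p}. z k + u k)) (Pi\<^sub>E {1..p} A) =
      (\<Prod>i\<in>{1..p}. emeasure lborel (A i))" .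
qed auto

lemma
  fixes F :: "(nat \<Rightarrow> real) \<Rightarrow> real"
  assumes F[measurable]: "F \<in> borel_measurable (leb p)"
  shows integral_leb_translate: "(\<integral>z. F (\<lambda>k\<in>{1..p}. z k + u k) \<partial>leb p) = (\<integral>z. F z \<partial>leb p)"
    and integrable_leb_translate: "integrable (leb p) F \<Longrightarrow> integrable (leb p) (\<lambda>z. F (\<lambda>k\<in>{1..p}. z k + u k))"
proof -
  have [measurable]: "(\<lambda>z. \<lambda>k\<in>{1..p}. z k + u k) \<in> measurable (leb p) (leb p)"
    by measurable
  show "(\<integral>z. F (\<lambda>k\<in>{1..p}. z k + u k) \<partial>leb p) = (\<integral>z. F z \<partial>leb p)"
    using F by (subst (2) leb_translate[of p u, symmetric], subst integral_distr) auto
  show "integrable (leb p) (\<lambda>z. F (\<lambda>k\<in>{1..p}. z k + u k))" if "integrable (leb p) F"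
    using that F by (subst (asm) leb_translate[of p u, symmetric], subst (asm) integrable_distr_eq) auto
qed

section \<open>Total variation between normalised densities\<close>

lemma measure_density_real:
  assumes "integrable M f" "\<And>x. 0 \<le> f x" "A \<in> sets M"
  shows "measure (density M (\<lambda>x. ennreal (f x))) A = (\<integral>x. indicator A x * f x \<partial>M)"
proof -
  have [measurable]: "f \<in> borel_measurable M" "A \<in> sets M" using assms by auto
  have "emeasure (density M (\<lambda>x. ennreal (f x))) A = (\<integral>\<^sup>+x. ennreal (f x) * indicator A x \<partial>M)"
    by (rule emeasure_density) auto
  also have "\<dots> = (\<integral>\<^sup>+x. ennreal (indicator A x * f x) \<partial>M)"
    by (intro nn_integral_cong) (auto simp: indicator_def)
  also have "\<dots> = ennreal (\<integral>x. indicator A x * f x \<partial>M)"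
    using assms by (intro nn_integral_eq_integral) (auto intro!: integrable_real_mult_indicator simp: mult.commute)
  finally show ?thesis
    using assms by (simp add: measure_def integral_nonneg_AE)
qed

text \<open>One copy of the L1 distance pays for the change of mass of the event, a second one for
  the change of the normalising constant; hence the factor 2. Only the normalising constant of
  \<open>a\<close> enters, and in the application \<open>a\<close> is the Gaussian density.\<close>

lemma TV_density_le:
  fixes a b :: "'a \<Rightarrow> real"
  assumes ab: "integrable M a" "integrable M b" "\<And>x. 0 \<le> a x" "\<And>x. 0 \<le> b x"
    and Z: "0 < (\<integral>x. a x \<partial>M)" "0 < (\<integral>x. b x \<partial>M)"
  shows "TV (density M (\<lambda>x. ennreal (b x / (\<integral>x. b x \<partial>M)))) (density M (\<lambda>x. ennreal (a x / (\<integral>x. a x \<partial>M))))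
    \<le> 2 * (\<integral>x. \<bar>b x - a x\<bar> \<partial>M) / (\<integral>x. a x \<partial>M)"
proof -
  define Za Zb D where "Za = (\<integral>x. a x \<partial>M)" and "Zb = (\<integral>x. b x \<partial>M)" and "D = (\<integral>x. \<bar>b x - a x\<bar> \<partial>M)"
  have Z': "0 < Za" "0 < Zb" using Z by (auto simp: Za_def Zb_def)
  show ?thesis
    unfolding TV_def Za_def[symmetric] Zb_def[symmetric] D_def[symmetric]
  proof (rule cSUP_least)
    fix A assume "A \<in> sets (density M (\<lambda>x. ennreal (b x / Zb)))"
    then have A[measurable]: "A \<in> sets M" by simp
    let ?I = "indicator A :: 'a \<Rightarrow> real"
    have int: "integrable M (\<lambda>x. ?I x * a x)" "integrable M (\<lambda>x. ?I x * b x)"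
      using ab by (auto intro!: integrable_real_mult_indicator simp: mult.commute)
    define Aa Ab where "Aa = (\<integral>x. ?I x * a x \<partial>M)" and "Ab = (\<integral>x. ?I x * b x \<partial>M)"
    have 1: "measure (density M (\<lambda>x. ennreal (b x / Zb))) A = Ab / Zb"
      using ab Z' by (subst measure_density_real) (auto simp: Ab_def)
    have 2: "measure (density M (\<lambda>x. ennreal (a x / Za))) A = Aa / Za"
      using ab Z' by (subst measure_density_real) (auto simp: Aa_def)
    have "\<bar>Ab - Aa\<bar> = \<bar>\<integral>x. ?I x * b x - ?I x * a x \<partial>M\<bar>"
      unfolding Ab_def Aa_def using int by simp
    also have "\<dots> \<le> (\<integral>x. \<bar>?I x * b x - ?I x * a x\<bar> \<partial>M)"
      by (rule integral_abs_bound)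
    also have "\<dots> \<le> D"
      unfolding D_def using int ab by (intro integral_mono integrable_abs Bochner_Integration.integrable_diff) (auto simp: indicator_def)
    finally have d1: "\<bar>Ab - Aa\<bar> \<le> D" .
    have "\<bar>Za - Zb\<bar> = \<bar>\<integral>x. b x - a x \<partial>M\<bar>"
      unfolding Za_def Zb_def using ab by simp
    also have "\<dots> \<le> D"
      unfolding D_def by (rule integral_abs_bound)
    finally have d2: "\<bar>Za - Zb\<bar> \<le> D" .
    have Ab: "0 \<le> Ab" "Ab \<le> Zb"
      unfolding Ab_def Zb_def using int ab by (auto intro!: integral_nonneg_AE integral_mono simp: indicator_def)
    \<comment> \<open>Splitting in this order puts the factor \<open>Ab / Zb\<close>, which is a
      probability and so at most 1, in front of the error of the normalising constant.\<close>
    have "Ab / Zb - Aa / Za = (Ab - Aa) / Za + Ab / Zb * ((Za - Zb) / Za)"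
      using Z' by (simp add: field_simps)
    then have "\<bar>Ab / Zb - Aa / Za\<bar> \<le> \<bar>Ab - Aa\<bar> / Za + Ab / Zb * (\<bar>Za - Zb\<bar> / Za)"
      using Z' Ab by (simp add: abs_mult order.trans[OF abs_triangle_ineq])
    also have "\<dots> \<le> D / Za + 1 * (D / Za)"
      using Z' Ab d1 d2 by (intro add_mono mult_mono divide_right_mono) auto
    finally show "\<bar>measure (density M (\<lambda>x. ennreal (b x / Zb))) A - measure (density M (\<lambda>x. ennreal (a x / Za))) A\<bar> \<le> 2 * D / Za"
      unfolding 1 2 by simp
  qed auto
qed

subsection \<open>Exponential inequalities\<close>

lemma exp_abs_le: "exp (t * \<bar>x\<bar>) \<le> exp (t * x) + exp (- (t * x))" for t x :: real
  by (cases "0 \<le> x") (auto simp: add_increasing add_increasing2)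

text \<open>Extracts second moments from exponential moments; the two exponentials together dominate
  the exponential of \<open>\<bar>x / s\<bar>\<close>.\<close>

lemma square_le_exp: "(x::real)\<^sup>2 \<le> 2 * s\<^sup>2 * (exp (x / s) + exp (- (x / s)))" if "0 < s"
proof -
  have "1 + \<bar>x / s\<bar> + \<bar>x / s\<bar>\<^sup>2 / 2 \<le> exp \<bar>x / s\<bar>"
    by (rule exp_lower_Taylor_quadratic) simp
  then have "(x / s)\<^sup>2 \<le> 2 * exp \<bar>x / s\<bar>"
    unfolding power2_abs by linarith
  also have "\<dots> \<le> 2 * (exp (x / s) + exp (- (x / s)))"
    using exp_abs_le[of 1 "x / s"] by simp
  finally have "s\<^sup>2 * (x / s)\<^sup>2 \<le> s\<^sup>2 * (2 * (exp (x / s) + exp (- (x / s))))"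
    by (intro mult_left_mono) auto
  then show ?thesis using that by (simp add: power_divide algebra_simps)
qed

text \<open>The tangent of \<open>u \<mapsto> exp (sqrt u / 4)\<close> at \<open>u = t\<close> lies below the curve once
  \<open>sqrt t \<ge> 8\<close>, although the function is not convex near 0.\<close>

lemma exp_ge_tangent:
  fixes v \<omega> :: real
  assumes "0 \<le> v" "2 \<le> \<omega>"
  shows "exp \<omega> * (1 + (v\<^sup>2 - \<omega>\<^sup>2) / (2 * \<omega>)) \<le> exp v"
proof -
  define \<delta> where "\<delta> = v - \<omega>"
  have eq: "1 + (v\<^sup>2 - \<omega>\<^sup>2) / (2 * \<omega>) = 1 + \<delta> + \<delta>\<^sup>2 / (2 * \<omega>)"
    using assms by (simp add: \<delta>_def field_simps power2_eq_square)
  have "1 + \<delta> + \<delta>\<^sup>2 / (2 * \<omega>) \<le> exp \<delta>"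
  proof (cases "0 \<le> \<delta>")
    case True
    have "\<delta>\<^sup>2 / (2 * \<omega>) \<le> \<delta>\<^sup>2 / 2"
      using assms by (intro divide_left_mono) auto
    with exp_lower_Taylor_quadratic[OF True] show ?thesis by linarith
  next
    case False
    \<comment> \<open>For \<open>\<delta>\<close> between -2 and 0, the condition
      \<open>2 \<le> \<omega>\<close> bounds the left side by the perfect square of
      \<open>1 + \<delta> / 2\<close>. Further to the left, \<open>0 \<le> v\<close> gives
      \<open>- \<delta> \<le> \<omega>\<close> and the left side is not positive.\<close>
    show ?thesis
    proof (cases "- 2 \<le> \<delta>")
      case True
      have "\<delta>\<^sup>2 / (2 * \<omega>) \<le> \<delta>\<^sup>2 / 4"
        using assms by (intro divide_left_mono) auto
      then have "1 + \<delta> + \<delta>\<^sup>2 / (2 * \<omega>) \<le> (1 + \<delta> / 2)\<^sup>2"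
        by (simp add: power2_eq_square algebra_simps)
      also have "\<dots> \<le> (exp (\<delta> / 2))\<^sup>2"
        using True exp_ge_add_one_self[of "\<delta> / 2"] by (intro power_mono) auto
      also have "\<dots> = exp \<delta>"
        by (simp add: power2_eq_square exp_add[symmetric])
      finally show ?thesis .
    next
      case neg: False
      have "\<delta>\<^sup>2 \<le> (- \<delta>) * \<omega>"
        using assms False unfolding power2_eq_square \<delta>_def
        by (metis diff_ge_0_iff_ge le_add_same_cancel1 minus_diff_eq minus_mult_minus mult_left_mono
            neg_0_le_iff_le nle_le diff_le_eq add.commute)
      then have "\<delta>\<^sup>2 / (2 * \<omega>) \<le> - \<delta> / 2"
        using assms by (simp add: field_simps)
      then have "1 + \<delta> + \<delta>\<^sup>2 / (2 * \<omega>) \<le> 0"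
        using neg by linarith
      then show ?thesis by (meson exp_ge_zero order.trans)
    qed
  qed
  then have "exp \<omega> * (1 + \<delta> + \<delta>\<^sup>2 / (2 * \<omega>)) \<le> exp \<omega> * exp \<delta>"
    by simp
  also have "\<dots> = exp v"
    by (simp add: exp_add[symmetric] \<delta>_def)
  finally show ?thesis by (simp add: eq)
qed

text \<open>Jensen's inequality for \<open>exp (sqrt u / 4)\<close> at the values
  \<open>u = y i ^ 4\<close>, up to a factor \<open>exp 2\<close> that makes up for the failure of
  convexity near 0: if \<open>\<omega> < 2\<close>, the left side is below \<open>exp 2\<close>,
  while the mean on the right is at least 1.\<close>

lemma exp_root_mean_fourth_power_le:
  fixes y :: "'i \<Rightarrow> real"
  assumes I: "finite I" "I \<noteq> {}"
  shows "exp (sqrt ((\<Sum>i\<in>I. y i ^ 4) / real (card I)) / 4) \<le> exp 2 * ((\<Sum>i\<in>I. exp ((y i)\<^sup>2 / 4)) / real (card I))"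
proof -
  define \<omega> where "\<omega> = sqrt ((\<Sum>i\<in>I. y i ^ 4) / real (card I)) / 4"
  have N: "0 < real (card I)" using I by (simp add: card_gt_0_iff)
  have "real (card I) \<le> (\<Sum>i\<in>I. exp ((y i)\<^sup>2 / 4))"
    using sum_mono[of I "\<lambda>_. 1::real" "\<lambda>i. exp ((y i)\<^sup>2 / 4)"] by simp
  then have E1: "1 \<le> (\<Sum>i\<in>I. exp ((y i)\<^sup>2 / 4)) / real (card I)"
    using N by simp
  show ?thesis
  proof (cases "2 \<le> \<omega>")
    case False
    then have "exp \<omega> \<le> exp 2 * 1" by simp
    also have "\<dots> \<le> exp 2 * ((\<Sum>i\<in>I. exp ((y i)\<^sup>2 / 4)) / real (card I))"
      using E1 by (intro mult_left_mono) auto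
    finally show ?thesis by (simp add: \<omega>_def)
  next
    case True
    have "\<omega>\<^sup>2 = ((\<Sum>i\<in>I. y i ^ 4) / real (card I)) / 16"
      by (simp add: \<omega>_def power_divide sum_nonneg)
    then have \<omega>2: "(\<Sum>i\<in>I. y i ^ 4 / 16) = real (card I) * \<omega>\<^sup>2"
      using N by (simp add: sum_divide_distrib[symmetric])
    have "exp \<omega> * (1 + (y i ^ 4 / 16 - \<omega>\<^sup>2) / (2 * \<omega>)) \<le> exp ((y i)\<^sup>2 / 4)" for i
      using exp_ge_tangent[of "(y i)\<^sup>2 / 4", OF _ True] by (simp add: power_divide)
    then have "(\<Sum>i\<in>I. exp \<omega> * (1 + (y i ^ 4 / 16 - \<omega>\<^sup>2) / (2 * \<omega>))) \<le> (\<Sum>i\<in>I. exp ((y i)\<^sup>2 / 4))"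
      by (intro sum_mono)
    \<comment> \<open>The tangent is taken at the mean of the fourth powers, so the linear terms
      cancel in the sum.\<close>
    moreover have "(\<Sum>i\<in>I. exp \<omega> * (1 + (y i ^ 4 / 16 - \<omega>\<^sup>2) / (2 * \<omega>))) = exp \<omega> * real (card I)"
      unfolding sum_distrib_left[symmetric] sum.distrib sum_divide_distrib[symmetric] sum_subtractf
      using \<omega>2 by (simp add: sum_divide_distrib[symmetric])
    ultimately have "exp \<omega> \<le> (\<Sum>i\<in>I. exp ((y i)\<^sup>2 / 4)) / real (card I)"
      using N by (simp add: field_simps)
    also have "\<dots> \<le> exp 2 * \<dots>"
      using mult_right_mono[of 1 "exp 2" "(\<Sum>i\<in>I. exp ((y i)\<^sup>2 / 4)) / real (card I)"] E1 by simp
    finally show ?thesis by (simp add: \<omega>_def)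
  qed
qed

lemma sum_abs_cube_le:
  fixes x :: "'i \<Rightarrow> real"
  shows "(\<Sum>i\<in>I. \<bar>x i\<bar> ^ 3) \<le> sqrt (\<Sum>i\<in>I. (x i)\<^sup>2) * sqrt (\<Sum>i\<in>I. x i ^ 4)"
proof -
  have "(\<Sum>i\<in>I. \<bar>x i\<bar> ^ 3) = (\<Sum>i\<in>I. \<bar>x i\<bar> * \<bar>(x i)\<^sup>2\<bar>)"
    by (intro sum.cong) (auto simp: power2_eq_square power3_eq_cube)
  also have "\<dots> \<le> L2_set x I * L2_set (\<lambda>i. (x i)\<^sup>2) I"
    by (rule L2_set_mult_ineq)
  finally show ?thesis by (simp add: L2_set_def)
qed

lemma exp_minus_one_abs_le: "\<bar>exp (- r) - 1\<bar> \<le> \<bar>r\<bar> * exp \<bar>r\<bar>" for r :: real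
proof (cases "0 \<le> r")
  case True
  have "1 - exp (- r) \<le> r" using exp_ge_add_one_self[of "- r"] by linarith
  also have "\<dots> \<le> r * exp r" using True by (simp add: mult_le_cancel_left1)
  finally show ?thesis using True by simp
next
  case False
  have "exp (- r) * (1 + r) \<le> exp (- r) * exp r"
    by (intro mult_left_mono exp_ge_add_one_self) auto
  also have "\<dots> = 1" by (simp add: exp_add[symmetric])
  finally have "exp (- r) - 1 \<le> - r * exp (- r)" by (simp add: algebra_simps)
  then show ?thesis using False by simp
qed

section \<open>Exponential averages under the standard normal law\<close>

lemma nn_integral_std_normal_mgf:
  "(\<integral>\<^sup>+\<xi>. ennreal (std_normal_density \<xi> * exp (\<xi> * s)) \<partial>lborel) = ennreal (exp (s\<^sup>2 / 2))"
proof -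
  have "std_normal_density \<xi> * exp (\<xi> * s) = exp (s\<^sup>2 / 2) * normal_density s 1 \<xi>" for \<xi>
    by (simp add: normal_density_def exp_add[symmetric] divide_simps) (simp add: power2_eq_square algebra_simps)
  then have "(\<integral>\<^sup>+\<xi>. ennreal (std_normal_density \<xi> * exp (\<xi> * s)) \<partial>lborel) =
      (\<integral>\<^sup>+\<xi>. ennreal (exp (s\<^sup>2 / 2)) * ennreal (normal_density s 1 \<xi>) \<partial>lborel)"
    by (simp add: ennreal_mult)
  also have "\<dots> = ennreal (exp (s\<^sup>2 / 2)) * (\<integral>\<^sup>+\<xi>. ennreal (normal_density s 1 \<xi>) \<partial>lborel)"
    by (rule nn_integral_cmult) auto
  also have "(\<integral>\<^sup>+\<xi>. ennreal (normal_density s 1 \<xi>) \<partial>lborel) = 1"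
    by (subst nn_integral_eq_integral) auto
  finally show ?thesis by simp
qed

text \<open>The factor \<open>exp (\<xi>\<^sup>2 / 4)\<close> cancels half of the Gaussian exponent,
  leaving \<open>sqrt 2\<close> times the density with variance 2.\<close>

lemma nn_integral_std_normal_exp_square:
  "(\<integral>\<^sup>+\<xi>. ennreal (std_normal_density \<xi> * exp (\<xi>\<^sup>2 / 4)) \<partial>lborel) = ennreal (sqrt 2)"
proof -
  have "std_normal_density \<xi> * exp (\<xi>\<^sup>2 / 4) = sqrt 2 * normal_density 0 (sqrt 2) \<xi>" for \<xi>
    by (simp add: normal_density_def exp_add[symmetric] real_sqrt_mult divide_simps)
  then have "(\<integral>\<^sup>+\<xi>. ennreal (std_normal_density \<xi> * exp (\<xi>\<^sup>2 / 4)) \<partial>lborel) =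
      (\<integral>\<^sup>+\<xi>. ennreal (sqrt 2) * ennreal (normal_density 0 (sqrt 2) \<xi>) \<partial>lborel)"
    by (simp add: ennreal_mult)
  also have "\<dots> = ennreal (sqrt 2) * (\<integral>\<^sup>+\<xi>. ennreal (normal_density 0 (sqrt 2) \<xi>) \<partial>lborel)"
    by (rule nn_integral_cmult) auto
  also have "(\<integral>\<^sup>+\<xi>. ennreal (normal_density 0 (sqrt 2) \<xi>) \<partial>lborel) = 1"
    by (subst nn_integral_eq_integral) auto
  finally show ?thesis by simp
qed

subsection \<open>Perturbation of sub-Gaussian linear statistics\<close>

text \<open>Exponential moments are required for every tempering \<open>\<kappa>\<close> in (0, 1],
  because the tails are compared with Gaussians of reduced curvature. Tempering acts on the data
  part \<open>Q\<close> and leaves the prior part \<open>g\<close> intact. The dimension of the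
  underlying space does not occur, so the resulting bounds are free of it.\<close>

locale laplace_core = sigma_finite_measure M
  for M :: "'a measure" +
  fixes g :: "'a \<Rightarrow> real" and x :: "nat \<Rightarrow> 'a \<Rightarrow> real" and w :: "nat \<Rightarrow> real"
    and n :: nat and \<sigma> wlo whi :: real
  assumes g_measurable[measurable]: "g \<in> borel_measurable M"
    and x_measurable[measurable]: "\<And>j. x j \<in> borel_measurable M"
    and n: "1 \<le> n"
    and \<sigma>: "0 < \<sigma>"
    and w: "0 < wlo" "\<And>j. j \<in> {1..n} \<Longrightarrow> wlo \<le> w j" "\<And>j. j \<in> {1..n} \<Longrightarrow> w j \<le> whi"
    and mgf: "\<And>\<kappa> j t. 0 < \<kappa> \<Longrightarrow> \<kappa> \<le> 1 \<Longrightarrow> j \<in> {1..n} \<Longrightarrow>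
        integrable M (\<lambda>\<theta>. exp (- g \<theta> - \<kappa> * (\<Sum>j=1..n. w j * (x j \<theta>)\<^sup>2) / 2) * exp (t * x j \<theta>)) \<and>
        (\<integral>\<theta>. exp (- g \<theta> - \<kappa> * (\<Sum>j=1..n. w j * (x j \<theta>)\<^sup>2) / 2) * exp (t * x j \<theta>) \<partial>M)
          \<le> exp (t\<^sup>2 * \<sigma>\<^sup>2 / (2 * \<kappa>)) * (\<integral>\<theta>. exp (- g \<theta> - \<kappa> * (\<Sum>j=1..n. w j * (x j \<theta>)\<^sup>2) / 2) \<partial>M)"
    and Z1_pos: "0 < (\<integral>\<theta>. exp (- g \<theta> - (\<Sum>j=1..n. w j * (x j \<theta>)\<^sup>2) / 2) \<partial>M)"
begin

definition Q :: "'a \<Rightarrow> real" where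
  "Q \<theta> = (\<Sum>j=1..n. w j * (x j \<theta>)\<^sup>2)"

definition G :: "real \<Rightarrow> 'a \<Rightarrow> real" where
  "G \<kappa> \<theta> = exp (- g \<theta> - \<kappa> * Q \<theta> / 2)"

definition Z :: "real \<Rightarrow> real" where
  "Z \<kappa> = (\<integral>\<theta>. G \<kappa> \<theta> \<partial>M)"

lemma Q_measurable[measurable]: "Q \<in> borel_measurable M"
  unfolding Q_def by measurable

lemma G_measurable[measurable]: "G \<kappa> \<in> borel_measurable M"
  unfolding G_def by measurable

lemma w_pos: "j \<in> {1..n} \<Longrightarrow> 0 < w j"
  using w(1) w(2)[of j] by linarith

lemma whi_pos: "0 < whi"
  using n w_pos[of 1] w(3)[of 1] by auto

lemma Q_nonneg: "0 \<le> Q \<theta>"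
  unfolding Q_def by (intro sum_nonneg mult_nonneg_nonneg) (auto simp: less_imp_le[OF w_pos])

lemma G_pos: "0 < G \<kappa> \<theta>" "0 \<le> G \<kappa> \<theta>"
  by (auto simp: G_def)

lemma Z1_pos': "0 < Z 1"
  using Z1_pos by (simp add: Z_def G_def Q_def)

context
  fixes \<kappa> :: real
  assumes \<kappa>: "0 < \<kappa>" "\<kappa> \<le> 1"
begin

lemma integrable_G_exp: "j \<in> {1..n} \<Longrightarrow> integrable M (\<lambda>\<theta>. G \<kappa> \<theta> * exp (t * x j \<theta>))"
  using mgf[OF \<kappa>] by (simp add: G_def Q_def)

lemma integral_G_exp_le:
  "j \<in> {1..n} \<Longrightarrow> (\<integral>\<theta>. G \<kappa> \<theta> * exp (t * x j \<theta>) \<partial>M) \<le> exp (t\<^sup>2 * \<sigma>\<^sup>2 / (2 * \<kappa>)) * Z \<kappa>"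
  using mgf[OF \<kappa>] by (simp add: G_def Q_def Z_def)

lemma integrable_G: "integrable M (G \<kappa>)"
  using integrable_G_exp[of 1 0] n by simp

lemma Z_nonneg: "0 \<le> Z \<kappa>"
  unfolding Z_def using G_pos by (intro integral_nonneg_AE) auto

lemma second_moment:
  assumes j: "j \<in> {1..n}"
  shows "integrable M (\<lambda>\<theta>. G \<kappa> \<theta> * (x j \<theta>)\<^sup>2)"
    and "(\<integral>\<theta>. G \<kappa> \<theta> * (x j \<theta>)\<^sup>2 \<partial>M) \<le> 8 * \<sigma>\<^sup>2 / \<kappa> * Z \<kappa>"
proof -
  \<comment> \<open>At this scale the moment bounds at \<open>1 / s\<close> and
    \<open>- 1 / s\<close> have exponent 1/2. Bounding \<open>exp (1/2)\<close> by 2 yields the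
    constant \<open>8 = 2 * (2 + 2)\<close>.\<close>
  define s where "s = \<sigma> / sqrt \<kappa>"
  have s: "0 < s" "s\<^sup>2 = \<sigma>\<^sup>2 / \<kappa>" using \<kappa> \<sigma> by (auto simp: s_def power_divide)
  let ?B = "\<lambda>\<theta>. 2 * s\<^sup>2 * (G \<kappa> \<theta> * exp ((1 / s) * x j \<theta>) + G \<kappa> \<theta> * exp ((- 1 / s) * x j \<theta>))"
  have le: "G \<kappa> \<theta> * (x j \<theta>)\<^sup>2 \<le> ?B \<theta>" for \<theta>
    using mult_left_mono[OF square_le_exp[OF s(1), of "x j \<theta>"] G_pos(2)[of \<kappa> \<theta>]] by (simp add: algebra_simps)
  have intB: "integrable M ?B"
    using j by (intro integrable_mult_right Bochner_Integration.integrable_add integrable_G_exp)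
  show int: "integrable M (\<lambda>\<theta>. G \<kappa> \<theta> * (x j \<theta>)\<^sup>2)"
    using intB by (rule Bochner_Integration.integrable_bound) (use le G_pos in \<open>auto intro!: AE_I2 order.trans[OF le]\<close>)
  have "exp (1/2) \<le> (2::real)"
  proof -
    have "(exp (1/2))\<^sup>2 = exp (1::real)" by (simp add: power2_eq_square exp_add[symmetric])
    also have "\<dots> \<le> 2\<^sup>2" using exp_le by simp
    finally show ?thesis by (rule power2_le_imp_le) simp
  qed
  moreover have "(1 / s)\<^sup>2 * \<sigma>\<^sup>2 / (2 * \<kappa>) = 1 / 2" "(- 1 / s)\<^sup>2 * \<sigma>\<^sup>2 / (2 * \<kappa>) = 1 / 2"
    using s \<sigma> \<kappa> by (auto simp: power_divide)
  ultimately have e: "(\<integral>\<theta>. G \<kappa> \<theta> * exp (t * x j \<theta>) \<partial>M) \<le> 2 * Z \<kappa>" if "t = 1 / s \<or> t = - 1 / s" for t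
    using that integral_G_exp_le[OF j, of t] Z_nonneg mult_right_mono[of "exp (1/2)" 2 "Z \<kappa>"] by auto
  have "(\<integral>\<theta>. G \<kappa> \<theta> * (x j \<theta>)\<^sup>2 \<partial>M) \<le> (\<integral>\<theta>. ?B \<theta> \<partial>M)"
    using int intB le by (rule integral_mono)
  also have "\<dots> = 2 * s\<^sup>2 * ((\<integral>\<theta>. G \<kappa> \<theta> * exp ((1 / s) * x j \<theta>) \<partial>M) + (\<integral>\<theta>. G \<kappa> \<theta> * exp ((- 1 / s) * x j \<theta>) \<partial>M))"
    unfolding integral_mult_right_zero
    by (subst Bochner_Integration.integral_add) (rule refl | rule integrable_G_exp[OF j])+
  also have "\<dots> \<le> 2 * s\<^sup>2 * (2 * Z \<kappa> + 2 * Z \<kappa>)"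
    by (intro mult_left_mono add_mono e) auto
  finally show "(\<integral>\<theta>. G \<kappa> \<theta> * (x j \<theta>)\<^sup>2 \<partial>M) \<le> 8 * \<sigma>\<^sup>2 / \<kappa> * Z \<kappa>"
    by (simp add: s(2))
qed

text \<open>Jensen's inequality for the exponential of \<open>- (1 - \<kappa>) * Q / 2\<close>.\<close>

lemma Z_le: "Z \<kappa> \<le> exp (4 * real n * whi * \<sigma>\<^sup>2 / \<kappa>) * Z 1"
proof -
  \<comment> \<open>\<open>m\<close> bounds the mean of \<open>Q / 2\<close> under the normalised
    \<open>G \<kappa>\<close>: each of the \<open>n\<close> summands of \<open>Q\<close> has mean at
    most \<open>whi * 8 * \<sigma>\<^sup>2 / \<kappa>\<close>.\<close>
  define m where "m = 4 * real n * whi * \<sigma>\<^sup>2 / \<kappa>"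
  have m: "0 \<le> m" using \<kappa> whi_pos by (simp add: m_def)
  have int: "integrable M (\<lambda>\<theta>. G \<kappa> \<theta> * Q \<theta>)"
    unfolding Q_def sum_distrib_left
    using second_moment(1) by (auto simp: mult.left_commute)
  have "(\<integral>\<theta>. G \<kappa> \<theta> * Q \<theta> \<partial>M) = (\<integral>\<theta>. (\<Sum>j=1..n. w j * (G \<kappa> \<theta> * (x j \<theta>)\<^sup>2)) \<partial>M)"
    unfolding Q_def sum_distrib_left by (simp add: mult.left_commute)
  also have "\<dots> = (\<Sum>j=1..n. w j * (\<integral>\<theta>. G \<kappa> \<theta> * (x j \<theta>)\<^sup>2 \<partial>M))"
    using second_moment(1) by (subst Bochner_Integration.integral_sum) auto
  also have "\<dots> \<le> (\<Sum>j=1..n. whi * (8 * \<sigma>\<^sup>2 / \<kappa> * Z \<kappa>))"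
    using w(3) less_imp_le[OF w_pos] whi_pos G_pos second_moment(2)
    by (intro sum_mono mult_mono) (auto intro!: integral_nonneg_AE)
  also have "\<dots> = 2 * m * Z \<kappa>" by (simp add: m_def)
  finally have EQ: "(\<integral>\<theta>. G \<kappa> \<theta> * Q \<theta> \<partial>M) \<le> 2 * m * Z \<kappa>" .
  \<comment> \<open>A pointwise form of Jensen's inequality: integrating the tangent of the
    exponential at \<open>- m\<close> avoids dividing by \<open>Z \<kappa>\<close>. The factor
    \<open>1 - \<kappa>\<close> is enlarged to 1 on the way.\<close>
  have le: "exp (- m) * ((1 + m) * G \<kappa> \<theta> - G \<kappa> \<theta> * Q \<theta> / 2) \<le> G 1 \<theta>" for \<theta>
  proof -
    have "1 + (m - Q \<theta> / 2) \<le> exp (m - Q \<theta> / 2)"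
      by (rule exp_ge_add_one_self)
    also have "\<dots> \<le> exp (m - (1 - \<kappa>) * Q \<theta> / 2)"
      using \<kappa> Q_nonneg[of \<theta>] by (simp add: mult_left_le_one_le)
    finally have "exp (- m) * G \<kappa> \<theta> * (1 + (m - Q \<theta> / 2)) \<le> exp (- m) * G \<kappa> \<theta> * exp (m - (1 - \<kappa>) * Q \<theta> / 2)"
      using G_pos by (intro mult_left_mono) auto
    also have "\<dots> = G 1 \<theta>"
      unfolding G_def by (simp add: exp_add[symmetric] field_simps)
    finally show ?thesis by (simp add: algebra_simps)
  qed
  have int1: "integrable M (G 1)"
    using mgf[of 1 1 0] n by (simp add: G_def[abs_def] Q_def)
  have "exp (- m) * Z \<kappa> \<le> exp (- m) * ((1 + m) * Z \<kappa> - (\<integral>\<theta>. G \<kappa> \<theta> * Q \<theta> \<partial>M) / 2)"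
    using EQ by (intro mult_left_mono) (auto simp: algebra_simps)
  also have "\<dots> = (\<integral>\<theta>. exp (- m) * ((1 + m) * G \<kappa> \<theta> - G \<kappa> \<theta> * Q \<theta> / 2) \<partial>M)"
    using int integrable_G by (simp add: Z_def)
  also have "\<dots> \<le> (\<integral>\<theta>. G 1 \<theta> \<partial>M)"
    by (intro integral_mono integrable_mult_right Bochner_Integration.integrable_diff integrable_divide int int1 integrable_G le)
  finally have "exp m * (exp (- m) * Z \<kappa>) \<le> exp m * Z 1"
    by (simp add: Z_def)
  then show ?thesis
    by (simp add: exp_minus_inverse mult.assoc[symmetric] exp_minus m_def)
qed

end

lemma nn_integral_G: "0 < \<kappa> \<Longrightarrow> \<kappa> \<le> 1 \<Longrightarrow> (\<integral>\<^sup>+\<theta>. ennreal (G \<kappa> \<theta>) \<partial>M) = ennreal (Z \<kappa>)"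
  unfolding Z_def using integrable_G G_pos by (intro nn_integral_eq_integral) auto

text \<open>Writing \<open>exp (y\<^sup>2 / 4)\<close> as a Gaussian average of exponentials of multiples of \<open>y\<close>.\<close>

lemma nn_integral_exp_square_le:
  assumes j: "j \<in> {1..n}"
  shows "(\<integral>\<^sup>+\<theta>. ennreal (G 1 \<theta> * exp ((x j \<theta> / \<sigma>)\<^sup>2 / 4)) \<partial>M) \<le> ennreal (sqrt 2 * Z 1)"
proof -
  interpret P: pair_sigma_finite M lborel ..
  \<comment> \<open>With this scaling the moment bound costs \<open>exp (\<xi>\<^sup>2 / 4)\<close>,
    which still has a finite average under the standard normal law.\<close>
  define s where "s \<theta> = x j \<theta> / \<sigma> / sqrt 2" for \<theta>
  have [measurable]: "s \<in> borel_measurable M" unfolding s_def by measurable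
  have s2: "(s \<theta>)\<^sup>2 / 2 = (x j \<theta> / \<sigma>)\<^sup>2 / 4" for \<theta>
    by (simp add: s_def power_divide power_mult_distrib)
  have inner: "(\<integral>\<^sup>+\<theta>. ennreal (G 1 \<theta> * (std_normal_density \<xi> * exp (\<xi> * s \<theta>))) \<partial>M)
      \<le> ennreal (std_normal_density \<xi> * exp (\<xi>\<^sup>2 / 4)) * ennreal (Z 1)" for \<xi>
  proof -
    define t where "t = \<xi> / (\<sigma> * sqrt 2)"
    have eq: "G 1 \<theta> * (std_normal_density \<xi> * exp (\<xi> * s \<theta>)) = std_normal_density \<xi> * (G 1 \<theta> * exp (t * x j \<theta>))" for \<theta>
      by (simp add: s_def t_def)
    have t2: "t\<^sup>2 * \<sigma>\<^sup>2 / (2 * 1) = \<xi>\<^sup>2 / 4"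
      using \<sigma> by (simp add: t_def power_divide power_mult_distrib)
    have "(\<integral>\<^sup>+\<theta>. ennreal (G 1 \<theta> * (std_normal_density \<xi> * exp (\<xi> * s \<theta>))) \<partial>M) =
        ennreal (\<integral>\<theta>. std_normal_density \<xi> * (G 1 \<theta> * exp (t * x j \<theta>)) \<partial>M)"
      unfolding eq using j integrable_G_exp[of 1 j t] G_pos by (intro nn_integral_eq_integral) auto
    also have "\<dots> \<le> ennreal (std_normal_density \<xi> * (exp (\<xi>\<^sup>2 / 4) * Z 1))"
      using integral_G_exp_le[of 1 j t] j unfolding t2 by (auto intro!: ennreal_leI mult_left_mono)
    also have "\<dots> = ennreal (std_normal_density \<xi> * exp (\<xi>\<^sup>2 / 4)) * ennreal (Z 1)"
      using Z1_pos' by (simp add: ennreal_mult[symmetric] mult_ac)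
    finally show ?thesis .
  qed
  have "(\<integral>\<^sup>+\<theta>. ennreal (G 1 \<theta> * exp ((x j \<theta> / \<sigma>)\<^sup>2 / 4)) \<partial>M) =
      (\<integral>\<^sup>+\<theta>. ennreal (G 1 \<theta>) * (\<integral>\<^sup>+\<xi>. ennreal (std_normal_density \<xi> * exp (\<xi> * s \<theta>)) \<partial>lborel) \<partial>M)"
    unfolding nn_integral_std_normal_mgf s2 using G_pos by (simp add: ennreal_mult)
  also have "\<dots> = (\<integral>\<^sup>+\<theta>. (\<integral>\<^sup>+\<xi>. ennreal (G 1 \<theta> * (std_normal_density \<xi> * exp (\<xi> * s \<theta>))) \<partial>lborel) \<partial>M)"
    using G_pos by (subst nn_integral_cmult[symmetric]) (auto simp: ennreal_mult)
  also have "\<dots> = (\<integral>\<^sup>+\<xi>. (\<integral>\<^sup>+\<theta>. ennreal (G 1 \<theta> * (std_normal_density \<xi> * exp (\<xi> * s \<theta>))) \<partial>M) \<partial>lborel)"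
    by (rule P.Fubini'[symmetric]) measurable
  also have "\<dots> \<le> (\<integral>\<^sup>+\<xi>. ennreal (std_normal_density \<xi> * exp (\<xi>\<^sup>2 / 4)) * ennreal (Z 1) \<partial>lborel)"
    by (intro nn_integral_mono inner)
  also have "\<dots> = (\<integral>\<^sup>+\<xi>. ennreal (std_normal_density \<xi> * exp (\<xi>\<^sup>2 / 4)) \<partial>lborel) * ennreal (Z 1)"
    by (rule nn_integral_multc) auto
  also have "\<dots> = ennreal (sqrt 2 * Z 1)"
    unfolding nn_integral_std_normal_exp_square using Z1_pos' by (simp add: ennreal_mult)
  finally show ?thesis .
qed

lemma nn_integral_mean_exp_square_le:
  "(\<integral>\<^sup>+\<theta>. ennreal (G 1 \<theta> * ((\<Sum>j=1..n. exp ((x j \<theta> / \<sigma>)\<^sup>2 / 4)) / real n)) \<partial>M) \<le> ennreal (sqrt 2 * Z 1)"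
proof -
  have "(\<integral>\<^sup>+\<theta>. ennreal (G 1 \<theta> * ((\<Sum>j=1..n. exp ((x j \<theta> / \<sigma>)\<^sup>2 / 4)) / real n)) \<partial>M) =
      (\<integral>\<^sup>+\<theta>. (\<Sum>j=1..n. ennreal (1 / real n) * ennreal (G 1 \<theta> * exp ((x j \<theta> / \<sigma>)\<^sup>2 / 4))) \<partial>M)"
    using G_pos by (intro nn_integral_cong)
      (simp add: ennreal_mult[symmetric] sum_distrib_left sum_divide_distrib)
  also have "\<dots> = (\<Sum>j=1..n. ennreal (1 / real n) * (\<integral>\<^sup>+\<theta>. ennreal (G 1 \<theta> * exp ((x j \<theta> / \<sigma>)\<^sup>2 / 4)) \<partial>M))"
    by (subst nn_integral_sum) (auto intro!: sum.cong nn_integral_cmult)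
  also have "\<dots> \<le> (\<Sum>j=1..n. ennreal (1 / real n) * ennreal (sqrt 2 * Z 1))"
    by (intro sum_mono mult_left_mono nn_integral_exp_square_le) auto
  also have "\<dots> = ennreal (sqrt 2 * Z 1)"
    using n Z1_pos' by (simp add: ennreal_mult[symmetric] ennreal_of_nat_eq_real_of_nat)
  finally show ?thesis .
qed

text \<open>The Chernoff majorant of \<open>G \<kappa>\<close> on the set where some \<open>|x\<^sub>j|\<close> is at least \<open>s\<close>.\<close>

definition layer :: "real \<Rightarrow> real \<Rightarrow> 'a \<Rightarrow> real" where
  "layer \<kappa> s \<theta> = (let t = s * \<kappa> / \<sigma>\<^sup>2 in
     exp (- t * s) * (\<Sum>j=1..n. G \<kappa> \<theta> * exp (t * x j \<theta>) + G \<kappa> \<theta> * exp (- t * x j \<theta>)))"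

lemma layer_nonneg: "0 \<le> layer \<kappa> s \<theta>"
  unfolding layer_def Let_def using G_pos by (auto intro!: mult_nonneg_nonneg sum_nonneg add_nonneg_nonneg)

lemma layer_measurable[measurable]: "layer \<kappa> s \<in> borel_measurable M"
  unfolding layer_def Let_def by measurable

lemma G_le_layer:
  assumes "0 < \<kappa>" "0 < s" "j \<in> {1..n}" "s \<le> \<bar>x j \<theta>\<bar>"
  shows "G \<kappa> \<theta> \<le> layer \<kappa> s \<theta>"
proof -
  define t where "t = s * \<kappa> / \<sigma>\<^sup>2"
  have t: "0 < t" using assms \<sigma> by (simp add: t_def)
  have "exp (t * s) \<le> exp (t * \<bar>x j \<theta>\<bar>)" using t assms by simp
  also have "\<dots> \<le> exp (t * x j \<theta>) + exp (- t * x j \<theta>)"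
    using exp_abs_le[of t "x j \<theta>"] by simp
  finally have "G \<kappa> \<theta> * exp (t * s) \<le> G \<kappa> \<theta> * (exp (t * x j \<theta>) + exp (- t * x j \<theta>))"
    using G_pos by (intro mult_left_mono) auto
  also have "\<dots> \<le> (\<Sum>j=1..n. G \<kappa> \<theta> * exp (t * x j \<theta>) + G \<kappa> \<theta> * exp (- t * x j \<theta>))"
    unfolding distrib_left using assms G_pos
    by (intro member_le_sum[of j "{1..n}" "\<lambda>j. G \<kappa> \<theta> * exp (t * x j \<theta>) + G \<kappa> \<theta> * exp (- t * x j \<theta>)"]) (auto intro!: add_nonneg_nonneg)
  finally have "exp (- t * s) * (G \<kappa> \<theta> * exp (t * s)) \<le> layer \<kappa> s \<theta>"
    unfolding layer_def Let_def t_def[symmetric] by (intro mult_left_mono) auto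
  then show ?thesis by (simp add: exp_minus field_simps)
qed

text \<open>A union bound over \<open>n\<close> indices and two signs gives
  \<open>2 * real n\<close>. The positive term in the exponent is the price from \<open>Z_le\<close>
  for replacing \<open>Z \<kappa>\<close> by \<open>Z 1\<close>.\<close>

lemma layer_integral_le:
  assumes \<kappa>: "0 < \<kappa>" "\<kappa> \<le> 1"
  shows "(\<integral>\<^sup>+\<theta>. ennreal (layer \<kappa> s \<theta>) \<partial>M)
    \<le> ennreal (2 * real n * exp (4 * real n * whi * \<sigma>\<^sup>2 / \<kappa> - s\<^sup>2 * \<kappa> / (2 * \<sigma>\<^sup>2)) * Z 1)"
proof -
  \<comment> \<open>This \<open>t\<close> minimises the Chernoff exponent
    \<open>t\<^sup>2 * \<sigma>\<^sup>2 / (2 * \<kappa>) - t * s\<close>; the minimum is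
    \<open>- e\<close> with \<open>e\<close> as defined below.\<close>
  define t where "t = s * \<kappa> / \<sigma>\<^sup>2"
  have t2: "t\<^sup>2 * \<sigma>\<^sup>2 / (2 * \<kappa>) = s\<^sup>2 * \<kappa> / (2 * \<sigma>\<^sup>2)" "t * s = 2 * (s\<^sup>2 * \<kappa> / (2 * \<sigma>\<^sup>2))"
    using \<kappa> \<sigma> by (simp_all add: t_def field_simps power2_eq_square)
  define e where "e = s\<^sup>2 * \<kappa> / (2 * \<sigma>\<^sup>2)"
  note t2 = t2[folded e_def]
  note int = integrable_G_exp[OF \<kappa>]
  have int2: "integrable M (\<lambda>\<theta>. G \<kappa> \<theta> * exp (t * x j \<theta>) + G \<kappa> \<theta> * exp (- t * x j \<theta>))" if "j \<in> {1..n}" for j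
    by (rule Bochner_Integration.integrable_add[OF int[OF that] int[OF that]])
  have eq2: "(\<integral>\<theta>. G \<kappa> \<theta> * exp (t * x j \<theta>) + G \<kappa> \<theta> * exp (- t * x j \<theta>) \<partial>M) =
      (\<integral>\<theta>. G \<kappa> \<theta> * exp (t * x j \<theta>) \<partial>M) + (\<integral>\<theta>. G \<kappa> \<theta> * exp (- t * x j \<theta>) \<partial>M)" if "j \<in> {1..n}" for j
    by (rule Bochner_Integration.integral_add[OF int[OF that] int[OF that]])
  have le: "(\<integral>\<theta>. G \<kappa> \<theta> * exp (t * x j \<theta>) \<partial>M) \<le> exp e * Z \<kappa>"
    "(\<integral>\<theta>. G \<kappa> \<theta> * exp (- t * x j \<theta>) \<partial>M) \<le> exp e * Z \<kappa>" if "j \<in> {1..n}" for j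
    using integral_G_exp_le[OF \<kappa> that, of t] integral_G_exp_le[OF \<kappa> that, of "- t"]
    unfolding power2_minus t2(1) .
  have int_sum: "integrable M (\<lambda>\<theta>. \<Sum>j=1..n. G \<kappa> \<theta> * exp (t * x j \<theta>) + G \<kappa> \<theta> * exp (- t * x j \<theta>))"
    by (intro Bochner_Integration.integrable_sum int2)
  have nn: "(\<integral>\<^sup>+\<theta>. ennreal (layer \<kappa> s \<theta>) \<partial>M) = ennreal (\<integral>\<theta>. layer \<kappa> s \<theta> \<partial>M)"
  proof (rule nn_integral_eq_integral)
    show "integrable M (layer \<kappa> s)"
      unfolding layer_def[abs_def] Let_def t_def[symmetric] by (intro integrable_mult_right int_sum)
  qed (auto simp: layer_nonneg)
  have "(\<integral>\<theta>. layer \<kappa> s \<theta> \<partial>M) = exp (- t * s) * (\<Sum>j=1..n. \<integral>\<theta>. G \<kappa> \<theta> * exp (t * x j \<theta>) + G \<kappa> \<theta> * exp (- t * x j \<theta>) \<partial>M)"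
    unfolding layer_def Let_def t_def[symmetric] integral_mult_right_zero
    by (subst Bochner_Integration.integral_sum[OF int2]) simp_all
  also have "\<dots> = exp (- t * s) * (\<Sum>j=1..n. (\<integral>\<theta>. G \<kappa> \<theta> * exp (t * x j \<theta>) \<partial>M) + (\<integral>\<theta>. G \<kappa> \<theta> * exp (- t * x j \<theta>) \<partial>M))"
    by (simp only: eq2 cong: sum.cong)
  also have "\<dots> \<le> exp (- t * s) * (\<Sum>j=1..n. exp e * Z \<kappa> + exp e * Z \<kappa>)"
    by (intro mult_left_mono sum_mono add_mono le exp_ge_zero)
  also have "\<dots> = exp (- t * s) * exp e * (2 * real n * Z \<kappa>)"
    by simp
  also have "exp (- t * s) * exp e = exp (- e)"
    unfolding exp_add[symmetric] using t2(2) by simp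
  also have "exp (- e) * (2 * real n * Z \<kappa>) = 2 * real n * exp (- e) * Z \<kappa>"
    by (rule mult.left_commute[THEN trans]) (simp only: mult.assoc)
  also have "\<dots> \<le> 2 * real n * exp (- e) * (exp (4 * real n * whi * \<sigma>\<^sup>2 / \<kappa>) * Z 1)"
    by (intro mult_left_mono Z_le[OF \<kappa>]) auto
  also have "\<dots> = 2 * real n * exp (4 * real n * whi * \<sigma>\<^sup>2 / \<kappa> - e) * Z 1"
    unfolding diff_conv_add_uminus exp_add by (simp only: mult_ac)
  finally show ?thesis unfolding nn e_def by (rule ennreal_leI)
qed

end

section \<open>Comparison of a perturbed density with the Gaussian one\<close>

lemma ex_dyadic:
  fixes s :: real
  assumes "1 < s"
  shows "\<exists>i. 2 ^ i < s \<and> s \<le> 2 ^ (i + 1)"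
proof -
  obtain k where k: "s < 2 ^ k" using real_arch_pow[of 2 s] by auto
  define m where "m = (LEAST k. s \<le> 2 ^ k)"
  have m: "s \<le> 2 ^ m" unfolding m_def by (rule LeastI[of _ k]) (use k in simp)
  with assms have "m \<noteq> 0" by (intro notI) simp
  then obtain i where i: "m = i + 1" by (metis Suc_eq_plus1 not0_implies_Suc)
  have "\<not> s \<le> 2 ^ i" using not_less_Least[of i "\<lambda>k. s \<le> 2 ^ k"] i m_def by simp
  then show ?thesis using m i by (intro exI[of _ i]) simp
qed

text \<open>\<open>D j\<close> models a Bregman divergence of \<open>h\<close>. Taylor expansion and
  curvature are assumed on [-1, 1] only; \<open>D_star\<close> forces at least linear growth along
  rays and thereby carries the lower bound to large arguments.\<close>

locale laplace_potential = laplace_core +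
  fixes D :: "nat \<Rightarrow> real \<Rightarrow> real" and C3 c1 :: real
  assumes D_measurable[measurable]: "\<And>j. D j \<in> borel_measurable borel"
    and C3: "0 < C3" and c1: "0 < c1" "c1 \<le> 1"
    and D_Taylor: "\<And>j t. j \<in> {1..n} \<Longrightarrow> \<bar>t\<bar> \<le> 1 \<Longrightarrow> \<bar>D j t - w j * t\<^sup>2 / 2\<bar> \<le> C3 * \<bar>t\<bar> ^ 3"
    and D_lower: "\<And>j t. j \<in> {1..n} \<Longrightarrow> \<bar>t\<bar> \<le> 1 \<Longrightarrow> c1 * (w j * t\<^sup>2 / 2) \<le> D j t"
    and D_star: "\<And>j s t. j \<in> {1..n} \<Longrightarrow> 1 \<le> s \<Longrightarrow> s * D j t \<le> D j (s * t)"
begin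

definition b :: "'a \<Rightarrow> real" where
  "b \<theta> = exp (- g \<theta> - (\<Sum>j=1..n. D j (x j \<theta>)))"

lemma b_measurable[measurable]: "b \<in> borel_measurable M"
  unfolding b_def by measurable

lemma b_pos: "0 < b \<theta>" "0 \<le> b \<theta>"
  by (auto simp: b_def)

text \<open>The log ratio \<open>- r\<close> is estimated twice. The Cauchy-Schwarz bound on the
  cubes and \<open>small\<close> give \<open>\<bar>r\<bar> \<le> \<omega> / 2\<close>, which
  controls the exponential; a direct bound on the cubes gives the size
  \<open>n * \<sigma> ^ 3\<close>, times \<open>exp (\<omega> / 2)\<close>. Together they produce
  \<open>exp \<omega>\<close>, which \<open>exp_root_mean_fourth_power_le\<close> turns into a
  mean.\<close>

lemma bulk_bound:
  assumes small: "8 * C3 * sqrt (Qm / wlo) * \<sigma>\<^sup>2 * sqrt (real n) \<le> 1"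
    and x1: "\<And>j. j \<in> {1..n} \<Longrightarrow> \<bar>x j \<theta>\<bar> \<le> 1" and Qm: "Q \<theta> \<le> Qm"
  shows "\<bar>b \<theta> - G 1 \<theta>\<bar> \<le> 128 * exp 2 * C3 * real n * \<sigma> ^ 3 *
    (G 1 \<theta> * ((\<Sum>j=1..n. exp ((x j \<theta> / \<sigma>)\<^sup>2 / 4)) / real n))"
proof -
  define r where "r = (\<Sum>j=1..n. D j (x j \<theta>)) - Q \<theta> / 2"
  define y where "y j = x j \<theta> / \<sigma>" for j
  define \<omega> where "\<omega> = sqrt ((\<Sum>j=1..n. y j ^ 4) / real n) / 4"
  define S where "S = (\<Sum>j=1..n. \<bar>x j \<theta>\<bar> ^ 3)"
  have xy: "x j \<theta> = \<sigma> * y j" for j using \<sigma> by (simp add: y_def)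
  have \<omega>: "0 \<le> \<omega>" by (simp add: \<omega>_def sum_nonneg)
  have N: "0 < real n" using n by simp
  have "16 * \<omega>\<^sup>2 = (\<Sum>j=1..n. y j ^ 4) / real n"
    by (simp add: \<omega>_def power_divide sum_nonneg)
  then have y4: "(\<Sum>j=1..n. y j ^ 4) = real n * (16 * \<omega>\<^sup>2)" using N by simp
  have bG: "b \<theta> = G 1 \<theta> * exp (- r)"
    by (simp add: b_def G_def r_def exp_add[symmetric])
  have "r = (\<Sum>j=1..n. D j (x j \<theta>) - w j * (x j \<theta>)\<^sup>2 / 2)"
    by (simp add: r_def Q_def sum_subtractf sum_divide_distrib)
  also have "\<bar>\<dots>\<bar> \<le> (\<Sum>j=1..n. C3 * \<bar>x j \<theta>\<bar> ^ 3)"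
    by (rule order.trans[OF sum_abs sum_mono]) (use D_Taylor x1 in auto)
  finally have r: "\<bar>r\<bar> \<le> C3 * S" by (simp add: S_def sum_distrib_left)
  have "wlo * (\<Sum>j=1..n. (x j \<theta>)\<^sup>2) \<le> Q \<theta>"
    unfolding Q_def sum_distrib_left using w(2) by (intro sum_mono mult_right_mono) auto
  then have x2: "(\<Sum>j=1..n. (x j \<theta>)\<^sup>2) \<le> Qm / wlo"
    using Qm w(1) by (simp add: field_simps)
  have "(\<Sum>j=1..n. x j \<theta> ^ 4) = \<sigma> ^ 4 * (\<Sum>j=1..n. y j ^ 4)"
    unfolding xy by (simp add: power_mult_distrib sum_distrib_left)
  also have "\<dots> = (\<sigma>\<^sup>2)\<^sup>2 * real n * (4 * \<omega>)\<^sup>2"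
    unfolding y4 by (simp add: power_mult_distrib)
  finally have x4: "sqrt (\<Sum>j=1..n. x j \<theta> ^ 4) = \<sigma>\<^sup>2 * sqrt (real n) * (4 * \<omega>)"
    using \<omega> by (simp only: real_sqrt_mult real_sqrt_abs) simp
  have "S \<le> sqrt (Qm / wlo) * (\<sigma>\<^sup>2 * sqrt (real n) * (4 * \<omega>))"
    unfolding S_def x4[symmetric]
    by (rule order.trans[OF sum_abs_cube_le mult_right_mono]) (use x2 in \<open>auto intro: sum_nonneg\<close>)
  then have "C3 * S \<le> C3 * (sqrt (Qm / wlo) * (\<sigma>\<^sup>2 * sqrt (real n) * (4 * \<omega>)))"
    using C3 by (intro mult_left_mono) auto
  also have "\<dots> = (8 * C3 * sqrt (Qm / wlo) * \<sigma>\<^sup>2 * sqrt (real n)) * (\<omega> / 2)" by simp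
  also have "\<dots> \<le> 1 * (\<omega> / 2)"
    using small \<omega> by (intro mult_right_mono) auto
  finally have r_exp: "\<bar>r\<bar> \<le> \<omega> / 2" using r by linarith
  have cube: "\<bar>u\<bar> ^ 3 \<le> 1 + u ^ 4" for u :: real
  proof (cases "\<bar>u\<bar> \<le> 1")
    case True
    then have "\<bar>u\<bar> ^ 3 \<le> 1" by (simp add: power_le_one)
    then show ?thesis by (smt (verit) zero_le_even_power' even_numeral zero_le_power_eq_numeral)
  next
    case False
    then have "\<bar>u\<bar> ^ 3 \<le> \<bar>u\<bar> ^ 4" by (intro power_increasing) auto
    then show ?thesis by (simp add: power_even_abs)
  qed
  have "S = \<sigma> ^ 3 * (\<Sum>j=1..n. \<bar>y j\<bar> ^ 3)"
    unfolding S_def xy using \<sigma> by (simp add: abs_mult power_mult_distrib sum_distrib_left)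
  also have "\<dots> \<le> \<sigma> ^ 3 * (\<Sum>j=1..n. 1 + y j ^ 4)"
    using \<sigma> cube by (intro mult_left_mono sum_mono) auto
  also have "\<dots> = real n * \<sigma> ^ 3 * (1 + 16 * \<omega>\<^sup>2)"
    unfolding sum.distrib y4 by (simp add: algebra_simps)
  \<comment> \<open>The quadratic Taylor term of \<open>exp (\<omega> / 2)\<close> is
    \<open>\<omega>\<^sup>2 / 8\<close>, hence \<open>128 = 16 * 8\<close>.\<close>
  also have "\<dots> \<le> real n * \<sigma> ^ 3 * (128 * exp (\<omega> / 2))"
    using exp_lower_Taylor_quadratic[of "\<omega> / 2"] \<omega> \<sigma>
    by (intro mult_left_mono) (auto simp: power_divide)
  finally have r_S: "\<bar>r\<bar> \<le> C3 * (real n * \<sigma> ^ 3 * (128 * exp (\<omega> / 2)))"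
    using r C3 by (meson mult_left_mono less_imp_le order.trans)
  have "b \<theta> - G 1 \<theta> = G 1 \<theta> * (exp (- r) - 1)"
    by (simp add: bG right_diff_distrib)
  then have "\<bar>b \<theta> - G 1 \<theta>\<bar> = G 1 \<theta> * \<bar>exp (- r) - 1\<bar>"
    using G_pos(2)[of 1 \<theta>] by (simp only: abs_mult abs_of_nonneg)
  also have "\<dots> \<le> G 1 \<theta> * (\<bar>r\<bar> * exp \<bar>r\<bar>)"
    using G_pos by (intro mult_left_mono exp_minus_one_abs_le) auto
  also have "\<dots> \<le> G 1 \<theta> * (C3 * (real n * \<sigma> ^ 3 * (128 * exp (\<omega> / 2))) * exp (\<omega> / 2))"
    using G_pos C3 \<sigma> r_S r_exp by (intro mult_left_mono mult_mono) auto
  also have "\<dots> = 128 * C3 * real n * \<sigma> ^ 3 * G 1 \<theta> * (exp (\<omega> / 2) * exp (\<omega> / 2))"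
    by (simp only: mult_ac)
  also have "\<dots> = 128 * C3 * real n * \<sigma> ^ 3 * G 1 \<theta> * exp \<omega>"
    unfolding exp_add[symmetric] by simp
  also have "\<dots> \<le> 128 * C3 * real n * \<sigma> ^ 3 * G 1 \<theta> * (exp 2 * ((\<Sum>j=1..n. exp ((y j)\<^sup>2 / 4)) / real n))"
    using exp_root_mean_fourth_power_le[of "{1..n}" y] n C3 \<sigma> G_pos
    by (intro mult_left_mono) (auto simp: \<omega>_def)
  finally show ?thesis unfolding y_def by (simp only: mult_ac)
qed

text \<open>Dividing by \<open>s\<close> brings every argument into [-1, 1], where
  \<open>D_lower\<close> applies. Returning by \<open>D_star\<close> restores only one of the two
  factors \<open>s\<close> lost in the square.\<close>

lemma b_le_G:
  assumes "1 \<le> s" "\<And>j. j \<in> {1..n} \<Longrightarrow> \<bar>x j \<theta>\<bar> \<le> s"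
  shows "b \<theta> \<le> G (c1 / s) \<theta>"
proof -
  have "c1 / s * (w j * (x j \<theta>)\<^sup>2 / 2) \<le> D j (x j \<theta>)" if j: "j \<in> {1..n}" for j
  proof -
    have "c1 / s * (w j * (x j \<theta>)\<^sup>2 / 2) = s * (c1 * (w j * (x j \<theta> / s)\<^sup>2 / 2))"
      using assms(1) by (simp add: field_simps power2_eq_square)
    also have "\<dots> \<le> s * D j (x j \<theta> / s)"
      using assms j by (intro mult_left_mono D_lower) auto
    also have "\<dots> \<le> D j (s * (x j \<theta> / s))"
      using assms j by (intro D_star) auto
    finally show ?thesis using assms(1) by simp
  qed
  then have "c1 / s * (\<Sum>j=1..n. w j * (x j \<theta>)\<^sup>2 / 2) \<le> (\<Sum>j=1..n. D j (x j \<theta>))"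
    unfolding sum_distrib_left by (intro sum_mono) auto
  then show ?thesis
    unfolding b_def G_def Q_def by (simp add: sum_divide_distrib[symmetric])
qed

lemma G_antimono: "\<kappa> \<le> \<kappa>' \<Longrightarrow> G \<kappa>' \<theta> \<le> G \<kappa> \<theta>"
  unfolding G_def using Q_nonneg[of \<theta>] by (auto intro: mult_right_mono)

text \<open>Each summand dominates the difference on one of the three regions. All are nonnegative
  everywhere, so their sum is a bound throughout and no indicator functions are needed. The series
  runs over the dyadic layers of the largest \<open>\<bar>x j \<theta>\<bar>\<close>.\<close>

lemma pointwise_bound:
  assumes small: "8 * C3 * sqrt (Qm / wlo) * \<sigma>\<^sup>2 * sqrt (real n) \<le> 1"
  shows "ennreal \<bar>b \<theta> - G 1 \<theta>\<bar> \<le>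
    ennreal (128 * exp 2 * C3 * real n * \<sigma> ^ 3) * ennreal (G 1 \<theta> * ((\<Sum>j=1..n. exp ((x j \<theta> / \<sigma>)\<^sup>2 / 4)) / real n))
    + ennreal (exp (- c1 * Qm / 4)) * ennreal (G (c1 / 2) \<theta>)
    + (\<Sum>i. ennreal (layer (c1 / 2 ^ (i + 1)) (2 ^ i) \<theta>))" (is "_ \<le> ?A + ?B + ?C")
proof -
  have max: "\<bar>b \<theta> - G 1 \<theta>\<bar> \<le> u" if "b \<theta> \<le> u" "G 1 \<theta> \<le> u" for u
    using that b_pos[of \<theta>] G_pos[of 1 \<theta>] by linarith
  consider "\<exists>j\<in>{1..n}. 1 < \<bar>x j \<theta>\<bar>" | "\<And>j. j \<in> {1..n} \<Longrightarrow> \<bar>x j \<theta>\<bar> \<le> 1" "Qm < Q \<theta>"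
    | "\<And>j. j \<in> {1..n} \<Longrightarrow> \<bar>x j \<theta>\<bar> \<le> 1" "Q \<theta> \<le> Qm"
    by (meson not_le)
  then show ?thesis
  proof cases
    case 1
    define s where "s = Max ((\<lambda>j. \<bar>x j \<theta>\<bar>) ` {1..n})"
    have s_ge: "\<bar>x j \<theta>\<bar> \<le> s" if "j \<in> {1..n}" for j
      unfolding s_def using that by (intro Max_ge) auto
    have "s \<in> (\<lambda>j. \<bar>x j \<theta>\<bar>) ` {1..n}"
      unfolding s_def using n by (intro Max_in) auto
    then obtain j where j: "j \<in> {1..n}" "s = \<bar>x j \<theta>\<bar>" by auto
    have "1 < s" using 1 s_ge by fastforce
    from ex_dyadic[OF this] obtain i where i: "2 ^ i < s" "s \<le> 2 ^ (i + 1)" by auto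
    have p: "(1::real) \<le> 2 ^ (i + 1)" by (rule one_le_power) simp
    have 1: "b \<theta> \<le> G (c1 / 2 ^ (i + 1)) \<theta>"
      using p i s_ge by (intro b_le_G) (auto intro: order.trans)
    have 2: "G 1 \<theta> \<le> G (c1 / 2 ^ (i + 1)) \<theta>"
      by (rule G_antimono, rule divide_le_eq_1_pos[THEN iffD2, OF _ order.trans[OF c1(2) p]]) simp
    have "\<bar>b \<theta> - G 1 \<theta>\<bar> \<le> layer (c1 / 2 ^ (i + 1)) (2 ^ i) \<theta>"
      by (rule order.trans[OF max[OF 1 2]]) (rule G_le_layer[of _ _ j], use c1 i j in auto)
    then have "ennreal \<bar>b \<theta> - G 1 \<theta>\<bar> \<le> ennreal (layer (c1 / 2 ^ (i + 1)) (2 ^ i) \<theta>)"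
      by (rule ennreal_leI)
    also have "\<dots> \<le> ?C"
      using sum_le_suminf[of "\<lambda>i. ennreal (layer (c1 / 2 ^ (i + 1)) (2 ^ i) \<theta>)" "{i}"] by simp
    finally show ?thesis by (rule add_increasing[OF zero_le])
  next
    case 2
    \<comment> \<open>Half of the decay in \<open>Q\<close> produces the small factor; the other
      half stays in the density so that it remains integrable with a controlled
      \<open>Z\<close>.\<close>
    have e: "G c1 \<theta> = G (c1 / 2) \<theta> * exp (- c1 * Q \<theta> / 4)"
      unfolding G_def by (simp add: exp_add[symmetric])
    have "b \<theta> \<le> G c1 \<theta>" using b_le_G[of 1 \<theta>] 2 by simp
    moreover have "G 1 \<theta> \<le> G c1 \<theta>" using c1 by (intro G_antimono)
    ultimately have "\<bar>b \<theta> - G 1 \<theta>\<bar> \<le> G c1 \<theta>" by (rule max)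
    also have "\<dots> \<le> exp (- c1 * Qm / 4) * G (c1 / 2) \<theta>"
      unfolding e using 2 c1 G_pos by (simp add: mult.commute mult_left_mono)
    finally have "ennreal \<bar>b \<theta> - G 1 \<theta>\<bar> \<le> ?B"
      using G_pos by (subst ennreal_mult[symmetric]) (auto intro: ennreal_leI)
    then have "ennreal \<bar>b \<theta> - G 1 \<theta>\<bar> \<le> ?A + ?B" by (rule add_increasing[OF zero_le])
    then show ?thesis by (rule add_increasing2[OF zero_le])
  next
    case 3
    have "\<bar>b \<theta> - G 1 \<theta>\<bar> \<le> 128 * exp 2 * C3 * real n * \<sigma> ^ 3 *
        (G 1 \<theta> * ((\<Sum>j=1..n. exp ((x j \<theta> / \<sigma>)\<^sup>2 / 4)) / real n))"
      using 3 by (intro bulk_bound[OF small]) auto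
    moreover have "0 \<le> 128 * exp 2 * C3 * real n * \<sigma> ^ 3" using C3 \<sigma> by simp
    moreover have "0 \<le> G 1 \<theta> * ((\<Sum>j=1..n. exp ((x j \<theta> / \<sigma>)\<^sup>2 / 4)) / real n)"
      by (intro mult_nonneg_nonneg divide_nonneg_nonneg sum_nonneg G_pos) auto
    ultimately have "ennreal \<bar>b \<theta> - G 1 \<theta>\<bar> \<le> ?A"
      by (subst ennreal_mult[symmetric]) (assumption | rule ennreal_leI)+
    then have "ennreal \<bar>b \<theta> - G 1 \<theta>\<bar> \<le> ?A + ?B" by (rule add_increasing2[OF zero_le])
    then show ?thesis by (rule add_increasing2[OF zero_le])
  qed
qed

text \<open>The conditions \<open>large\<close> say that in both tails the decay exceeds, by at
  least \<open>\<nu>\<close>, the price from \<open>Z_le\<close> for returning to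
  \<open>Z 1\<close>.\<close>

lemma L1_distance_le_regions:
  assumes small: "8 * C3 * sqrt (Qm / wlo) * \<sigma>\<^sup>2 * sqrt (real n) \<le> 1"
    and large: "1 \<le> \<nu>" "8 * real n * whi * \<sigma>\<^sup>2 / c1 - c1 * Qm / 4 \<le> - \<nu>"
      "8 * real n * whi * \<sigma>\<^sup>2 / c1 - c1 / (4 * \<sigma>\<^sup>2) \<le> - \<nu>"
  shows "(\<integral>\<^sup>+\<theta>. ennreal \<bar>b \<theta> - G 1 \<theta>\<bar> \<partial>M) \<le>
    ennreal ((256 * exp 2 * C3 * real n * \<sigma> ^ 3 + 5 * real n * exp (- \<nu>)) * Z 1)"
proof -
  define K1 where "K1 = 128 * exp 2 * C3 * real n * \<sigma> ^ 3"
  have K1: "0 \<le> K1" using C3 \<sigma> by (simp add: K1_def)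
  let ?\<kappa> = "\<lambda>i::nat. c1 / 2 ^ (i + 1)"
  have \<kappa>: "0 < ?\<kappa> i" "?\<kappa> i \<le> 1" for i
  proof -
    have "(1::real) \<le> 2 ^ (i + 1)" by (rule one_le_power) simp
    from order.trans[OF c1(2) this] show "?\<kappa> i \<le> 1" by (rule divide_le_eq_1_pos[THEN iffD2, rotated]) simp
  qed (use c1 in simp)
  have B: "(\<integral>\<^sup>+\<theta>. ennreal (exp (- c1 * Qm / 4)) * ennreal (G (c1 / 2) \<theta>) \<partial>M) \<le> ennreal (exp (- \<nu>) * Z 1)"
  proof -
    have nn: "(\<integral>\<^sup>+\<theta>. ennreal (exp (- c1 * Qm / 4)) * ennreal (G (c1 / 2) \<theta>) \<partial>M) = ennreal (exp (- c1 * Qm / 4) * Z (c1 / 2))"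
      using c1 Z_nonneg by (subst nn_integral_cmult) (auto simp: nn_integral_G ennreal_mult)
    have "exp (- c1 * Qm / 4) * Z (c1 / 2) \<le> exp (- c1 * Qm / 4) * (exp (4 * real n * whi * \<sigma>\<^sup>2 / (c1 / 2)) * Z 1)"
      using c1 by (intro mult_left_mono Z_le) auto
    also have "\<dots> = exp (8 * real n * whi * \<sigma>\<^sup>2 / c1 - c1 * Qm / 4) * Z 1"
      by (simp add: exp_add[symmetric])
    also have "\<dots> \<le> exp (- \<nu>) * Z 1"
      using large Z1_pos' by (intro mult_right_mono) auto
    finally show ?thesis unfolding nn by (rule ennreal_leI)
  qed
  have C: "(\<integral>\<^sup>+\<theta>. ennreal (layer (?\<kappa> i) (2 ^ i) \<theta>) \<partial>M) \<le> ennreal (2 * real n * exp (- \<nu>) * Z 1 * (1 / 2) ^ i)" for i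
  proof -
    \<comment> \<open>The squared threshold grows like \<open>4 ^ i\<close> while
      \<open>?\<kappa> i\<close> decays like \<open>2 ^ - i\<close>, so price and decay both scale
      with \<open>2 ^ i\<close> and the case \<open>i = 0\<close> decides.\<close>
    have "4 * real n * whi * \<sigma>\<^sup>2 / ?\<kappa> i - (2 ^ i)\<^sup>2 * ?\<kappa> i / (2 * \<sigma>\<^sup>2) = 2 ^ i * (8 * real n * whi * \<sigma>\<^sup>2 / c1 - c1 / (4 * \<sigma>\<^sup>2))"
      using c1 \<sigma> by (simp add: field_simps power2_eq_square)
    also have "\<dots> \<le> 2 ^ i * (- \<nu>)"
      using large by (intro mult_left_mono) auto
    \<comment> \<open>From \<open>i + 1 \<le> 2 ^ i\<close> and \<open>1 \<le> \<nu>\<close>; the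
      extra \<open>i\<close> makes the layers summable as a geometric series.\<close>
    also have "\<dots> \<le> - (\<nu> + real i)"
    proof -
      have "real (Suc i) \<le> 2 ^ i" by (metis Suc_leI less_exp of_nat_le_iff of_nat_numeral of_nat_power)
      then have "real (Suc i) * \<nu> \<le> 2 ^ i * \<nu>" using large by (intro mult_right_mono) auto
      moreover have "real i * 1 \<le> real i * \<nu>" using large by (intro mult_left_mono) auto
      ultimately show ?thesis by (simp add: algebra_simps)
    qed
    finally have "exp (4 * real n * whi * \<sigma>\<^sup>2 / ?\<kappa> i - (2 ^ i)\<^sup>2 * ?\<kappa> i / (2 * \<sigma>\<^sup>2)) \<le> exp (- \<nu>) * exp (- 1) ^ i"
      by (simp add: exp_add[symmetric] exp_of_nat_mult[symmetric])
    also have "exp (- 1) ^ i \<le> (1 / 2 :: real) ^ i"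
      using exp_ge_add_one_self[of "1::real"] by (intro power_mono) (auto simp: exp_minus field_simps)
    finally have e: "exp (4 * real n * whi * \<sigma>\<^sup>2 / ?\<kappa> i - (2 ^ i)\<^sup>2 * ?\<kappa> i / (2 * \<sigma>\<^sup>2)) \<le> exp (- \<nu>) * (1 / 2) ^ i"
      by simp
    have "2 * real n * exp (4 * real n * whi * \<sigma>\<^sup>2 / ?\<kappa> i - (2 ^ i)\<^sup>2 * ?\<kappa> i / (2 * \<sigma>\<^sup>2)) * Z 1 \<le> 2 * real n * (exp (- \<nu>) * (1 / 2) ^ i) * Z 1"
      using Z1_pos' by (intro mult_right_mono mult_left_mono e) auto
    then show ?thesis
      by (intro order.trans[OF layer_integral_le[OF \<kappa>]] ennreal_leI) (simp add: mult_ac)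
  qed
  have "(\<integral>\<^sup>+\<theta>. ennreal \<bar>b \<theta> - G 1 \<theta>\<bar> \<partial>M) \<le>
      (\<integral>\<^sup>+\<theta>. ennreal K1 * ennreal (G 1 \<theta> * ((\<Sum>j=1..n. exp ((x j \<theta> / \<sigma>)\<^sup>2 / 4)) / real n))
        + ennreal (exp (- c1 * Qm / 4)) * ennreal (G (c1 / 2) \<theta>)
        + (\<Sum>i. ennreal (layer (?\<kappa> i) (2 ^ i) \<theta>)) \<partial>M)"
    unfolding K1_def by (intro nn_integral_mono pointwise_bound small)
  also have "\<dots> = ennreal K1 * (\<integral>\<^sup>+\<theta>. ennreal (G 1 \<theta> * ((\<Sum>j=1..n. exp ((x j \<theta> / \<sigma>)\<^sup>2 / 4)) / real n)) \<partial>M)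
        + (\<integral>\<^sup>+\<theta>. ennreal (exp (- c1 * Qm / 4)) * ennreal (G (c1 / 2) \<theta>) \<partial>M)
        + (\<Sum>i. \<integral>\<^sup>+\<theta>. ennreal (layer (?\<kappa> i) (2 ^ i) \<theta>) \<partial>M)"
    by (simp add: nn_integral_add nn_integral_cmult nn_integral_suminf)
  also have "\<dots> \<le> ennreal K1 * ennreal (sqrt 2 * Z 1) + ennreal (exp (- \<nu>) * Z 1)
        + (\<Sum>i. ennreal (2 * real n * exp (- \<nu>) * Z 1 * (1 / 2) ^ i))"
    by (intro add_mono mult_left_mono nn_integral_mean_exp_square_le B suminf_le C) auto
  also have "(\<Sum>i. ennreal (2 * real n * exp (- \<nu>) * Z 1 * (1 / 2) ^ i)) = ennreal (2 * real n * exp (- \<nu>) * Z 1 * 2)"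
  proof (rule suminf_ennreal_eq)
    show "(\<lambda>i. 2 * real n * exp (- \<nu>) * Z 1 * (1 / 2) ^ i) sums (2 * real n * exp (- \<nu>) * Z 1 * 2)"
      using geometric_sums[of "1/2 :: real"] by (intro sums_mult) simp
  qed (use Z1_pos' in auto)
  also have "ennreal K1 * ennreal (sqrt 2 * Z 1) + ennreal (exp (- \<nu>) * Z 1) + ennreal (2 * real n * exp (- \<nu>) * Z 1 * 2)
      = ennreal ((K1 * sqrt 2 + (1 + 4 * real n) * exp (- \<nu>)) * Z 1)"
    using Z1_pos' K1 by (simp add: ennreal_mult[symmetric] ennreal_plus[symmetric] algebra_simps del: ennreal_plus)
  also have "\<dots> \<le> ennreal ((K1 * 2 + (5 * real n) * exp (- \<nu>)) * Z 1)"
    using Z1_pos' K1 n sqrt2_less_2 by (intro ennreal_leI mult_right_mono add_mono mult_left_mono) auto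
  finally show ?thesis by (simp add: K1_def mult_ac)
qed

text \<open>All thresholds are measured against \<open>\<nu>\<close>, the cube root of
  \<open>n\<close>. If \<open>d\<close> is small compared with \<open>\<nu>\<close>, a cutoff
  \<open>Qm\<close> of order \<open>\<nu>\<close> meets the requirements of the bulk and of both
  tails at once.\<close>

lemma L1_distance_le:
  fixes d \<nu> S E :: real
  assumes d: "1 \<le> d" and \<nu>: "\<nu> ^ 3 = real n" and S: "0 < S" "\<sigma>\<^sup>2 = S * d / real n"
    and E: "E = 8 * whi * S / c1 + 1"
    and small: "d \<le> \<nu>" "8 * C3 * S * sqrt (4 * E / (c1 * wlo)) * d \<le> \<nu>" "4 * S * E * d \<le> c1 * \<nu>"
  shows "(\<integral>\<^sup>+\<theta>. ennreal \<bar>b \<theta> - G 1 \<theta>\<bar> \<partial>M) \<le>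
    ennreal ((256 * exp 2 * C3 * (S * sqrt S) + 15625) * (d * sqrt d / sqrt (real n)) * Z 1)"
proof -
  have \<nu>1: "1 \<le> \<nu>" using d small by linarith
  have E1: "1 \<le> E" using E whi_pos S c1 by simp
  have nn: "0 < real n" using n by simp
  have "sqrt (real n) = sqrt (\<nu> * \<nu> * \<nu>)" using \<nu> by (simp add: power3_eq_cube)
  then have sqrt_n: "sqrt (real n) = \<nu> * sqrt \<nu>" using \<nu>1 by (simp add: real_sqrt_mult)
  \<comment> \<open>Chosen so that \<open>c1 * Qm / 4 = E * \<nu>\<close>, which exceeds the price,
    at most \<open>(E - 1) * \<nu>\<close>, by the required \<open>\<nu>\<close>.\<close>
  define Qm where "Qm = 4 * E / c1 * \<nu>"
  have n\<sigma>: "real n * \<sigma>\<^sup>2 = S * d" using S nn by simp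
  have "sqrt (Qm / wlo) = sqrt (4 * E / (c1 * wlo)) * sqrt \<nu>"
    unfolding Qm_def real_sqrt_mult[symmetric] by (simp add: field_simps)
  then have "8 * C3 * sqrt (Qm / wlo) * \<sigma>\<^sup>2 * sqrt (real n)
      = 8 * C3 * (sqrt (4 * E / (c1 * wlo)) * sqrt \<nu>) * (S * d / (\<nu> ^ 3)) * (\<nu> * sqrt \<nu>)"
    using S \<nu> sqrt_n by simp
  also have "\<dots> = (8 * C3 * S * sqrt (4 * E / (c1 * wlo)) * d) * (sqrt \<nu> * sqrt \<nu>) * \<nu> / (\<nu> ^ 3)"
    by simp
  also have "\<dots> = (8 * C3 * S * sqrt (4 * E / (c1 * wlo)) * d) / \<nu>"
    using \<nu>1 by (simp add: power3_eq_cube)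
  also have "\<dots> \<le> 1" using small \<nu>1 by simp
  finally have 1: "8 * C3 * sqrt (Qm / wlo) * \<sigma>\<^sup>2 * sqrt (real n) \<le> 1" .
  have Sd: "8 * real n * whi * \<sigma>\<^sup>2 / c1 \<le> (E - 1) * \<nu>"
  proof -
    have "8 * real n * whi * \<sigma>\<^sup>2 / c1 = 8 * whi * (real n * \<sigma>\<^sup>2) / c1" by simp
    also have "\<dots> = (E - 1) * d" unfolding n\<sigma> E by simp
    also have "\<dots> \<le> (E - 1) * \<nu>" using E1 small by (intro mult_left_mono) auto
    finally show ?thesis .
  qed
  have "c1 * Qm / 4 = E * \<nu>" using c1 by (simp add: Qm_def)
  then have 2: "8 * real n * whi * \<sigma>\<^sup>2 / c1 - c1 * Qm / 4 \<le> - \<nu>"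
    using Sd by (simp add: algebra_simps)
  have "E * \<nu> * (4 * \<sigma>\<^sup>2) = (4 * S * E * d) * \<nu> / real n"
    using S by simp
  also have "\<dots> \<le> (c1 * \<nu>) * \<nu> / real n"
    using small \<nu>1 by (intro divide_right_mono mult_right_mono) auto
  also have "\<dots> = c1 / \<nu>"
    using \<nu>[symmetric] \<nu>1 by (simp add: power3_eq_cube)
  also have "\<dots> \<le> c1" using c1 \<nu>1 by (simp add: field_simps)
  finally have "E * \<nu> \<le> c1 / (4 * \<sigma>\<^sup>2)"
    using \<sigma> by (simp add: pos_le_divide_eq)
  then have 3: "8 * real n * whi * \<sigma>\<^sup>2 / c1 - c1 / (4 * \<sigma>\<^sup>2) \<le> - \<nu>"
    using Sd by (simp add: algebra_simps)
  have "\<sigma> = sqrt (S * d / real n)" using S(2) \<sigma> by (metis real_sqrt_abs abs_of_pos)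
  then have \<sigma>_eq: "\<sigma> = sqrt S * sqrt d / sqrt (real n)" by (simp add: real_sqrt_mult real_sqrt_divide)
  have "real n * \<sigma> ^ 3 = (real n * \<sigma>\<^sup>2) * \<sigma>" by (simp add: power2_eq_square power3_eq_cube)
  also have "\<dots> = S * sqrt S * (d * sqrt d / sqrt (real n))"
    unfolding n\<sigma> by (subst \<sigma>_eq) simp
  finally have n\<sigma>3: "real n * \<sigma> ^ 3 = S * sqrt S * (d * sqrt d / sqrt (real n))" .
  \<comment> \<open>As \<open>n = \<nu> ^ 3\<close>, a fifth power leaves
    \<open>\<nu>\<^sup>2\<close> to spare, which is at least \<open>sqrt n\<close>. The constant is
    \<open>3125 = 5 ^ 5\<close>, and the factor 5 of the tail term turns it into 15625.\<close>
  have "(\<nu> / 5) ^ 5 \<le> exp (\<nu> / 5) ^ 5"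
    using \<nu>1 exp_ge_add_one_self[of "\<nu> / 5"] by (intro power_mono) linarith+
  also have "\<dots> = exp \<nu>" by (simp add: exp_of_nat_mult[symmetric])
  finally have "\<nu> ^ 5 \<le> 3125 * exp \<nu>" by (simp add: power_divide)
  then have "real n * \<nu>\<^sup>2 * exp (- \<nu>) \<le> 3125"
    unfolding \<nu>[symmetric] by (simp add: exp_minus field_simps power_add[symmetric])
  then have "real n * exp (- \<nu>) \<le> 3125 / \<nu>\<^sup>2"
    using \<nu>1 by (simp add: pos_le_divide_eq mult_ac)
  also have "\<dots> \<le> 3125 * (d * sqrt d / sqrt (real n))"
  proof -
    have "sqrt \<nu> \<le> \<nu>" using \<nu>1 by (intro real_le_lsqrt) (auto simp: power2_eq_square)
    then have "sqrt (real n) \<le> \<nu>\<^sup>2" using \<nu>1 by (simp add: sqrt_n power2_eq_square)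
    then have "1 / \<nu>\<^sup>2 \<le> 1 / sqrt (real n)" using nn \<nu>1 by (intro divide_left_mono mult_pos_pos) auto
    moreover have "1 * 1 \<le> d * sqrt d" using d by (intro mult_mono) auto
    then have "1 / sqrt (real n) \<le> d * sqrt d / sqrt (real n)" using nn by (intro divide_right_mono) auto
    ultimately show ?thesis by simp
  qed
  finally have ne: "real n * exp (- \<nu>) \<le> 3125 * (d * sqrt d / sqrt (real n))" .
  have "256 * exp 2 * C3 * real n * \<sigma> ^ 3 + 5 * real n * exp (- \<nu>) = 256 * exp 2 * C3 * (real n * \<sigma> ^ 3) + 5 * (real n * exp (- \<nu>))"
    by simp
  also have "\<dots> \<le> (256 * exp 2 * C3 * (S * sqrt S) + 15625) * (d * sqrt d / sqrt (real n))"
    unfolding n\<sigma>3 distrib_right using ne by (intro add_mono) simp_all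
  finally have "(256 * exp 2 * C3 * real n * \<sigma> ^ 3 + 5 * real n * exp (- \<nu>)) * Z 1
      \<le> (256 * exp 2 * C3 * (S * sqrt S) + 15625) * (d * sqrt d / sqrt (real n)) * Z 1"
    using Z1_pos' by (intro mult_right_mono) auto
  then show ?thesis
    by (intro order.trans[OF L1_distance_le_regions[OF 1 \<nu>1 2 3]] ennreal_leI)
qed

end

subsection \<open>Gaussian integrals\<close>

lemma quadratic_form_translate:
  fixes A :: "nat \<Rightarrow> nat \<Rightarrow> real"
  assumes sym: "\<And>i j. i \<in> {1..p} \<Longrightarrow> j \<in> {1..p} \<Longrightarrow> A i j = A j i"
    and u: "\<And>i. i \<in> {1..p} \<Longrightarrow> (\<Sum>j=1..p. A i j * u j) = v i"
  shows "(\<Sum>i=1..p. \<Sum>j=1..p. (z i - t * u i) * A i j * (z j - t * u j)) =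
    (\<Sum>i=1..p. \<Sum>j=1..p. z i * A i j * z j) - 2 * t * (\<Sum>i=1..p. v i * z i) + t\<^sup>2 * (\<Sum>i=1..p. v i * u i)"
proof -
  have 1: "(\<Sum>i=1..p. \<Sum>j=1..p. y i * A i j * u j) = (\<Sum>i=1..p. v i * y i)" for y
  proof -
    have "(\<Sum>i=1..p. \<Sum>j=1..p. y i * A i j * u j) = (\<Sum>i=1..p. y i * (\<Sum>j=1..p. A i j * u j))"
      by (simp add: sum_distrib_left mult.assoc)
    also have "\<dots> = (\<Sum>i=1..p. v i * y i)"
      by (intro sum.cong refl, subst u) (auto simp: mult.commute)
    finally show ?thesis .
  qed
  have 2: "(\<Sum>i=1..p. \<Sum>j=1..p. u i * A i j * y j) = (\<Sum>i=1..p. v i * y i)" for y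
  proof -
    have "(\<Sum>i=1..p. \<Sum>j=1..p. u i * A i j * y j) = (\<Sum>j=1..p. \<Sum>i=1..p. u i * A i j * y j)"
      by (rule sum.swap)
    also have "\<dots> = (\<Sum>j=1..p. \<Sum>i=1..p. y j * A j i * u i)"
      by (intro sum.cong refl) (simp add: sym mult_ac del: One_nat_def)
    finally show ?thesis unfolding 1 .
  qed
  have "(z i - t * u i) * A i j * (z j - t * u j) =
      z i * A i j * z j - t * (z i * A i j * u j) - t * (u i * A i j * z j) + t\<^sup>2 * (u i * A i j * u j)" for i j
    by (simp add: algebra_simps power2_eq_square)
  then have "(\<Sum>i=1..p. \<Sum>j=1..p. (z i - t * u i) * A i j * (z j - t * u j)) =
      (\<Sum>i=1..p. \<Sum>j=1..p. z i * A i j * z j) - t * (\<Sum>i=1..p. \<Sum>j=1..p. z i * A i j * u j)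
      - t * (\<Sum>i=1..p. \<Sum>j=1..p. u i * A i j * z j) + t\<^sup>2 * (\<Sum>i=1..p. \<Sum>j=1..p. u i * A i j * u j)"
    by (simp add: sum.distrib sum_subtractf sum_distrib_left)
  also have "\<dots> = (\<Sum>i=1..p. \<Sum>j=1..p. z i * A i j * z j) - 2 * t * (\<Sum>i=1..p. v i * z i) + t\<^sup>2 * (\<Sum>i=1..p. v i * u i)"
    unfolding 1 2 by simp
  finally show ?thesis .
qed

text \<open>Completing the square with the solution \<open>u\<close> of \<open>A u = v\<close>.\<close>

lemma gaussian_mgf_le:
  fixes A :: "nat \<Rightarrow> nat \<Rightarrow> real" and a v :: "nat \<Rightarrow> real" and s t :: real
  assumes sym: "\<And>i j. i \<in> {1..p} \<Longrightarrow> j \<in> {1..p} \<Longrightarrow> A i j = A j i"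
    and pos: "\<And>z. \<exists>i\<in>{1..p}. z i \<noteq> 0 \<Longrightarrow> 0 < (\<Sum>i=1..p. \<Sum>j=1..p. z i * A i j * z j)"
    and s: "0 \<le> s"
    and var: "\<And>z. (\<Sum>k=1..p. v k * z k)\<^sup>2 \<le> s * (\<Sum>i=1..p. \<Sum>j=1..p. z i * A i j * z j)"
    and int: "integrable (leb p) (\<lambda>\<theta>. exp (- (\<Sum>i=1..p. \<Sum>j=1..p. (\<theta> i - a i) * A i j * (\<theta> j - a j)) / 2))"
  shows "integrable (leb p) (\<lambda>\<theta>. exp (- (\<Sum>i=1..p. \<Sum>j=1..p. (\<theta> i - a i) * A i j * (\<theta> j - a j)) / 2) * exp (t * (\<Sum>k=1..p. v k * (\<theta> k - a k))))"
    (is "integrable _ ?G")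
    and "(\<integral>\<theta>. exp (- (\<Sum>i=1..p. \<Sum>j=1..p. (\<theta> i - a i) * A i j * (\<theta> j - a j)) / 2) * exp (t * (\<Sum>k=1..p. v k * (\<theta> k - a k))) \<partial>leb p)
      \<le> exp (t\<^sup>2 * s / 2) * (\<integral>\<theta>. exp (- (\<Sum>i=1..p. \<Sum>j=1..p. (\<theta> i - a i) * A i j * (\<theta> j - a j)) / 2) \<partial>leb p)"
proof -
  let ?F = "\<lambda>\<theta>. exp (- (\<Sum>i=1..p. \<Sum>j=1..p. (\<theta> i - a i) * A i j * (\<theta> j - a j)) / 2)"
  let ?T = "\<lambda>\<theta> u. \<lambda>k\<in>{1..p}. \<theta> k + u k :: real"
  obtain u where u: "\<And>i. i \<in> {1..p} \<Longrightarrow> (\<Sum>j=1..p. A i j * u j) = v i"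
    using posdef_solvable[OF finite_atLeastAtMost sym pos] by blast
  define c where "c = (\<Sum>i=1..p. v i * u i)"
  have qu: "(\<Sum>i=1..p. \<Sum>j=1..p. u i * A i j * u j) = c"
  proof -
    have "(\<Sum>i=1..p. \<Sum>j=1..p. u i * A i j * u j) = (\<Sum>i=1..p. u i * (\<Sum>j=1..p. A i j * u j))"
      by (simp add: sum_distrib_left mult.assoc)
    also have "\<dots> = c"
      unfolding c_def by (intro sum.cong refl, subst u) (auto simp: mult.commute)
    finally show ?thesis .
  qed
  \<comment> \<open>\<open>c\<close> is the exact variance of the linear form. Applying
    \<open>var\<close> to \<open>u\<close> itself gives \<open>c\<^sup>2 \<le> s * c\<close>, and
    positive definiteness allows division by \<open>c\<close>.\<close>
  have cs: "c \<le> s"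
  proof (cases "\<exists>i\<in>{1..p}. u i \<noteq> 0")
    case True
    then have "0 < c" using pos[of u] qu by simp
    moreover have "c\<^sup>2 \<le> s * c" using var[of u] qu by (simp add: c_def)
    ultimately show ?thesis by (simp add: power2_eq_square)
  next
    case False
    then have "c = 0" unfolding c_def by (intro sum.neutral) auto
    then show ?thesis using s by simp
  qed
  have F_meas: "?F \<in> borel_measurable (leb p)" by measurable
  \<comment> \<open>Exponential tilting by the linear form is a translation by \<open>t * u\<close>,
    up to a constant factor.\<close>
  have eq: "?G \<theta> = exp (t\<^sup>2 * c / 2) * ?F (?T \<theta> (\<lambda>k. - t * u k))" for \<theta>
  proof -
    have "(\<Sum>i=1..p. \<Sum>j=1..p. (?T \<theta> (\<lambda>k. - t * u k) i - a i) * A i j * (?T \<theta> (\<lambda>k. - t * u k) j - a j)) =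
        (\<Sum>i=1..p. \<Sum>j=1..p. ((\<theta> i - a i) - t * u i) * A i j * ((\<theta> j - a j) - t * u j))"
      by (intro sum.cong refl) (simp add: algebra_simps)
    also have "\<dots> = (\<Sum>i=1..p. \<Sum>j=1..p. (\<theta> i - a i) * A i j * (\<theta> j - a j)) - 2 * t * (\<Sum>k=1..p. v k * (\<theta> k - a k)) + t\<^sup>2 * c"
      unfolding c_def by (rule quadratic_form_translate[OF sym u])
    finally show ?thesis by (simp add: exp_add[symmetric] field_simps)
  qed
  show "integrable (leb p) ?G"
    unfolding eq using integrable_leb_translate[OF F_meas int, of "\<lambda>k. - t * u k"] by (rule integrable_mult_right)
  have "(\<integral>\<theta>. ?G \<theta> \<partial>leb p) = exp (t\<^sup>2 * c / 2) * (\<integral>\<theta>. ?F (?T \<theta> (\<lambda>k. - t * u k)) \<partial>leb p)"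
    unfolding eq by (rule integral_mult_right_zero)
  also have "(\<integral>\<theta>. ?F (?T \<theta> (\<lambda>k. - t * u k)) \<partial>leb p) = (\<integral>\<theta>. ?F \<theta> \<partial>leb p)"
    by (rule integral_leb_translate[OF F_meas])
  finally have I: "(\<integral>\<theta>. ?G \<theta> \<partial>leb p) = exp (t\<^sup>2 * c / 2) * (\<integral>\<theta>. ?F \<theta> \<partial>leb p)" .
  show "(\<integral>\<theta>. ?G \<theta> \<partial>leb p) \<le> exp (t\<^sup>2 * s / 2) * (\<integral>\<theta>. ?F \<theta> \<partial>leb p)"
    unfolding I using cs by (intro mult_right_mono) (auto simp: mult_left_mono)
qed

lemma integrable_exp_square:
  fixes c a :: real
  assumes "0 < c"
  shows "integrable lborel (\<lambda>x. exp (- c * (x - a)\<^sup>2 / 2))"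
proof -
  have "integrable lborel (\<lambda>x. sqrt (2 * pi / c) * normal_density a (1 / sqrt c) x)"
    using assms by (intro integrable_mult_right integrable_normal_density) simp
  moreover have "sqrt (2 * pi / c) * normal_density a (1 / sqrt c) x = exp (- c * (x - a)\<^sup>2 / 2)" for x
    using assms by (simp add: normal_density_def power_divide field_simps real_sqrt_divide)
  ultimately show ?thesis by simp
qed

lemma integrable_exp_diagonal:
  fixes c a :: "nat \<Rightarrow> real"
  assumes "\<And>k. k \<in> {1..p} \<Longrightarrow> 0 < c k"
  shows "integrable (leb p) (\<lambda>\<theta>. exp (- (\<Sum>k=1..p. c k * (\<theta> k - a k)\<^sup>2) / 2))"
proof -
  have "integrable (leb p) (\<lambda>\<theta>. \<Prod>k\<in>{1..p}. exp (- c k * (\<theta> k - a k)\<^sup>2 / 2))"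
    using assms by (intro product_sigma_finite.product_integrable_prod[OF product_sigma_finite_lborel] integrable_exp_square) auto
  moreover have "(\<Prod>k\<in>{1..p}. exp (- c k * (\<theta> k - a k)\<^sup>2 / 2)) = exp (- (\<Sum>k=1..p. c k * (\<theta> k - a k)\<^sup>2) / 2)" for \<theta>
    by (simp add: exp_sum[symmetric] sum_negf sum_divide_distrib)
  ultimately show ?thesis by simp
qed

lemma integral_leb_pos:
  fixes F :: "(nat \<Rightarrow> real) \<Rightarrow> real"
  assumes "integrable (leb p) F" "\<And>\<theta>. 0 < F \<theta>"
  shows "0 < (\<integral>\<theta>. F \<theta> \<partial>leb p)"
proof -
  have "emeasure (leb p) (space (leb p)) \<noteq> 0"
    unfolding space_PiM by (subst product_sigma_finite.emeasure_PiM[OF product_sigma_finite_lborel]) auto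
  moreover have "emeasure (leb p) (space (leb p)) = 0" if "(\<integral>\<theta>. F \<theta> \<partial>leb p) = 0"
  proof -
    have "AE \<theta> in leb p. F \<theta> = 0"
      using that assms integral_nonneg_eq_0_iff_AE[OF assms(1)] by (simp add: less_imp_le)
    then have "AE \<theta> in leb p. False"
      by (rule AE_mp) (use assms(2) in \<open>auto intro!: AE_I2 simp: less_le\<close>)
    then obtain N where "space (leb p) \<subseteq> N" "emeasure (leb p) N = 0" "N \<in> sets (leb p)"
      by (auto elim!: AE_E)
    then show ?thesis using emeasure_mono[of "space (leb p)" N "leb p"] by simp
  qed
  moreover have "0 \<le> (\<integral>\<theta>. F \<theta> \<partial>leb p)"
    using assms(2) by (intro integral_nonneg_AE) (auto simp: less_imp_le)
  ultimately show ?thesis by fastforce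
qed

subsection \<open>Smooth convex functions\<close>

definition bregman :: "(real \<Rightarrow> real) \<Rightarrow> real \<Rightarrow> real \<Rightarrow> real" where
  "bregman h s t = h (s + t) - h s - deriv h s * t"

context
  fixes h :: "real \<Rightarrow> real"
  assumes smooth: "\<And>k s. ((deriv ^^ k) h) differentiable (at s)"
begin

lemma DERIV_iterate: "((deriv ^^ k) h has_real_derivative (deriv ^^ Suc k) h s) (at s)"
  using smooth[of k s] by (simp add: DERIV_deriv_iff_real_differentiable)

lemma continuous_iterate: "continuous_on A ((deriv ^^ k) h)"
  by (meson DERIV_iterate DERIV_isCont continuous_at_imp_continuous_on)

text \<open>Lagrange form of the remainder. The intermediate point is only located in a closed
  interval, so that \<open>t = 0\<close> is covered too.\<close>

lemma taylor_iterate: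
  assumes "0 < n"
  shows "\<exists>u. \<bar>u - s\<bar> \<le> \<bar>t\<bar> \<and> h (s + t) = (\<Sum>m<n. (deriv ^^ m) h s / fact m * t ^ m) + (deriv ^^ n) h u / fact n * t ^ n"
proof (cases "t = 0")
  case True
  have "(\<Sum>m<n. (deriv ^^ m) h s / fact m * 0 ^ m) = h s"
    using assms by (subst sum.remove[of _ 0]) (auto intro!: sum.neutral)
  then show ?thesis using True assms by (intro exI[of _ s]) simp
next
  case False
  then have "\<exists>u. (if s + t < s then s + t < u \<and> u < s else s < u \<and> u < s + t) \<and>
      h (s + t) = (\<Sum>m<n. (deriv ^^ m) h s / fact m * (s + t - s) ^ m) + (deriv ^^ n) h u / fact n * (s + t - s) ^ n"
    using assms DERIV_iterate by (intro Taylor[of n "\<lambda>m. (deriv ^^ m) h" h "min s (s + t)" "max s (s + t)"]) auto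
  then obtain u where "if s + t < s then s + t < u \<and> u < s else s < u \<and> u < s + t"
    "h (s + t) = (\<Sum>m<n. (deriv ^^ m) h s / fact m * (s + t - s) ^ m) + (deriv ^^ n) h u / fact n * (s + t - s) ^ n"
    by blast
  then show ?thesis by (intro exI[of _ u]) (auto split: if_splits)
qed

lemma bregman_Taylor:
  assumes "\<And>u. \<bar>u\<bar> \<le> C + 1 \<Longrightarrow> \<bar>(deriv ^^ 3) h u\<bar> \<le> L" "\<bar>s\<bar> \<le> C" "\<bar>t\<bar> \<le> 1"
  shows "\<bar>bregman h s t - (deriv ^^ 2) h s * t\<^sup>2 / 2\<bar> \<le> L * \<bar>t\<bar> ^ 3"
proof -
  obtain u where u: "\<bar>u - s\<bar> \<le> \<bar>t\<bar>"
    "h (s + t) = (\<Sum>m<3. (deriv ^^ m) h s / fact m * t ^ m) + (deriv ^^ 3) h u / fact 3 * t ^ 3"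
    using taylor_iterate[of 3 s t] by auto
  have L: "\<bar>(deriv ^^ 3) h u\<bar> \<le> L" using u assms by (intro assms) linarith
  have *: "bregman h s t - (deriv ^^ 2) h s * t\<^sup>2 / 2 = (deriv ^^ 3) h u / 6 * t ^ 3"
    unfolding bregman_def u(2) by (simp add: lessThan_nat_numeral lessThan_Suc fact_numeral numeral_2_eq_2)
  have "\<bar>bregman h s t - (deriv ^^ 2) h s * t\<^sup>2 / 2\<bar> = \<bar>(deriv ^^ 3) h u\<bar> / 6 * \<bar>t\<bar> ^ 3"
    unfolding * by (simp add: abs_mult power_abs)
  also have "\<dots> \<le> L * \<bar>t\<bar> ^ 3"
    using L by (intro mult_right_mono) auto
  finally show ?thesis .
qed

lemma bregman_lower:
  assumes "\<And>u. \<bar>u\<bar> \<le> C + 1 \<Longrightarrow> w \<le> (deriv ^^ 2) h u" "\<bar>s\<bar> \<le> C" "\<bar>t\<bar> \<le> 1"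
  shows "w * t\<^sup>2 / 2 \<le> bregman h s t"
proof -
  obtain u where u: "\<bar>u - s\<bar> \<le> \<bar>t\<bar>"
    "h (s + t) = (\<Sum>m<2. (deriv ^^ m) h s / fact m * t ^ m) + (deriv ^^ 2) h u / fact 2 * t ^ 2"
    using taylor_iterate[of 2 s t] by auto
  have "w \<le> (deriv ^^ 2) h u" using u assms by (intro assms) linarith
  then have "w * t\<^sup>2 / 2 \<le> (deriv ^^ 2) h u * t\<^sup>2 / 2" by (intro divide_right_mono mult_right_mono) auto
  also have "\<dots> = bregman h s t"
    unfolding bregman_def u(2) by (simp add: lessThan_nat_numeral lessThan_Suc fact_numeral numeral_2_eq_2)
  finally show ?thesis .
qed

lemma bregman_measurable: "bregman h s \<in> borel_measurable borel"
  unfolding bregman_def[abs_def]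
  by (intro borel_measurable_continuous_onI continuous_intros continuous_on_compose2[OF continuous_iterate[of UNIV 0, simplified]]) auto

end

text \<open>\<open>s + t\<close> is the convex combination of \<open>s + r * t\<close> and
  \<open>s\<close> with weights \<open>1 / r\<close> and \<open>1 - 1 / r\<close>, and the linear
  term of the divergence is homogeneous in \<open>t\<close>.\<close>

lemma bregman_star:
  assumes convex: "\<And>s t u. s \<noteq> t \<Longrightarrow> 0 < u \<Longrightarrow> u < 1 \<Longrightarrow> h (u * s + (1 - u) * t) < u * h s + (1 - u) * h t"
    and r: "1 \<le> r"
  shows "r * bregman h s t \<le> bregman h s (r * t)"
proof -
  have "h (1 / r * (s + r * t) + (1 - 1 / r) * s) \<le> 1 / r * h (s + r * t) + (1 - 1 / r) * h s"
  proof (cases "r = 1 \<or> t = 0")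
    case False
    then show ?thesis using r by (intro less_imp_le convex) auto
  qed (use r in \<open>auto simp: algebra_simps\<close>)
  also have "1 / r * (s + r * t) + (1 - 1 / r) * s = s + t"
    using r by (simp add: field_simps)
  finally have "r * h (s + t) \<le> r * (1 / r * h (s + r * t) + (1 - 1 / r) * h s)"
    using r by (intro mult_left_mono) auto
  also have "\<dots> = h (s + r * t) + (r - 1) * h s"
    using r by (simp add: field_simps)
  finally show ?thesis by (simp add: bregman_def algebra_simps)
qed

subsection \<open>Effective dimension\<close>

text \<open>The first \<open>M\<close> terms, with \<open>M\<close> the ceiling of \<open>m\<close>,
  contribute at most \<open>M \<le> 2 * m\<close>. Beyond them the inverse squares telescope to at
  most \<open>m\<^sup>2 / M \<le> m\<close>.\<close>

lemma sum_min_square_le: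
  fixes m :: real
  assumes m: "1 \<le> m"
  shows "(\<Sum>k=1..p. min 1 ((m / real k)\<^sup>2)) \<le> 3 * min m (real p)"
proof -
  define M where "M = nat \<lceil>m\<rceil>"
  have M: "m \<le> real M" "real M \<le> 2 * m" "0 < real M" using m by (auto simp: M_def) linarith+
  have p: "(\<Sum>k=1..p. min 1 ((m / real k)\<^sup>2)) \<le> real p" for p
    using sum_mono[of "{1..p}" "\<lambda>k. min 1 ((m / real k)\<^sup>2)" "\<lambda>_. 1"] by simp
  have "(\<Sum>k=1..M + q. min 1 ((m / real k)\<^sup>2)) \<le> real M + m\<^sup>2 * (1 / real M - 1 / real (M + q))" for q
  proof (induction q)
    case 0
    then show ?case using p[of M] by simp
  next
    case (Suc q)
    define x where "x = real (M + q)"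
    have x: "0 < x" using M by (simp add: x_def)
    have "min 1 ((m / real (Suc (M + q)))\<^sup>2) \<le> m\<^sup>2 * (1 / (x + 1)\<^sup>2)"
      by (simp add: x_def power_divide add.commute)
    also have "\<dots> \<le> m\<^sup>2 * (1 / x - 1 / (x + 1))"
    proof (intro mult_left_mono)
      have "1 / (x + 1)\<^sup>2 \<le> 1 / (x * (x + 1))"
        using x by (intro divide_left_mono mult_pos_pos) (auto simp: power2_eq_square)
      also have "\<dots> = 1 / x - 1 / (x + 1)" using x by (simp add: field_simps)
      finally show "1 / (x + 1)\<^sup>2 \<le> 1 / x - 1 / (x + 1)" .
    qed simp
    finally have "(\<Sum>k=1..M + Suc q. min 1 ((m / real k)\<^sup>2))
        \<le> real M + m\<^sup>2 * (1 / real M - 1 / x) + m\<^sup>2 * (1 / x - 1 / (x + 1))"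
      using Suc by (simp add: x_def)
    also have "\<dots> = real M + m\<^sup>2 * (1 / real M - 1 / (x + 1))"
      by (simp add: algebra_simps)
    finally show ?case by (simp add: x_def add_ac)
  qed
  moreover have "real M + m\<^sup>2 * (1 / real M - 1 / real (M + q)) \<le> 3 * m" for q
  proof -
    have "m\<^sup>2 * (1 / real M - 1 / real (M + q)) \<le> m\<^sup>2 * (1 / real M)"
      by (intro mult_left_mono) auto
    also have "\<dots> \<le> m"
      using M m by (simp add: power2_eq_square divide_le_eq)
    finally show ?thesis using M by linarith
  qed
  ultimately have big: "(\<Sum>k=1..M + q. min 1 ((m / real k)\<^sup>2)) \<le> 3 * m" for q
    using order.trans by blast
  have "(\<Sum>k=1..p. min 1 ((m / real k)\<^sup>2)) \<le> 3 * m"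
  proof (cases "M \<le> p")
    case True
    then show ?thesis using big[of "p - M"] by simp
  next
    case False
    then show ?thesis using p[of p] M m by linarith
  qed
  moreover have "(\<Sum>k=1..p. min 1 ((m / real k)\<^sup>2)) \<le> 3 * real p" using p[of p] by linarith
  ultimately show ?thesis by simp
qed

text \<open>\<open>m\<close> is the index at which \<open>k powr \<alpha>\<close> reaches
  \<open>n\<close>. Below it a term is at most \<open>1 / n\<close>; above it,
  \<open>m / k < 1\<close> and \<open>2 \<le> \<alpha>\<close> reduce the decay to an inverse
  square, with a constant free of \<open>\<alpha>\<close>.\<close>

lemma sum_effective_dimension_le:
  fixes \<alpha> :: real
  assumes n: "1 \<le> n" and \<alpha>: "2 \<le> \<alpha>"
  shows "(\<Sum>k=1..p. 1 / (real n + real k powr \<alpha>)) \<le> 3 * min (real n powr (1 / \<alpha>)) (real p) / real n"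
proof -
  define m where "m = real n powr (1 / \<alpha>)"
  have m: "1 \<le> m" using n \<alpha> by (simp add: m_def ge_one_powr_ge_zero)
  have m\<alpha>: "m powr \<alpha> = real n" using n \<alpha> by (simp add: m_def powr_powr)
  have "1 / (real n + real k powr \<alpha>) \<le> min 1 ((m / real k)\<^sup>2) / real n" if k: "k \<in> {1..p}" for k
  proof (cases "real k \<le> m")
    case True
    then have "1 \<le> (m / real k)\<^sup>2" using k by (simp add: power2_eq_square field_simps mult_mono)
    then have "min 1 ((m / real k)\<^sup>2) = 1" by simp
    moreover have "1 / (real n + real k powr \<alpha>) \<le> 1 / real n"
      using n k by (intro divide_left_mono mult_pos_pos) (auto intro!: add_pos_nonneg)
    ultimately show ?thesis by simp
  next
    case False
    have k0: "0 < real k" using k by simp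
    have "1 / (real n + real k powr \<alpha>) \<le> 1 / (real k powr \<alpha>)"
      using n k0 by (intro divide_left_mono mult_pos_pos) (auto intro!: add_pos_nonneg)
    also have "\<dots> = (m powr \<alpha> / real k powr \<alpha>) / real n"
      unfolding m\<alpha> using n by simp
    also have "m powr \<alpha> / real k powr \<alpha> = (m / real k) powr \<alpha>"
      using m k0 by (simp add: powr_divide)
    also have "(m / real k) powr \<alpha> \<le> (m / real k) powr 2"
      using \<alpha> m k0 False by (intro powr_mono') auto
    also have "(m / real k) powr 2 = (m / real k)\<^sup>2"
      using m k0 by simp
    also have "(m / real k)\<^sup>2 = min 1 ((m / real k)\<^sup>2)"
      using m k0 False by (simp add: power_le_one)
    finally show ?thesis using n by (simp add: divide_right_mono)
  qed
  then have "(\<Sum>k=1..p. 1 / (real n + real k powr \<alpha>)) \<le> (\<Sum>k=1..p. min 1 ((m / real k)\<^sup>2)) / real n"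
    unfolding sum_divide_distrib by (rule sum_mono)
  also have "\<dots> \<le> 3 * min m (real p) / real n"
    using sum_min_square_le[OF m] by (intro divide_right_mono) auto
  finally show ?thesis by (simp add: m_def)
qed

text \<open>Above the threshold \<open>T\<close> the larger exponent wins on its own; up to
  \<open>T\<close> the left side is bounded and \<open>n / 2\<close> absorbs it. The absolute value
  of \<open>lam\<close> in the proof covers negative exponents.\<close>

lemma powr_dominated:
  fixes K0 \<eta> lam \<alpha> :: real
  assumes "0 < K0" "0 < \<eta>" "lam < \<alpha>"
  shows "\<exists>n0\<ge>1::nat. \<forall>n\<ge>n0. \<forall>k\<ge>1. K0 * real k powr lam \<le> real n / 2 + \<eta> * real k powr \<alpha>"
proof -
  define T where "T = max 1 ((K0 / \<eta>) powr (1 / (\<alpha> - lam)))"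
  obtain n0 :: nat where n0: "2 * K0 * T powr \<bar>lam\<bar> \<le> real n0" using real_arch_simple by blast
  have "K0 * real k powr lam \<le> real n / 2 + \<eta> * real k powr \<alpha>" if n: "max 1 n0 \<le> n" and k: "1 \<le> k" for n k :: nat
  proof (cases "real k \<le> T")
    case True
    have "real k powr lam \<le> real k powr \<bar>lam\<bar>" using k by (intro powr_mono) auto
    also have "\<dots> \<le> T powr \<bar>lam\<bar>" using True by (intro powr_mono2) auto
    finally have "K0 * real k powr lam \<le> K0 * T powr \<bar>lam\<bar>" using assms by (intro mult_left_mono) auto
    also have "\<dots> \<le> real n / 2" using n0 n by simp
    finally show ?thesis using assms by (simp add: add_increasing2)
  next
    case False
    then have "(K0 / \<eta>) powr (1 / (\<alpha> - lam)) \<le> real k" by (simp add: T_def)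
    then have "((K0 / \<eta>) powr (1 / (\<alpha> - lam))) powr (\<alpha> - lam) \<le> real k powr (\<alpha> - lam)"
      using assms by (intro powr_mono2) auto
    then have "K0 / \<eta> \<le> real k powr (\<alpha> - lam)" using assms by (simp add: powr_powr)
    then have "K0 / \<eta> * real k powr lam \<le> real k powr (\<alpha> - lam) * real k powr lam" by (intro mult_right_mono) auto
    also have "\<dots> = real k powr \<alpha>" by (simp add: powr_add[symmetric])
    finally show ?thesis using assms by (simp add: field_simps add_increasing)
  qed
  then show ?thesis by (intro exI[of _ "max 1 n0"]) auto
qed

subsection \<open>Penalised generalised linear models\<close>

lemma sum_mult_fun_upd:
  fixes c \<theta> :: "nat \<Rightarrow> real"
  assumes "finite I" "i \<in> I"
  shows "(\<Sum>k\<in>I. c k * (\<theta>(i := t)) k) = (\<Sum>k\<in>I. c k * \<theta> k) + c i * (t - \<theta> i)"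
proof -
  have "(\<Sum>k\<in>I. c k * (\<theta>(i := t)) k) = c i * t + (\<Sum>k\<in>I - {i}. c k * \<theta> k)"
    using assms by (subst sum.remove[of I i]) (auto intro!: sum.cong)
  also have "\<dots> = (\<Sum>k\<in>I. c k * \<theta> k) + c i * (t - \<theta> i)"
    using assms by (simp add: sum.remove[of I i] algebra_simps)
  finally show ?thesis .
qed

text \<open>The negative log posterior is the instance with the design matrix for \<open>X\<close>
  and the weights \<open>k powr (2 * \<gamma>)\<close> for \<open>c\<close>.\<close>

locale penalized_glm =
  fixes h :: "real \<Rightarrow> real" and X :: "nat \<Rightarrow> nat \<Rightarrow> real" and Y c :: "nat \<Rightarrow> real" and n p :: nat
  assumes smooth: "\<And>k s. ((deriv ^^ k) h) differentiable (at s)"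
begin

definition s :: "nat \<Rightarrow> (nat \<Rightarrow> real) \<Rightarrow> real" where
  "s l \<theta> = (\<Sum>k=1..p. X l k * \<theta> k)"

definition F :: "(nat \<Rightarrow> real) \<Rightarrow> real" where
  "F \<theta> = (\<Sum>l=1..n. h (s l \<theta>) - Y l * s l \<theta>) + 1/2 * (\<Sum>k=1..p. c k * (\<theta> k)\<^sup>2)"

lemma s_upd: "i \<in> {1..p} \<Longrightarrow> s l (\<theta>(i := t)) = s l \<theta> + X l i * (t - \<theta> i)"
  unfolding s_def by (rule sum_mult_fun_upd) auto

lemma sq_upd: "i \<in> {1..p} \<Longrightarrow> (\<Sum>k=1..p. c k * ((\<theta>(i := t)) k)\<^sup>2) = (\<Sum>k=1..p. c k * (\<theta> k)\<^sup>2) + c i * (t\<^sup>2 - (\<theta> i)\<^sup>2)"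
proof -
  assume i: "i \<in> {1..p}"
  have "(\<Sum>k=1..p. c k * ((\<theta>(i := t)) k)\<^sup>2) = (\<Sum>k=1..p. c k * ((\<lambda>k. (\<theta> k)\<^sup>2)(i := t\<^sup>2)) k)"
    by (intro sum.cong) auto
  then show ?thesis using i by (subst (asm) sum_mult_fun_upd) auto
qed

lemma DERIV_h: "(h has_real_derivative deriv h u) (at u)"
  using DERIV_iterate[OF smooth, of 0] by simp

lemma DERIV_h': "(deriv h has_real_derivative (deriv ^^ 2) h u) (at u)"
  using DERIV_iterate[OF smooth, of 1] by (simp add: numeral_2_eq_2)

lemma DERIV_F:
  assumes i: "i \<in> {1..p}"
  shows "((\<lambda>t. F (\<theta>(i := t))) has_real_derivative (\<Sum>l=1..n. (deriv h (s l \<theta>) - Y l) * X l i) + c i * \<theta> i) (at (\<theta> i))"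
proof -
  have D: "((\<lambda>t. h (s l \<theta> + X l i * (t - \<theta> i))) has_real_derivative deriv h (s l \<theta>) * X l i) (at (\<theta> i))" for l
    by (rule DERIV_chain'[where g = h]) (auto intro!: derivative_eq_intros simp: DERIV_h)
  have "((\<lambda>t. (\<Sum>l=1..n. h (s l \<theta> + X l i * (t - \<theta> i)) - Y l * (s l \<theta> + X l i * (t - \<theta> i)))
      + 1/2 * ((\<Sum>k=1..p. c k * (\<theta> k)\<^sup>2) + c i * (t\<^sup>2 - (\<theta> i)\<^sup>2)))
    has_real_derivative (\<Sum>l=1..n. (deriv h (s l \<theta>) - Y l) * X l i) + c i * \<theta> i) (at (\<theta> i))"
    by (rule derivative_eq_intros D refl)+ (simp_all add: algebra_simps sum_subtractf)
  then show ?thesis unfolding F_def s_upd[OF i] sq_upd[OF i] .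
qed

lemma partial_F:
  assumes "i \<in> {1..p}"
  shows "partial i F \<theta> = (\<Sum>l=1..n. (deriv h (s l \<theta>) - Y l) * X l i) + c i * \<theta> i"
  unfolding partial_def by (rule DERIV_imp_deriv[OF DERIV_F[OF assms]])

lemma hessian_F:
  assumes i: "i \<in> {1..p}" and j: "j \<in> {1..p}"
  shows "hessian F \<theta> i j = (if i = j then c i else 0) + (\<Sum>l=1..n. (deriv ^^ 2) h (s l \<theta>) * X l i * X l j)"
proof -
  have D: "((\<lambda>t. deriv h (s l \<theta> + X l i * (t - \<theta> i))) has_real_derivative (deriv ^^ 2) h (s l \<theta>) * X l i) (at (\<theta> i))" for l
    by (rule DERIV_chain'[where g = "deriv h"]) (auto intro!: derivative_eq_intros simp: DERIV_h')
  have D2: "((\<lambda>t. (\<theta>(i := t)) j) has_real_derivative (if i = j then 1 else 0)) (at (\<theta> i))"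
    by (cases "i = j") (auto intro!: derivative_eq_intros)
  have "((\<lambda>t. (\<Sum>l=1..n. (deriv h (s l \<theta> + X l i * (t - \<theta> i)) - Y l) * X l j) + c j * (\<theta>(i := t)) j) has_real_derivative
     (\<Sum>l=1..n. (deriv ^^ 2) h (s l \<theta>) * X l i * X l j) + c j * (if i = j then 1 else 0)) (at (\<theta> i))"
    by (rule derivative_eq_intros D D2 refl)+ simp
  then have "((\<lambda>t. partial j F (\<theta>(i := t))) has_real_derivative
     (\<Sum>l=1..n. (deriv ^^ 2) h (s l \<theta>) * X l i * X l j) + c j * (if i = j then 1 else 0)) (at (\<theta> i))"
    unfolding partial_F[OF j] s_upd[OF i] .
  then have "hessian F \<theta> i j = (\<Sum>l=1..n. (deriv ^^ 2) h (s l \<theta>) * X l i * X l j) + c j * (if i = j then 1 else 0)"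
    unfolding hessian_def partial_def[of i] by (rule DERIV_imp_deriv)
  then show ?thesis by simp
qed

lemma stationary:
  assumes min: "is_arg_min F (\<lambda>\<theta>. \<theta> \<in> space (leb p)) a" and i: "i \<in> {1..p}"
  shows "(\<Sum>l=1..n. (deriv h (s l a) - Y l) * X l i) + c i * a i = 0"
proof (rule DERIV_local_min[OF DERIV_F[OF i] zero_less_one])
  \<comment> \<open>Changing a coordinate in \<open>{1..p}\<close> keeps the vector extensional, so
    it competes with the minimiser.\<close>
  have "F a \<le> F (a(i := t))" for t
  proof -
    have "a(i := t) \<in> space (leb p)"
      using min i by (auto simp: is_arg_min_def space_PiM PiE_iff extensional_def)
    then show ?thesis using min by (auto simp: is_arg_min_def not_less)
  qed
  then show "\<forall>t. \<bar>a i - t\<bar> < 1 \<longrightarrow> F (a(i := a i)) \<le> F (a(i := t))" by simp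
qed

text \<open>Stationarity cancels the linear terms and with them \<open>Y\<close>; the data survive
  only through the minimiser \<open>a\<close>. This is why the constants can be uniform over the
  data.\<close>

lemma expansion_at_minimizer:
  assumes min: "is_arg_min F (\<lambda>\<theta>. \<theta> \<in> space (leb p)) a"
  shows "F \<theta> - F a = 1/2 * (\<Sum>k=1..p. c k * (\<theta> k - a k)\<^sup>2)
    + (\<Sum>l=1..n. bregman h (s l a) (\<Sum>k=1..p. X l k * (\<theta> k - a k)))"
proof -
  have s_diff: "(\<Sum>k=1..p. X l k * (\<theta> k - a k)) = s l \<theta> - s l a" for l
    by (simp add: s_def right_diff_distrib sum_subtractf)
  have "(\<Sum>l=1..n. (deriv h (s l a) - Y l) * (s l \<theta> - s l a)) + (\<Sum>k=1..p. c k * a k * (\<theta> k - a k))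
      = (\<Sum>k=1..p. (\<theta> k - a k) * ((\<Sum>l=1..n. (deriv h (s l a) - Y l) * X l k) + c k * a k))"
  proof -
    have "(\<Sum>l=1..n. (deriv h (s l a) - Y l) * (s l \<theta> - s l a)) =
        (\<Sum>l=1..n. \<Sum>k=1..p. (\<theta> k - a k) * ((deriv h (s l a) - Y l) * X l k))"
      unfolding s_diff[symmetric] sum_distrib_left by (simp add: mult_ac)
    also have "\<dots> = (\<Sum>k=1..p. (\<theta> k - a k) * (\<Sum>l=1..n. (deriv h (s l a) - Y l) * X l k))"
      unfolding sum_distrib_left by (rule sum.swap)
    finally show ?thesis by (simp add: distrib_left sum.distrib mult_ac)
  qed
  also have "\<dots> = 0"
    using stationary[OF min] by (intro sum.neutral) auto
  finally have lin: "(\<Sum>l=1..n. (deriv h (s l a) - Y l) * (s l \<theta> - s l a)) + (\<Sum>k=1..p. c k * a k * (\<theta> k - a k)) = 0" .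
  have "F \<theta> - F a - (1/2 * (\<Sum>k=1..p. c k * (\<theta> k - a k)\<^sup>2) + (\<Sum>l=1..n. bregman h (s l a) (s l \<theta> - s l a)))
      = (\<Sum>l=1..n. (h (s l \<theta>) - Y l * s l \<theta>) - (h (s l a) - Y l * s l a) - bregman h (s l a) (s l \<theta> - s l a))
        + (\<Sum>k=1..p. (c k * (\<theta> k)\<^sup>2 - c k * (a k)\<^sup>2 - c k * (\<theta> k - a k)\<^sup>2) / 2)"
    unfolding F_def by (simp add: sum_subtractf sum_divide_distrib[symmetric] diff_divide_distrib)
  also have "\<dots> = (\<Sum>l=1..n. (deriv h (s l a) - Y l) * (s l \<theta> - s l a)) + (\<Sum>k=1..p. c k * a k * (\<theta> k - a k))"
    by (intro arg_cong2[where f="(+)"] sum.cong refl) (simp_all add: bregman_def field_simps power2_eq_square)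
  finally show ?thesis unfolding s_diff lin by simp
qed

end

section \<open>Laplace approximation of a penalised model\<close>

context penalized_glm
begin

lemma quadratic_form_split:
  fixes w z :: "nat \<Rightarrow> real"
  shows "(\<Sum>i=1..p. \<Sum>j=1..p. z i * ((if i = j then c i else 0) + \<kappa> * (\<Sum>l=1..n. w l * X l i * X l j)) * z j)
    = (\<Sum>k=1..p. c k * (z k)\<^sup>2) + \<kappa> * (\<Sum>l=1..n. w l * (\<Sum>k=1..p. X l k * z k)\<^sup>2)"
proof -
  have 1: "(\<Sum>i=1..p. \<Sum>j=1..p. z i * (if i = j then c i else 0) * z j) = (\<Sum>k=1..p. c k * (z k)\<^sup>2)"
  proof (intro sum.cong refl)
    fix i assume i: "i \<in> {1..p}"
    have "(\<Sum>j=1..p. z i * (if i = j then c i else 0) * z j) = (\<Sum>j=1..p. if i = j then c i * (z i)\<^sup>2 else 0)"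
      by (intro sum.cong) (auto simp: power2_eq_square)
    then show "(\<Sum>j=1..p. z i * (if i = j then c i else 0) * z j) = c i * (z i)\<^sup>2" using i by simp
  qed
  have "(\<Sum>l=1..n. w l * (\<Sum>k=1..p. X l k * z k)\<^sup>2) = (\<Sum>l=1..n. \<Sum>i=1..p. \<Sum>j=1..p. z i * (w l * X l i * X l j) * z j)"
    unfolding power2_eq_square sum_product unfolding sum_distrib_left by (intro sum.cong refl) (simp only: mult_ac)
  also have "\<dots> = (\<Sum>i=1..p. \<Sum>l=1..n. \<Sum>j=1..p. z i * (w l * X l i * X l j) * z j)"
    by (rule sum.swap)
  also have "\<dots> = (\<Sum>i=1..p. \<Sum>j=1..p. \<Sum>l=1..n. z i * (w l * X l i * X l j) * z j)"
    by (intro sum.cong refl sum.swap)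
  also have "\<dots> = (\<Sum>i=1..p. \<Sum>j=1..p. z i * (\<Sum>l=1..n. w l * X l i * X l j) * z j)"
    by (simp add: sum_distrib_left sum_distrib_right)
  finally have 2: "(\<Sum>l=1..n. w l * (\<Sum>k=1..p. X l k * z k)\<^sup>2) = (\<Sum>i=1..p. \<Sum>j=1..p. z i * (\<Sum>l=1..n. w l * X l i * X l j) * z j)" .
  show ?thesis
    unfolding 1[symmetric] 2 by (simp add: sum_distrib_left sum.distrib[symmetric] algebra_simps)
qed

text \<open>The curvature bound settles increments up to 1; a larger one is rescaled to unit size
  and compared along its ray by \<open>bregman_star\<close>.\<close>

lemma bregman_nonneg:
  assumes convex: "\<And>s t u. s \<noteq> t \<Longrightarrow> 0 < u \<Longrightarrow> u < 1 \<Longrightarrow> h (u * s + (1 - u) * t) < u * h s + (1 - u) * h t"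
    and lower: "0 < wlo" "\<And>u. \<bar>u\<bar> \<le> C + 1 \<Longrightarrow> wlo \<le> (deriv ^^ 2) h u" and v: "\<bar>v\<bar> \<le> C"
  shows "0 \<le> bregman h v t"
proof -
  have small: "0 \<le> bregman h v t" if "\<bar>t\<bar> \<le> 1" for t
  proof -
    have "wlo * t\<^sup>2 / 2 \<le> bregman h v t" by (rule bregman_lower[OF smooth lower(2) v that])
    moreover have "0 \<le> wlo * t\<^sup>2 / 2" using lower(1) by simp
    ultimately show ?thesis by linarith
  qed
  show ?thesis
  proof (cases "\<bar>t\<bar> \<le> 1")
    case False
    then have "0 \<le> \<bar>t\<bar> * bregman h v (t / \<bar>t\<bar>)" by (intro mult_nonneg_nonneg small) auto
    also have "\<dots> \<le> bregman h v (\<bar>t\<bar> * (t / \<bar>t\<bar>))" using False by (intro bregman_star convex) auto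
    finally show ?thesis using False by simp
  qed (rule small)
qed

text \<open>Instantiates the abstract comparison with variance proxy \<open>S * d / n\<close> and
  \<open>c1 = wlo / whi\<close>. The hypothesis \<open>var\<close> expresses, without an inverse
  matrix, that each linear predictor has at most this variance under the Laplace
  approximation.\<close>

lemma TV_laplace_le:
  fixes C L wlo whi S d \<nu> E :: real
  assumes convex: "\<And>s t u. s \<noteq> t \<Longrightarrow> 0 < u \<Longrightarrow> u < 1 \<Longrightarrow> h (u * s + (1 - u) * t) < u * h s + (1 - u) * h t"
    and n: "1 \<le> n" and c_pos: "\<And>k. k \<in> {1..p} \<Longrightarrow> 0 < c k"
    and min: "is_arg_min F (\<lambda>\<theta>. \<theta> \<in> space (leb p)) a"
    and sC: "\<And>l. l \<in> {1..n} \<Longrightarrow> \<bar>s l a\<bar> \<le> C"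
    and L: "0 < L" "\<And>u. \<bar>u\<bar> \<le> C + 1 \<Longrightarrow> \<bar>(deriv ^^ 3) h u\<bar> \<le> L"
    and wlo: "0 < wlo" "\<And>u. \<bar>u\<bar> \<le> C + 1 \<Longrightarrow> wlo \<le> (deriv ^^ 2) h u"
    and whi: "\<And>u. \<bar>u\<bar> \<le> C + 1 \<Longrightarrow> (deriv ^^ 2) h u \<le> whi"
    and S: "0 < S" and d: "1 \<le> d"
    and var: "\<And>l z. l \<in> {1..n} \<Longrightarrow> (\<Sum>k=1..p. X l k * z k)\<^sup>2 \<le> S * d / real n *
        ((\<Sum>k=1..p. c k * (z k)\<^sup>2) + (\<Sum>l=1..n. (deriv ^^ 2) h (s l a) * (\<Sum>k=1..p. X l k * z k)\<^sup>2))"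
    and \<nu>: "\<nu> ^ 3 = real n"
    and E: "E = 8 * whi * S / (wlo / whi) + 1"
    and small: "d \<le> \<nu>" "8 * L * S * sqrt (4 * E / (wlo / whi * wlo)) * d \<le> \<nu>" "4 * S * E * d \<le> wlo / whi * \<nu>"
  shows "TV (gibbs p F) (laplace_approx p F a) \<le> 2 * ((256 * exp 2 * L * (S * sqrt S) + 15625) * (d * sqrt d / sqrt (real n)))"
proof -
  define g where "g \<theta> = 1/2 * (\<Sum>k=1..p. c k * (\<theta> k - a k)\<^sup>2)" for \<theta> :: "nat \<Rightarrow> real"
  define x where "x l \<theta> = (\<Sum>k=1..p. X l k * (\<theta> k - a k))" for l and \<theta> :: "nat \<Rightarrow> real"
  define w where "w l = (deriv ^^ 2) h (s l a)" for l
  define D where "D l = bregman h (s l a)" for l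
  define \<sigma> where "\<sigma> = sqrt (S * d / real n)"
  define A where "A \<kappa> i j = (if i = j then c i else 0) + \<kappa> * (\<Sum>l=1..n. w l * X l i * X l j)" for \<kappa> and i j :: nat
  have \<sigma>: "0 < \<sigma>" "\<sigma>\<^sup>2 = S * d / real n" using S d n by (auto simp: \<sigma>_def)
  have sC1: "\<bar>s l a\<bar> \<le> C + 1" if "l \<in> {1..n}" for l using sC[OF that] by linarith
  have w: "wlo \<le> w l" "w l \<le> whi" "0 \<le> w l" if "l \<in> {1..n}" for l
    using wlo(1) wlo(2)[OF sC1[OF that]] whi[OF sC1[OF that]] by (auto simp: w_def)
  have whi_pos: "0 < whi" using w[of 1] n wlo(1) by auto
  have wlo_whi: "wlo \<le> whi" using w[of 1] n by auto
  have quad: "(\<Sum>i=1..p. \<Sum>j=1..p. z i * A \<kappa> i j * z j) = (\<Sum>k=1..p. c k * (z k)\<^sup>2) + \<kappa> * (\<Sum>l=1..n. w l * (\<Sum>k=1..p. X l k * z k)\<^sup>2)" for \<kappa> and z :: "nat \<Rightarrow> real"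
    unfolding A_def by (rule quadratic_form_split)
  have c_nonneg: "0 \<le> (\<Sum>k=1..p. c k * (z k)\<^sup>2)" for z
    using c_pos by (intro sum_nonneg mult_nonneg_nonneg) (auto simp: less_imp_le)
  have w_nonneg: "0 \<le> (\<Sum>l=1..n. w l * (\<Sum>k=1..p. X l k * z k)\<^sup>2)" for z :: "nat \<Rightarrow> real"
    using w by (intro sum_nonneg mult_nonneg_nonneg) auto
  have A_sym: "A \<kappa> i j = A \<kappa> j i" for \<kappa> i j
    by (simp add: A_def mult_ac)
  have A_pos: "0 < (\<Sum>i=1..p. \<Sum>j=1..p. z i * A \<kappa> i j * z j)" if "0 < \<kappa>" "\<exists>i\<in>{1..p}. z i \<noteq> 0" for \<kappa> z
  proof -
    from that(2) obtain i where i: "i \<in> {1..p}" "z i \<noteq> 0" by auto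
    have "0 < c i * (z i)\<^sup>2" using i c_pos by simp
    also have "\<dots> \<le> (\<Sum>k=1..p. c k * (z k)\<^sup>2)"
      using i c_pos by (intro member_le_sum) (auto simp: less_imp_le)
    finally show ?thesis unfolding quad using that(1) w_nonneg by (simp add: add_pos_nonneg)
  qed
  have exp_eq: "exp (- g \<theta> - \<kappa> * (\<Sum>l=1..n. w l * (x l \<theta>)\<^sup>2) / 2) = exp (- (\<Sum>i=1..p. \<Sum>j=1..p. (\<theta> i - a i) * A \<kappa> i j * (\<theta> j - a j)) / 2)" for \<kappa> \<theta>
    unfolding quad g_def x_def by (simp add: field_simps)
  have int_g: "integrable (leb p) (\<lambda>\<theta>. exp (- g \<theta>))"
    using integrable_exp_diagonal[OF c_pos, where a = a] by (simp add: g_def)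
  have x_m[measurable]: "x l \<in> borel_measurable (leb p)" for l unfolding x_def by measurable
  have g_m[measurable]: "g \<in> borel_measurable (leb p)" unfolding g_def by measurable
  have int: "integrable (leb p) (\<lambda>\<theta>. exp (- g \<theta> - \<kappa> * (\<Sum>l=1..n. w l * (x l \<theta>)\<^sup>2) / 2))" if "0 < \<kappa>" for \<kappa>
  proof (rule Bochner_Integration.integrable_bound[OF int_g])
    show "AE \<theta> in leb p. norm (exp (- g \<theta> - \<kappa> * (\<Sum>l=1..n. w l * (x l \<theta>)\<^sup>2) / 2)) \<le> norm (exp (- g \<theta>))"
      using that w_nonneg by (intro AE_I2) (simp add: x_def)
  qed measurable
  interpret sigma_finite_measure "leb p"
    by (rule finite_product_sigma_finite.axioms(1)[OF _, THEN product_sigma_finite.sigma_finite]) (use product_sigma_finite_lborel in \<open>auto simp: finite_product_sigma_finite_def finite_product_sigma_finite_axioms_def\<close>)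
  interpret LP: laplace_potential "leb p" g x w n \<sigma> wlo whi D L "wlo / whi"
  proof
    fix \<kappa> t :: real and j assume \<kappa>: "0 < \<kappa>" "\<kappa> \<le> 1" and j: "j \<in> {1..n}"
    have v: "(\<Sum>k=1..p. X j k * z k)\<^sup>2 \<le> \<sigma>\<^sup>2 / \<kappa> * (\<Sum>i=1..p. \<Sum>j=1..p. z i * A \<kappa> i j * z j)" for z
    proof -
      have "(\<Sum>k=1..p. X j k * z k)\<^sup>2 \<le> \<sigma>\<^sup>2 * ((\<Sum>k=1..p. c k * (z k)\<^sup>2) + (\<Sum>l=1..n. w l * (\<Sum>k=1..p. X l k * z k)\<^sup>2))"
        using var[OF j] unfolding \<sigma>(2) w_def .
      \<comment> \<open>Dividing the penalty by \<open>\<kappa> \<le> 1\<close> only enlarges it,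
        and turns the Hessian into its tempered version times \<open>1 / \<kappa>\<close>.\<close>
      also have "\<dots> \<le> \<sigma>\<^sup>2 * ((\<Sum>k=1..p. c k * (z k)\<^sup>2) / \<kappa> + (\<Sum>l=1..n. w l * (\<Sum>k=1..p. X l k * z k)\<^sup>2))"
        using \<kappa> c_nonneg[of z] by (intro mult_left_mono add_right_mono) (auto simp: le_divide_eq mult_left_le)
      also have "\<dots> = \<sigma>\<^sup>2 / \<kappa> * (\<Sum>i=1..p. \<Sum>j=1..p. z i * A \<kappa> i j * z j)"
        unfolding quad using \<kappa> by (simp add: field_simps)
      finally show ?thesis .
    qed
    have s0: "0 \<le> \<sigma>\<^sup>2 / \<kappa>" using \<kappa> by simp
    have te: "t\<^sup>2 * (\<sigma>\<^sup>2 / \<kappa>) / 2 = t\<^sup>2 * \<sigma>\<^sup>2 / (2 * \<kappa>)" by simp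
    show "integrable (leb p) (\<lambda>\<theta>. exp (- g \<theta> - \<kappa> * (\<Sum>j=1..n. w j * (x j \<theta>)\<^sup>2) / 2) * exp (t * x j \<theta>)) \<and>
        (\<integral>\<theta>. exp (- g \<theta> - \<kappa> * (\<Sum>j=1..n. w j * (x j \<theta>)\<^sup>2) / 2) * exp (t * x j \<theta>) \<partial>leb p)
          \<le> exp (t\<^sup>2 * \<sigma>\<^sup>2 / (2 * \<kappa>)) * (\<integral>\<theta>. exp (- g \<theta> - \<kappa> * (\<Sum>j=1..n. w j * (x j \<theta>)\<^sup>2) / 2) \<partial>leb p)"
      using gaussian_mgf_le[where A = "A \<kappa>" and a = a and v = "X j" and t = t, OF A_sym A_pos[OF \<kappa>(1)] s0 v int[OF \<kappa>(1), unfolded exp_eq]]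
      unfolding exp_eq x_def[of j] te by blast
  next
    show "0 < (\<integral>\<theta>. exp (- g \<theta> - (\<Sum>j=1..n. w j * (x j \<theta>)\<^sup>2) / 2) \<partial>leb p)"
      using integral_leb_pos[OF int[of 1]] by simp
  next
    fix j and t :: real assume j: "j \<in> {1..n}" and t: "\<bar>t\<bar> \<le> 1"
    show "\<bar>D j t - w j * t\<^sup>2 / 2\<bar> \<le> L * \<bar>t\<bar> ^ 3"
      unfolding D_def w_def by (rule bregman_Taylor[OF smooth L(2) sC[OF j] t])
    have "wlo / whi * (w j * t\<^sup>2 / 2) \<le> wlo / whi * (whi * t\<^sup>2 / 2)"
      using w[OF j] wlo(1) whi_pos by (intro mult_left_mono divide_right_mono mult_right_mono) auto
    also have "\<dots> = wlo * t\<^sup>2 / 2" using whi_pos by simp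
    also have "\<dots> \<le> D j t"
      unfolding D_def by (rule bregman_lower[OF smooth wlo(2) sC[OF j] t])
    finally show "wlo / whi * (w j * t\<^sup>2 / 2) \<le> D j t" .
  next
    fix j and r t :: real assume "j \<in> {1..n}" "1 \<le> r"
    then show "r * D j t \<le> D j (r * t)" unfolding D_def by (intro bregman_star convex)
  next
    show "D j \<in> borel_measurable borel" for j
      unfolding D_def by (rule bregman_measurable[OF smooth])
  qed (use n \<sigma> wlo(1) L(1) w wlo_whi whi_pos x_m g_m in auto)
  \<comment> \<open>The value at the minimum is a constant factor that cancels on
    normalisation.\<close>
  define e0 where "e0 = exp (- F a)"
  have b_eq: "exp (- F \<theta>) = e0 * LP.b \<theta>" for \<theta>
  proof -
    have "F \<theta> = F a + (g \<theta> + (\<Sum>j=1..n. D j (x j \<theta>)))"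
      using expansion_at_minimizer[OF min, of \<theta>] by (simp add: g_def x_def D_def)
    then show ?thesis by (simp add: e0_def LP.b_def exp_add[symmetric])
  qed
  \<comment> \<open>Nonnegativity of the divergences makes the prior part alone an integrable
    majorant.\<close>
  have "LP.b \<theta> \<le> exp (- g \<theta>)" for \<theta>
    unfolding LP.b_def D_def using bregman_nonneg[OF convex wlo sC] by (auto intro!: sum_nonneg)
  then have int_b: "integrable (leb p) LP.b"
    by (intro Bochner_Integration.integrable_bound[OF int_g] LP.b_measurable) (auto intro!: AE_I2 simp: LP.b_pos)
  have int_G: "integrable (leb p) (LP.G 1)" by (rule LP.integrable_G) auto
  have Zb: "0 < (\<integral>\<theta>. LP.b \<theta> \<partial>leb p)" using integral_leb_pos[OF int_b LP.b_pos(1)] .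
  have gibbs_F: "gibbs p F = density (leb p) (\<lambda>\<theta>. ennreal (LP.b \<theta> / (\<integral>\<theta>. LP.b \<theta> \<partial>leb p)))"
    unfolding gibbs_def b_eq by (simp add: e0_def)
  have "mat_inv p (mat_inv p (hessian F a)) i j = A 1 i j" if "i \<in> {1..p}" "j \<in> {1..p}" for i j
  proof -
    have H: "hessian F a i j = A 1 i j" if "i \<in> {1..p}" "j \<in> {1..p}" for i j
      using hessian_F[OF that] by (simp add: A_def w_def)
    have "mat_inv p (mat_inv p (hessian F a)) i j = hessian F a i j"
    proof (rule mat_inv_mat_inv[OF _ _ that])
      show "hessian F a i j = hessian F a j i" if "i \<in> {1..p}" "j \<in> {1..p}" for i j
        using H that A_sym by metis
      show "0 < (\<Sum>i=1..p. \<Sum>j=1..p. z i * hessian F a i j * z j)" if "\<exists>i\<in>{1..p}. z i \<noteq> 0" for z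
        using A_pos[of 1 z] that by (simp only: H zero_less_one cong: sum.cong)
    qed
    with H[OF that] show ?thesis by simp
  qed
  then have "1 / 2 * (\<Sum>i=1..p. \<Sum>j=1..p. (\<theta> i - a i) * mat_inv p (mat_inv p (hessian F a)) i j * (\<theta> j - a j))
      = (\<Sum>i=1..p. \<Sum>j=1..p. (\<theta> i - a i) * A 1 i j * (\<theta> j - a j)) / 2" for \<theta>
    by (simp only: cong: sum.cong)
  then have laplace_F: "laplace_approx p F a = density (leb p) (\<lambda>\<theta>. ennreal (LP.G 1 \<theta> / (\<integral>\<theta>. LP.G 1 \<theta> \<partial>leb p)))"
    unfolding laplace_approx_def gaussian_def gibbs_def LP.G_def LP.Q_def exp_eq[of _ 1] by simp
  have "ennreal (\<integral>\<theta>. \<bar>LP.b \<theta> - LP.G 1 \<theta>\<bar> \<partial>leb p) = (\<integral>\<^sup>+\<theta>. ennreal \<bar>LP.b \<theta> - LP.G 1 \<theta>\<bar> \<partial>leb p)"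
    using int_b int_G by (intro nn_integral_eq_integral[symmetric]) auto
  also have "\<dots> \<le> ennreal ((256 * exp 2 * L * (S * sqrt S) + 15625) * (d * sqrt d / sqrt (real n)) * LP.Z 1)"
    by (rule LP.L1_distance_le[OF d \<nu> S \<sigma>(2) E small])
  finally have le: "(\<integral>\<theta>. \<bar>LP.b \<theta> - LP.G 1 \<theta>\<bar> \<partial>leb p) \<le> (256 * exp 2 * L * (S * sqrt S) + 15625) * (d * sqrt d / sqrt (real n)) * LP.Z 1"
    using L S d LP.Z1_pos' by (subst (asm) ennreal_le_iff) (auto intro!: mult_nonneg_nonneg add_nonneg_nonneg)
  have "TV (gibbs p F) (laplace_approx p F a) \<le> 2 * (\<integral>\<theta>. \<bar>LP.b \<theta> - LP.G 1 \<theta>\<bar> \<partial>leb p) / LP.Z 1"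
    unfolding gibbs_F laplace_F LP.Z_def
    by (rule TV_density_le[OF int_G int_b LP.G_pos(2) LP.b_pos(2) LP.Z1_pos'[unfolded LP.Z_def] Zb])
  also have "\<dots> \<le> 2 * ((256 * exp 2 * L * (S * sqrt S) + 15625) * (d * sqrt d / sqrt (real n)) * LP.Z 1) / LP.Z 1"
    using LP.Z1_pos' le by (intro divide_right_mono mult_left_mono) auto
  finally show ?thesis using LP.Z1_pos' by simp
qed

end

subsection \<open>The inverse problem\<close>

lemma Cauchy_Schwarz_weighted:
  fixes v z c :: "'i \<Rightarrow> real"
  assumes "\<And>k. k \<in> I \<Longrightarrow> 0 < c k"
  shows "(\<Sum>k\<in>I. v k * z k)\<^sup>2 \<le> (\<Sum>k\<in>I. (v k)\<^sup>2 / c k) * (\<Sum>k\<in>I. c k * (z k)\<^sup>2)"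
proof -
  have "(\<Sum>k\<in>I. v k * z k) = (\<Sum>k\<in>I. (v k / sqrt (c k)) * (sqrt (c k) * z k))"
  proof (intro sum.cong refl)
    fix k assume "k \<in> I"
    with assms[of k] show "v k * z k = (v k / sqrt (c k)) * (sqrt (c k) * z k)" by simp
  qed
  then have "(\<Sum>k\<in>I. v k * z k)\<^sup>2 \<le> (\<Sum>k\<in>I. (v k / sqrt (c k))\<^sup>2) * (\<Sum>k\<in>I. (sqrt (c k) * z k)\<^sup>2)"
    by (simp only: Cauchy_Schwarz_ineq_sum)
  also have "\<dots> = (\<Sum>k\<in>I. (v k)\<^sup>2 / c k) * (\<Sum>k\<in>I. c k * (z k)\<^sup>2)"
    using assms by (intro arg_cong2[where f="(*)"] sum.cong) (auto simp: power_divide power_mult_distrib less_imp_le)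
  finally show ?thesis .
qed

context inverse_problem
begin

text \<open>Membership in \<open>E\<close> is carried through the induction because \<open>R\<close>
  is linear on \<open>E\<close> only. The base case is linearity with both coefficients 0.\<close>

lemma R_q_fun:
  assumes "x \<in> {0..1}"
  shows "q_fun \<phi> p \<theta> \<in> E \<and> R (q_fun \<phi> p \<theta>) x = (\<Sum>k=1..p. R (\<phi> k) x * \<theta> k)"
proof -
  have lin: "R (\<lambda>t. a * f t + b * g t) x = a * R f x + b * R g x" if "f \<in> E" "g \<in> E" for f g a b
    using compact_linear assms that unfolding compact_linear_op_def by blast
  show ?thesis
  proof (induction p)
    case 0
    have "(\<lambda>x. 0) \<in> E" using subspace by (simp add: L2_subspace_def)
    with lin[of "\<lambda>x. 0" "\<lambda>x. 0" 0 0] show ?case by (simp add: q_fun_def)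
  next
    case (Suc p)
    have \<phi>: "\<phi> (Suc p) \<in> E" using basis by (simp add: complete_orthonormal_basis_def)
    have eq: "q_fun \<phi> (Suc p) \<theta> = (\<lambda>t. 1 * q_fun \<phi> p \<theta> t + \<theta> (Suc p) * \<phi> (Suc p) t)"
      by (simp add: q_fun_def)
    have "q_fun \<phi> (Suc p) \<theta> \<in> E"
      using subspace \<phi> Suc unfolding eq L2_subspace_def by blast
    moreover have "R (q_fun \<phi> (Suc p) \<theta>) x = 1 * R (q_fun \<phi> p \<theta>) x + \<theta> (Suc p) * R (\<phi> (Suc p)) x"
      unfolding eq using \<phi> Suc by (intro lin) auto
    ultimately show ?case using Suc by (simp add: mult.commute)
  qed
qed

lemma design_eq: "k \<ge> 1 \<Longrightarrow> design R \<phi> n l k = sqrt (eig k) * psi R \<phi> eig k (real l / real n)"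
  using eig_pos[of k] by (simp add: design_def psi_def)

lemma sum_design_square:
  "(\<Sum>l=1..n. (\<Sum>k=1..p. design R \<phi> n l k * z k)\<^sup>2)
    = (\<Sum>k=1..p. \<Sum>l=1..p. (sqrt (eig k) * z k) * Psi_mat R \<phi> eig n k l * (sqrt (eig l) * z l))"
proof -
  define \<psi> where "\<psi> l k = psi R \<phi> eig k (real l / real n)" for l k
  define u where "u k = sqrt (eig k) * z k" for k
  have "(\<Sum>l=1..n. (\<Sum>k=1..p. design R \<phi> n l k * z k)\<^sup>2) = (\<Sum>l=1..n. (\<Sum>k=1..p. \<psi> l k * u k)\<^sup>2)"
    by (intro sum.cong refl arg_cong[where f="\<lambda>x. x\<^sup>2"]) (simp add: design_eq \<psi>_def u_def)
  also have "\<dots> = (\<Sum>l=1..n. \<Sum>i=1..p. \<Sum>j=1..p. u i * (\<psi> l i * \<psi> l j) * u j)"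
    unfolding power2_eq_square sum_product by (intro sum.cong refl) (simp only: mult_ac)
  also have "\<dots> = (\<Sum>i=1..p. \<Sum>l=1..n. \<Sum>j=1..p. u i * (\<psi> l i * \<psi> l j) * u j)"
    by (rule sum.swap)
  also have "\<dots> = (\<Sum>i=1..p. \<Sum>j=1..p. \<Sum>l=1..n. u i * (\<psi> l i * \<psi> l j) * u j)"
    by (intro sum.cong refl sum.swap)
  also have "\<dots> = (\<Sum>i=1..p. \<Sum>j=1..p. u i * Psi_mat R \<phi> eig n i j * u j)"
    unfolding Psi_mat_def \<psi>_def by (simp add: sum_distrib_left sum_distrib_right)
  finally show ?thesis by (simp add: u_def)
qed

text \<open>In the coordinates \<open>sqrt (eig k) * z k\<close> the Gram matrix of the design is
  \<open>Psi_mat\<close>, which (ii) replaces by \<open>n\<close> times the identity at a price. By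
  \<open>dom\<close>, half of the data term and half of the penalty pay this price; the other halves
  give the two entries of the minimum.\<close>

lemma curvature_lower_bound:
  fixes \<gamma> lam K0 \<omega> :: real and w z :: "nat \<Rightarrow> real"
  assumes n: "n \<ge> 1" and p: "p \<ge> 1"
    and ii: "\<And>u. \<bar>\<Sum>k=1..p. \<Sum>l=1..p. u k * (Psi_mat R \<phi> eig n k l - (if k = l then real n else 0)) * u l\<bar>
             \<le> K0 * (\<Sum>k=1..p. real k powr lam * (u k)\<^sup>2)"
    and dom: "\<And>k. k \<ge> 1 \<Longrightarrow> K0 * real k powr lam \<le> real n / 2 + 1 / (2 * \<omega> * C') * real k powr (2 * \<beta> + 2 * \<gamma>)"
    and \<omega>: "0 < \<omega>" "\<And>l. l \<in> {1..n} \<Longrightarrow> \<omega> \<le> w l"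
  shows "min (\<omega> * c' / 2) (1 / 2) * (\<Sum>k=1..p. (real n * real k powr (- 2 * \<beta>) + real k powr (2 * \<gamma>)) * (z k)\<^sup>2)
    \<le> (\<Sum>k=1..p. real k powr (2 * \<gamma>) * (z k)\<^sup>2) + (\<Sum>l=1..n. w l * (\<Sum>k=1..p. design R \<phi> n l k * z k)\<^sup>2)"
proof -
  define u where "u k = sqrt (eig k) * z k" for k
  define T where "T = (\<Sum>l=1..n. (\<Sum>k=1..p. design R \<phi> n l k * z k)\<^sup>2)"
  have u2: "(u k)\<^sup>2 = eig k * (z k)\<^sup>2" if "k \<in> {1..p}" for k
    using eig_pos[of k] that by (simp add: u_def power_mult_distrib less_imp_le)
  have C': "0 < C'" using const_ranges by linarith
  have diag: "(\<Sum>k=1..p. \<Sum>l=1..p. u k * (if k = l then real n else 0) * u l) = real n * (\<Sum>k=1..p. (u k)\<^sup>2)"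
    unfolding sum_distrib_left
  proof (intro sum.cong refl)
    fix k assume "k \<in> {1..p}"
    moreover have "(\<Sum>l=1..p. u k * (if k = l then real n else 0) * u l) = (\<Sum>l=1..p. if k = l then real n * (u k)\<^sup>2 else 0)"
      by (intro sum.cong) (auto simp: power2_eq_square)
    ultimately show "(\<Sum>l=1..p. u k * (if k = l then real n else 0) * u l) = real n * (u k)\<^sup>2" by simp
  qed
  have "(\<Sum>k=1..p. \<Sum>l=1..p. u k * (Psi_mat R \<phi> eig n k l - (if k = l then real n else 0)) * u l)
      = T - real n * (\<Sum>k=1..p. (u k)\<^sup>2)"
    unfolding diag[symmetric] T_def sum_design_square u_def[symmetric]
    by (simp add: right_diff_distrib left_diff_distrib sum_subtractf)
  with ii[of u] have T: "real n * (\<Sum>k=1..p. (u k)\<^sup>2) - K0 * (\<Sum>k=1..p. real k powr lam * (u k)\<^sup>2) \<le> T"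
    by linarith
  have "min (\<omega> * c' / 2) (1 / 2) * (\<Sum>k=1..p. (real n * real k powr (- 2 * \<beta>) + real k powr (2 * \<gamma>)) * (z k)\<^sup>2)
      \<le> (\<Sum>k=1..p. real k powr (2 * \<gamma>) * (z k)\<^sup>2 + \<omega> * (real n - K0 * real k powr lam) * (u k)\<^sup>2)"
    unfolding sum_distrib_left
  proof (intro sum_mono)
    fix k assume k: "k \<in> {1..p}"
    define e where "e = min (\<omega> * c' / 2) (1 / 2)"
    have e: "0 \<le> e" "e \<le> \<omega> * c' / 2" "e \<le> 1 / 2" using \<omega> const_ranges by (auto simp: e_def)
    have eig: "0 < eig k" "c' * real k powr (- 2 * \<beta>) \<le> eig k" "eig k \<le> C' * real k powr (- 2 * \<beta>)"
      using eig_pos[of k] eig_bounds[of k] k by auto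
    have "e * (real n * real k powr (- 2 * \<beta>) + real k powr (2 * \<gamma>))
        \<le> (\<omega> * c' / 2) * (real n * real k powr (- 2 * \<beta>)) + 1 / 2 * real k powr (2 * \<gamma>)"
      unfolding distrib_left using e by (intro add_mono mult_right_mono) auto
    also have "(\<omega> * c' / 2) * (real n * real k powr (- 2 * \<beta>)) = \<omega> * real n / 2 * (c' * real k powr (- 2 * \<beta>))" by simp
    also have "\<dots> \<le> \<omega> * real n / 2 * eig k" using eig \<omega> by (intro mult_left_mono) auto
    finally have 1: "e * (real n * real k powr (- 2 * \<beta>) + real k powr (2 * \<gamma>)) \<le> \<omega> * real n / 2 * eig k + 1 / 2 * real k powr (2 * \<gamma>)"
      by simp
    \<comment> \<open>The coefficient is such that, by the upper eigenvalue bound, this part of the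
      price uses at most half of the penalty.\<close>
    define y where "y = 1 / (2 * \<omega> * C') * real k powr (2 * \<beta> + 2 * \<gamma>)"
    have "\<omega> * eig k * y = eig k * (real k powr (2 * \<beta> + 2 * \<gamma>) / (2 * C'))"
      using \<omega> by (simp add: y_def)
    also have "\<dots> \<le> (C' * real k powr (- 2 * \<beta>)) * (real k powr (2 * \<beta> + 2 * \<gamma>) / (2 * C'))"
      using eig C' by (intro mult_right_mono) auto
    also have "\<dots> = (real k powr (- 2 * \<beta>) * real k powr (2 * \<beta> + 2 * \<gamma>)) / 2"
      using C' by simp
    also have "\<dots> = 1 / 2 * real k powr (2 * \<gamma>)" by (simp add: powr_add[symmetric])
    finally have 2: "\<omega> * eig k * y \<le> 1 / 2 * real k powr (2 * \<gamma>)" .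
    have "\<omega> * eig k * (K0 * real k powr lam) \<le> \<omega> * eig k * (real n / 2 + y)"
      using \<omega> eig dom[of k] k unfolding y_def by (intro mult_left_mono) auto
    also have "\<dots> = \<omega> * real n / 2 * eig k + \<omega> * eig k * y"
      by (simp add: distrib_left)
    also have "\<dots> \<le> \<omega> * real n / 2 * eig k + 1 / 2 * real k powr (2 * \<gamma>)"
      using 2 by (rule add_left_mono)
    finally have "e * (real n * real k powr (- 2 * \<beta>) + real k powr (2 * \<gamma>)) \<le> real k powr (2 * \<gamma>) + \<omega> * (real n - K0 * real k powr lam) * eig k"
      using 1 by (simp add: algebra_simps)
    then have "e * (real n * real k powr (- 2 * \<beta>) + real k powr (2 * \<gamma>)) * (z k)\<^sup>2
        \<le> (real k powr (2 * \<gamma>) + \<omega> * (real n - K0 * real k powr lam) * eig k) * (z k)\<^sup>2"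
      by (rule mult_right_mono) simp
    then show "e * ((real n * real k powr (- 2 * \<beta>) + real k powr (2 * \<gamma>)) * (z k)\<^sup>2)
        \<le> real k powr (2 * \<gamma>) * (z k)\<^sup>2 + \<omega> * (real n - K0 * real k powr lam) * (u k)\<^sup>2"
      unfolding u2[OF k] by (simp add: algebra_simps)
  qed
  also have "\<dots> = (\<Sum>k=1..p. real k powr (2 * \<gamma>) * (z k)\<^sup>2)
      + \<omega> * (real n * (\<Sum>k=1..p. (u k)\<^sup>2) - K0 * (\<Sum>k=1..p. real k powr lam * (u k)\<^sup>2))"
    by (simp add: sum.distrib sum_subtractf sum_distrib_left algebra_simps)
  also have "\<dots> \<le> (\<Sum>k=1..p. real k powr (2 * \<gamma>) * (z k)\<^sup>2) + \<omega> * T"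
    using T \<omega> by (intro add_left_mono mult_left_mono) auto
  also have "\<omega> * T \<le> (\<Sum>l=1..n. w l * (\<Sum>k=1..p. design R \<phi> n l k * z k)\<^sup>2)"
    unfolding T_def sum_distrib_left using \<omega> by (intro sum_mono mult_right_mono) auto
  finally show ?thesis by simp
qed

text \<open>Weighted Cauchy-Schwarz with the diagonal from \<open>curvature_lower_bound\<close>. The
  squared design entries are of order \<open>k powr (- 2 * \<beta>)\<close>, so the sum is the
  effective dimension divided by \<open>n\<close>.\<close>

lemma variance_bound:
  fixes \<gamma> lam K0 \<omega> B :: real and w z :: "nat \<Rightarrow> real"
  assumes n: "n \<ge> 1" and p: "p \<ge> 1"
    and ii: "\<And>u. \<bar>\<Sum>k=1..p. \<Sum>l=1..p. u k * (Psi_mat R \<phi> eig n k l - (if k = l then real n else 0)) * u l\<bar>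
             \<le> K0 * (\<Sum>k=1..p. real k powr lam * (u k)\<^sup>2)"
    and dom: "\<And>k. k \<ge> 1 \<Longrightarrow> K0 * real k powr lam \<le> real n / 2 + 1 / (2 * \<omega> * C') * real k powr (2 * \<beta> + 2 * \<gamma>)"
    and \<omega>: "0 < \<omega>" "\<And>l. l \<in> {1..n} \<Longrightarrow> \<omega> \<le> w l"
    and B: "\<And>k x. k \<ge> 1 \<Longrightarrow> x \<in> {0..1} \<Longrightarrow> \<bar>psi R \<phi> eig k x\<bar> \<le> B"
    and \<alpha>: "2 \<le> 2 * \<beta> + 2 * \<gamma>" and l: "l \<in> {1..n}"
  shows "(\<Sum>k=1..p. design R \<phi> n l k * z k)\<^sup>2 \<le>
    3 * B\<^sup>2 * C' / min (\<omega> * c' / 2) (1 / 2) * min (real n powr (1 / (2 * \<beta> + 2 * \<gamma>))) (real p) / real n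
      * ((\<Sum>k=1..p. real k powr (2 * \<gamma>) * (z k)\<^sup>2) + (\<Sum>l=1..n. w l * (\<Sum>k=1..p. design R \<phi> n l k * z k)\<^sup>2))"
    (is "_ \<le> 3 * B\<^sup>2 * C' / ?e * ?d / real n * ?H")
proof -
  let ?c = "\<lambda>k. real n * real k powr (- 2 * \<beta>) + real k powr (2 * \<gamma>)"
  have e: "0 < ?e" using \<omega> const_ranges by simp
  have C': "0 < C'" using const_ranges by linarith
  have c: "0 < ?c k" if "k \<in> {1..p}" for k using n that by (intro add_pos_pos) auto
  have x: "real l / real n \<in> {0..1}" using l by auto
  have "(design R \<phi> n l k)\<^sup>2 / ?c k \<le> B\<^sup>2 * C' * (1 / (real n + real k powr (2 * \<beta> + 2 * \<gamma>)))" if k: "k \<in> {1..p}" for k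
  proof -
    have ceq: "?c k = real k powr (- 2 * \<beta>) * (real n + real k powr (2 * \<beta> + 2 * \<gamma>))"
      by (simp add: distrib_left powr_add[symmetric])
    have kp: "0 < real k powr (- 2 * \<beta>)" using k by simp
    have "\<bar>psi R \<phi> eig k (real l / real n)\<bar>\<^sup>2 \<le> B\<^sup>2"
      using B[of k, OF _ x] k by (intro power_mono) auto
    then have "(design R \<phi> n l k)\<^sup>2 \<le> eig k * B\<^sup>2"
      using k eig_pos[of k] by (simp add: design_eq power_mult_distrib)
    also have "\<dots> \<le> (C' * real k powr (- 2 * \<beta>)) * B\<^sup>2"
      using eig_bounds[of k] k by (intro mult_right_mono) auto
    finally have "(design R \<phi> n l k)\<^sup>2 / ?c k \<le> (C' * real k powr (- 2 * \<beta>)) * B\<^sup>2 / ?c k"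
      using c[OF k] by (intro divide_right_mono) auto
    also have "\<dots> = B\<^sup>2 * C' * (1 / (real n + real k powr (2 * \<beta> + 2 * \<gamma>)))"
      unfolding ceq using kp by simp
    finally show ?thesis .
  qed
  then have "(\<Sum>k=1..p. (design R \<phi> n l k)\<^sup>2 / ?c k) \<le> B\<^sup>2 * C' * (\<Sum>k=1..p. 1 / (real n + real k powr (2 * \<beta> + 2 * \<gamma>)))"
    unfolding sum_distrib_left by (rule sum_mono)
  also have "\<dots> \<le> B\<^sup>2 * C' * (3 * ?d / real n)"
    using C' by (intro mult_left_mono sum_effective_dimension_le n \<alpha>) auto
  finally have v: "(\<Sum>k=1..p. (design R \<phi> n l k)\<^sup>2 / ?c k) \<le> B\<^sup>2 * C' * (3 * ?d / real n)" .
  have "?e * (\<Sum>k=1..p. ?c k * (z k)\<^sup>2) \<le> ?H"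
    by (rule curvature_lower_bound[OF n p ii dom \<omega>])
  then have H: "(\<Sum>k=1..p. ?c k * (z k)\<^sup>2) \<le> ?H / ?e"
    using e by (simp add: pos_le_divide_eq mult.commute)
  have "(\<Sum>k=1..p. design R \<phi> n l k * z k)\<^sup>2 \<le> (\<Sum>k=1..p. (design R \<phi> n l k)\<^sup>2 / ?c k) * (\<Sum>k=1..p. ?c k * (z k)\<^sup>2)"
    by (rule Cauchy_Schwarz_weighted[OF c])
  also have "\<dots> \<le> (B\<^sup>2 * C' * (3 * ?d / real n)) * (?H / ?e)"
    using v H c C' by (intro mult_mono sum_nonneg) (auto simp: less_imp_le)
  finally show ?thesis by (simp add: mult_ac)
qed

end

section \<open>Uniform constants and the bound for the inverse problem\<close>

theorem corollary3p8:
  fixes E :: "(real \<Rightarrow> real) set"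
    and R Rt :: "(real \<Rightarrow> real) \<Rightarrow> real \<Rightarrow> real"
    and \<phi> :: "nat \<Rightarrow> real \<Rightarrow> real"
    and eig :: "nat \<Rightarrow> real"
    and \<beta> c' C' \<gamma> lam K0 C0 :: real
    and h :: "real \<Rightarrow> real"
  assumes problem: "inverse_problem E R Rt \<phi> eig \<beta> c' C'"
    and h_smooth: "\<And>k s. ((deriv ^^ k) h) differentiable (at s)"
    and h_strictly_convex: "\<And>s t u. s \<noteq> t \<Longrightarrow> 0 < u \<Longrightarrow> u < 1 \<Longrightarrow>
           h (u * s + (1 - u) * t) < u * h s + (1 - u) * h t"
    and h_deriv2_pos: "\<And>s. 0 < (deriv ^^ 2) h s"
    and gamma_nonneg: "0 \<le> \<gamma>"
    and i: "(SUP k\<in>{1..}. sup_norm (psi R \<phi> eig k)) < \<infinity>"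
    and K0_pos: "0 < K0"
    and ii: "\<And>n p u. n \<ge> 1 \<Longrightarrow> p \<ge> 1 \<Longrightarrow>
           \<bar>\<Sum>k=1..p. \<Sum>l=1..p. u k * (Psi_mat R \<phi> eig n k l - (if k = l then real n else 0)) * u l\<bar>
             \<le> K0 * (\<Sum>k=1..p. real k powr lam * (u k)\<^sup>2)"
    and smoothness: "2 * \<gamma> + 2 * \<beta> > max 2 (lam + 1)"
  shows "\<exists>(n0::nat) c K. n0 > 0 \<and> c > 0 \<and> K > 0 \<and>
    (\<forall>\<Y> \<mu> n p Y \<theta>hat.
       exponential_family \<Y> \<mu> h \<longrightarrow> n \<ge> n0 \<longrightarrow> p \<ge> 1 \<longrightarrow> (\<forall>j\<in>{1..n}. Y j \<in> \<Y>) \<longrightarrow>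
       is_arg_min (neg_logpost R \<phi> h \<gamma> n p Y) (\<lambda>\<theta>. \<theta> \<in> space (leb p)) \<theta>hat \<longrightarrow>
       sup_norm (R (q_fun \<phi> p \<theta>hat)) \<le> ereal C0 \<longrightarrow>
       (let m = real n powr (1 / (2 * \<beta> + 2 * \<gamma>));
            \<gamma>0 = \<gamma> - 1 / 2 - 1 / (2 * m);
            m0 = real n powr (1 / (2 * \<beta> + 2 * \<gamma>0));
            r = min m (real p) * sqrt (min m0 (real p)) / sqrt (real n);
            f = neg_logpost R \<phi> h \<gamma> n p Y
        in r \<le> c \<longrightarrow> TV (gibbs p f) (laplace_approx p f \<theta>hat) \<le> K * r))"
proof -
  interpret inverse_problem E R Rt \<phi> eig \<beta> c' C' by (rule problem)
  define \<alpha> where "\<alpha> = 2 * \<beta> + 2 * \<gamma>"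
  have \<alpha>: "2 < \<alpha>" "lam < \<alpha>" using smoothness by (auto simp: \<alpha>_def)
  have C': "0 < C'" using const_ranges by linarith
  obtain B where B: "\<And>k x. k \<ge> 1 \<Longrightarrow> x \<in> {0..1} \<Longrightarrow> \<bar>psi R \<phi> eig k x\<bar> \<le> B" "0 < B"
  proof -
    obtain N :: nat where N: "(SUP k\<in>{1..}. sup_norm (psi R \<phi> eig k)) < ereal (real N)"
      using i less_PInf_Ex_of_nat by (auto simp: less_top)
    have "\<bar>psi R \<phi> eig k x\<bar> \<le> real N + 1" if "k \<ge> 1" "x \<in> {0..1}" for k x
    proof -
      have "ereal \<bar>psi R \<phi> eig k x\<bar> \<le> sup_norm (psi R \<phi> eig k)"
        unfolding sup_norm_def using that by (intro SUP_upper)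
      also have "\<dots> \<le> (SUP k\<in>{1..}. sup_norm (psi R \<phi> eig k))"
        using that by (intro SUP_upper) auto
      also note N
      finally show ?thesis by simp
    qed
    then show ?thesis by (intro that[of "real N + 1"]) auto
  qed
  \<comment> \<open>The absolute value keeps the interval below nonempty for every
    \<open>C0\<close>; its extra margin of 1 leaves room for unit increments from the fitted
    values.\<close>
  define C where "C = \<bar>C0\<bar>"
  note cont = continuous_iterate[OF h_smooth]
  have K: "compact {- (C + 1)..C + 1}" "{- (C + 1)..C + 1} \<noteq> {}" by (auto simp: C_def)
  obtain ulo where ulo: "\<And>u. \<bar>u\<bar> \<le> C + 1 \<Longrightarrow> (deriv ^^ 2) h ulo \<le> (deriv ^^ 2) h u"
    using continuous_attains_inf[OF K cont[of _ 2]] by (metis abs_le_iff atLeastAtMost_iff minus_le_iff)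
  obtain uhi where uhi: "\<And>u. \<bar>u\<bar> \<le> C + 1 \<Longrightarrow> (deriv ^^ 2) h u \<le> (deriv ^^ 2) h uhi"
    using continuous_attains_sup[OF K cont[of _ 2]] by (metis abs_le_iff atLeastAtMost_iff minus_le_iff)
  obtain u3 where u3: "\<And>u. \<bar>u\<bar> \<le> C + 1 \<Longrightarrow> \<bar>(deriv ^^ 3) h u\<bar> \<le> \<bar>(deriv ^^ 3) h u3\<bar>"
    using continuous_attains_sup[OF K continuous_on_rabs[OF cont[of _ 3]]] by (metis abs_le_iff atLeastAtMost_iff minus_le_iff)
  define wlo whi L where "wlo = (deriv ^^ 2) h ulo" and "whi = (deriv ^^ 2) h uhi" and "L = \<bar>(deriv ^^ 3) h u3\<bar> + 1"
  have wlo: "0 < wlo" "\<And>u. \<bar>u\<bar> \<le> C + 1 \<Longrightarrow> wlo \<le> (deriv ^^ 2) h u"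
    using h_deriv2_pos ulo by (auto simp: wlo_def)
  have whi: "0 < whi" "\<And>u. \<bar>u\<bar> \<le> C + 1 \<Longrightarrow> (deriv ^^ 2) h u \<le> whi"
    using h_deriv2_pos uhi by (auto simp: whi_def)
  have L: "0 < L" "\<And>u. \<bar>u\<bar> \<le> C + 1 \<Longrightarrow> \<bar>(deriv ^^ 3) h u\<bar> \<le> L"
    using u3 by (auto simp: L_def intro: add_increasing2)
  have "0 < 1 / (2 * wlo * C')" using wlo(1) C' by simp
  from powr_dominated[OF K0_pos this \<alpha>(2)] obtain n0 :: nat where n0: "1 \<le> n0"
    "\<And>n k. n0 \<le> n \<Longrightarrow> 1 \<le> k \<Longrightarrow> K0 * real k powr lam \<le> real n / 2 + 1 / (2 * wlo * C') * real k powr \<alpha>"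
    by blast
  define S where "S = 3 * B\<^sup>2 * C' / min (wlo * c' / 2) (1 / 2)"
  have S: "0 < S" using B C' wlo(1) const_ranges by (simp add: S_def)
  define E' where "E' = 8 * whi * S / (wlo / whi) + 1"
  have E': "0 < E'" using S wlo(1) whi(1) by (simp add: E'_def add_pos_pos)
  \<comment> \<open>The last two smallness conditions of \<open>TV_laplace_le\<close> read
    \<open>P1 * d \<le> \<nu>\<close> and \<open>P2 * d \<le> \<nu>\<close>. Together with
    \<open>d \<le> \<nu>\<close> they follow from \<open>d / \<nu> \<le> \<epsilon>\<close>.\<close>
  define P1 P2 where "P1 = 8 * L * S * sqrt (4 * E' / (wlo / whi * wlo))" and "P2 = 4 * S * E' / (wlo / whi)"
  have P: "0 \<le> P1" "0 \<le> P2" using L(1) S E' wlo(1) whi(1) by (auto simp: P1_def P2_def)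
  define \<epsilon> where "\<epsilon> = 1 / (1 + P1 + P2)"
  have \<epsilon>: "0 < \<epsilon>" using P by (simp add: \<epsilon>_def)
  define K where "K = 2 * (256 * exp 2 * L * (S * sqrt S) + 15625)"
  have Kpos: "0 < K" using L(1) S by (simp add: K_def add_pos_pos)
  have main: "TV (gibbs p (neg_logpost R \<phi> h \<gamma> n p Y)) (laplace_approx p (neg_logpost R \<phi> h \<gamma> n p Y) \<theta>hat) \<le> K * r"
    if n: "n0 \<le> n" and p: "1 \<le> p"
      and min: "is_arg_min (neg_logpost R \<phi> h \<gamma> n p Y) (\<lambda>\<theta>. \<theta> \<in> space (leb p)) \<theta>hat"
      and sup: "sup_norm (R (q_fun \<phi> p \<theta>hat)) \<le> ereal C0"
      and m: "m = real n powr (1 / (2 * \<beta> + 2 * \<gamma>))"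
      and \<gamma>0: "\<gamma>0 = \<gamma> - 1 / 2 - 1 / (2 * m)" and m0: "m0 = real n powr (1 / (2 * \<beta> + 2 * \<gamma>0))"
      and r: "r = min m (real p) * sqrt (min m0 (real p)) / sqrt (real n)" and rc: "r \<le> \<epsilon> * sqrt \<epsilon>"
    for n p Y \<theta>hat m \<gamma>0 m0 r
  proof -
    have n1: "1 \<le> n" using n n0(1) by linarith
    define d where "d = min m (real p)"
    have m1: "1 \<le> m" unfolding m using n1 \<alpha> by (simp add: \<alpha>_def ge_one_powr_ge_zero)
    have d1: "1 \<le> d" using m1 p by (simp add: d_def)
    \<comment> \<open>Passing from \<open>\<gamma>\<close> to \<open>\<gamma>0\<close> lowers the
      denominator of the exponent by \<open>1 + 1 / m\<close>, which lies between 1 and 2. Since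
      \<open>\<alpha> > 2\<close> it stays positive, whence \<open>m \<le> m0\<close>.\<close>
    have "1 / m \<le> 1" "0 \<le> 1 / m" using m1 by auto
    moreover have "2 * \<gamma>0 = 2 * \<gamma> - 1 - 1 / m" by (simp add: \<gamma>0)
    ultimately have "0 < 2 * \<beta> + 2 * \<gamma>0" "2 * \<beta> + 2 * \<gamma>0 \<le> 2 * \<beta> + 2 * \<gamma>"
      using \<alpha>(1) unfolding \<alpha>_def by linarith+
    then have "1 / (2 * \<beta> + 2 * \<gamma>) \<le> 1 / (2 * \<beta> + 2 * \<gamma>0)" by (intro divide_left_mono mult_pos_pos) auto
    then have "m \<le> m0" unfolding m m0 using n1 by (intro powr_mono) auto
    then have "d \<le> min m0 (real p)" by (auto simp: d_def)
    then have r0: "d * sqrt d / sqrt (real n) \<le> r"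
      unfolding r d_def[symmetric] using d1 by (intro divide_right_mono mult_left_mono) auto
    define \<nu> where "\<nu> = root 3 (real n)"
    have \<nu>: "\<nu> ^ 3 = real n" "0 < \<nu>" using n1 by (auto simp: \<nu>_def)
    have "sqrt (real n) = sqrt (\<nu> * \<nu> * \<nu>)" using \<nu>(1) by (simp add: power3_eq_cube)
    then have sqrt_n: "sqrt (real n) = \<nu> * sqrt \<nu>" using \<nu>(2) by (simp add: real_sqrt_mult)
    \<comment> \<open>The left side equals \<open>d * sqrt d / sqrt n\<close>. As
      \<open>x * sqrt x\<close> is increasing, the threshold
      \<open>\<epsilon> * sqrt \<epsilon>\<close> for \<open>r\<close> is exactly what forces
      \<open>d / \<nu> \<le> \<epsilon>\<close>.\<close>
    have "(d / \<nu>) * sqrt (d / \<nu>) \<le> \<epsilon> * sqrt \<epsilon>"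
      using r0 rc by (simp add: sqrt_n real_sqrt_divide)
    moreover have "\<epsilon> * sqrt \<epsilon> < (d / \<nu>) * sqrt (d / \<nu>)" if "\<epsilon> < d / \<nu>"
      using that \<epsilon> by (intro mult_strict_mono) auto
    ultimately have "d / \<nu> \<le> \<epsilon>" by linarith
    then have dP: "d * (1 + P1 + P2) \<le> \<nu>"
      using \<nu>(2) P by (simp add: \<epsilon>_def pos_le_divide_eq pos_divide_le_eq)
    have dP': "d \<le> \<nu>" "P1 * d \<le> \<nu>" "P2 * d \<le> \<nu>"
    proof -
      have "0 \<le> P1 * d" "0 \<le> P2 * d" using P d1 by auto
      then show "d \<le> \<nu>" "P1 * d \<le> \<nu>" "P2 * d \<le> \<nu>" using dP d1 by (auto simp: algebra_simps)
    qed
    interpret G: penalized_glm h "design R \<phi> n" Y "\<lambda>k. real k powr (2 * \<gamma>)" n p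
      by standard (rule h_smooth)
    have F: "neg_logpost R \<phi> h \<gamma> n p Y = G.F"
      by (simp add: fun_eq_iff neg_logpost_def neg_loglik_def G.F_def G.s_def)
    have sC: "\<bar>G.s l \<theta>hat\<bar> \<le> C" if l: "l \<in> {1..n}" for l
    proof -
      have x: "real l / real n \<in> {0..1}" using l by auto
      have "ereal \<bar>R (q_fun \<phi> p \<theta>hat) (real l / real n)\<bar> \<le> sup_norm (R (q_fun \<phi> p \<theta>hat))"
        unfolding sup_norm_def using x by (intro SUP_upper)
      also note sup
      finally have "\<bar>R (q_fun \<phi> p \<theta>hat) (real l / real n)\<bar> \<le> C0" by simp
      then show ?thesis using R_q_fun[OF x, of p \<theta>hat] by (simp add: G.s_def design_def C_def)
    qed
    have var: "(\<Sum>k=1..p. design R \<phi> n l k * z k)\<^sup>2 \<le> S * d / real n *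
        ((\<Sum>k=1..p. real k powr (2 * \<gamma>) * (z k)\<^sup>2) + (\<Sum>l=1..n. (deriv ^^ 2) h (G.s l \<theta>hat) * (\<Sum>k=1..p. design R \<phi> n l k * z k)\<^sup>2))"
      if l: "l \<in> {1..n}" for l z
      unfolding S_def d_def m
    proof (rule variance_bound[OF n1 p ii[OF n1 p] n0(2)[OF n, unfolded \<alpha>_def] wlo(1) _ B(1) _ l])
      show "wlo \<le> (deriv ^^ 2) h (G.s l \<theta>hat)" if "l \<in> {1..n}" for l
        using sC[OF that] by (intro wlo(2)) linarith
      show "2 \<le> 2 * \<beta> + 2 * \<gamma>" using \<alpha>(1) by (simp add: \<alpha>_def)
    qed
    have "4 * S * E' * d \<le> wlo / whi * \<nu>"
      using dP'(3) wlo(1) whi(1) by (simp add: P2_def field_simps)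
    then have "TV (gibbs p G.F) (laplace_approx p G.F \<theta>hat) \<le> 2 * ((256 * exp 2 * L * (S * sqrt S) + 15625) * (d * sqrt d / sqrt (real n)))"
      using dP'(1) dP'(2)[unfolded P1_def] min[unfolded F] n1 sC
      by (intro G.TV_laplace_le[OF h_strictly_convex _ _ _ _ L wlo whi(2) S d1 var \<nu>(1) E'_def]) auto
    also have "\<dots> = K * (d * sqrt d / sqrt (real n))" by (simp add: K_def)
    also have "\<dots> \<le> K * r" using Kpos r0 by (intro mult_left_mono) auto
    finally show ?thesis unfolding F .
  qed
  show ?thesis
    unfolding Let_def
  proof (rule exI[of _ n0], rule exI[of _ "\<epsilon> * sqrt \<epsilon>"], rule exI[of _ K], intro conjI allI impI)
    show "0 < n0" "0 < \<epsilon> * sqrt \<epsilon>" "0 < K" using n0(1) \<epsilon> Kpos by auto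
  qed (rule main, (assumption | rule refl)+)
qed

end
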